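(* Let $\phi:\mathbb{R}^d\to\mathbb{R}$ be a radial basis function, conditionally positive definite of order $m_0$, whose generalized Fourier transform satisfies, for some exponent $\tau>d/2$ and constants $0<C_1\le C_2$, $r_0>0$, $$C_1(1+|\omega|^2)^{-\tau}\le\widehat\phi(\omega)\ \text{ for all }\omega\in\mathbb{R}^d\setminus\{0\},\qquad \widehat\phi(\omega)\le C_2|\omega|^{-2\tau}\ \text{ for all }|\omega|>r_0 .$$ Let $0\le s<\tau-d/2$. Then there is a constant $C$ such that for every finite set $\Xi\subset\mathbb{R}^d$ with separation radius $q<1$ and every $u\in V_\Xi(\phi)$, $$|\mathcal{J}_s u|_{\mathcal{N}(\phi)}\le C\,q^{-s}\,|u|_{\mathcal{N}(\phi)} .$$
   Context: $\mathcal{P}_k$ denotes polynomials on $\mathbb{R}^d$ of degree at most $k$ ($\mathcal{P}_k=\{0\}$ for $k<0$). Separation radius: $q=\frac12\min_{\xi\in\Xi}\mathrm{dist}(\xi,\Xi\setminus\{\xi\})$. Fourier transform: $\mathcal{F}\gamma(\omega)=(2\pi)^{-d/2}\int\gamma(x)e^{-ix\cdot\omega}dx$. For $m\ge0$ let $\mathcal{S}_m=\{\gamma\in\mathcal{S}(\mathbb{R}^d):\sup_{\omega\ne0}|\omega|^{-m}|\gamma(\omega)|<\infty\}$. A tempered distribution $g$ has generalized Fourier transform $\widehat g$ of order $m$ if $\widehat g$ is a measurable function on $\mathbb{R}^d\setminus\{0\}$ with $\int\widehat g\,\gamma\,d\omega=\langle g,\mathcal{F}\gamma\rangle$ for all $\gamma\in\mathcal{S}_{2m}$.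 $\phi$ is conditionally positive definite (CPD) of order $m_0$ if for every finite $\Xi\subset\mathbb{R}^d$ the matrix $(\phi(\xi-\zeta))_{\xi,\zeta\in\Xi}$ is strictly positive definite on $\{a\in\mathbb{R}^\Xi:\sum_\xi a_\xi p(\xi)=0\ \forall p\in\mathcal{P}_{m_0-1}\}$ (positive definite when $m_0\le 0$). A radial basis function is a rotationally symmetric CPD function. Standing assumption: $\phi$ is continuous, grows at most algebraically, and has a continuous generalized Fourier transform $\widehat\phi$ of order $m_0$. $V_\Xi(\phi)=\{\sum_{\xi\in\Xi}a_\xi\phi(\cdot-\xi):\sum_\xi a_\xi p(\xi)=0\ \forall p\in\mathcal{P}_{m_0-1}\}+\mathcal{P}_{m_0-1}$. Native space seminorm: $|f|_{\mathcal{N}(\phi)}^2=\int_{\mathbb{R}^d}|\widehat f(\omega)|^2/\widehat\phi(\omega)\,d\omega$ where $\widehat f$ is the generalized Fourier transform of $f$ (of order $m_0/2$); its nullspace is $\mathcal{P}_{m_0-1}$. $\mathcal{J}_s$ is the Bessel potential operator on tempered distributions: $\mathcal{F}(\mathcal{J}_sf)=(1+|\omega|^2)^{s/2}\mathcal{F}f$. It preserves each $\mathcal{P}_k$. *)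

theory Defs
  imports "HOL-Analysis.Analysis"
begin

text \<open>The degree bound is an integer, so that negative \<open>k\<close> gives \<open>{0}\<close>.\<close>

definition multi_indices :: "int \<Rightarrow> ('n::finite \<Rightarrow> nat) set" where
  "multi_indices k = {\<alpha>. int (\<Sum>i\<in>UNIV. \<alpha> i) \<le> k}"

lemma finite_multi_indices: "finite (multi_indices k :: ('n::finite \<Rightarrow> nat) set)"
proof (rule finite_subset)
  show "(multi_indices k :: ('n \<Rightarrow> nat) set) \<subseteq> PiE UNIV (\<lambda>_. {..nat k})"
  proof
    fix \<alpha> :: "'n \<Rightarrow> nat"
    assume \<alpha>: "\<alpha> \<in> multi_indices k"
    have "\<alpha> i \<le> nat k" for i
    proof -
      have "\<alpha> i \<le> sum \<alpha> UNIV"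
        by (rule member_le_sum) simp_all
      moreover have "int (sum \<alpha> UNIV) \<le> k"
        using \<alpha> unfolding multi_indices_def mem_Collect_eq .
      ultimately show ?thesis by linarith
    qed
    then show "\<alpha> \<in> PiE UNIV (\<lambda>_. {..nat k})" by (simp add: PiE_def extensional_def)
  qed
  show "finite (PiE UNIV (\<lambda>_. {..nat k}) :: ('n \<Rightarrow> nat) set)"
    by (rule finite_PiE) simp_all
qed

definition polynomials :: "int \<Rightarrow> (real ^ 'n \<Rightarrow> real) set" where
  "polynomials k =
     {p. \<exists>c. \<forall>x. p x = (\<Sum>\<alpha>\<in>multi_indices k. c \<alpha> * (\<Prod>i\<in>UNIV. (x $ i) ^ \<alpha> i))}"

text \<open>Extended-real valued, so that the distance to the empty set is \<open>\<infinity>\<close>; hence the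
  separation radius of a set with at most one point is \<open>\<infinity>\<close>.\<close>

definition separation_radius :: "(real ^ 'n) set \<Rightarrow> ereal" where
  "separation_radius \<Xi> = ereal (1/2) * (INF \<xi>\<in>\<Xi>. INF \<zeta>\<in>\<Xi> - {\<xi>}. ereal (dist \<xi> \<zeta>))"

text \<open>Iterated partial derivatives are indexed by lists of coordinates rather than by
  multi-indices.\<close>

primrec iter_partial :: "'n list \<Rightarrow> (real ^ 'n \<Rightarrow> complex) \<Rightarrow> real ^ 'n \<Rightarrow> complex" where
  "iter_partial [] f = f"
| "iter_partial (i # is) f = (\<lambda>x. frechet_derivative (iter_partial is f) (at x) (axis i 1))"

definition smooth :: "(real ^ 'n \<Rightarrow> complex) \<Rightarrow> bool" where
  "smooth f \<longleftrightarrow> (\<forall>is x. iter_partial is f differentiable (at x))"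

definition schwartz :: "(real ^ 'n \<Rightarrow> complex) set" where
  "schwartz = {\<gamma>. smooth \<gamma> \<and>
     (\<forall>is k. \<exists>B. \<forall>x. (1 + norm x) ^ k * cmod (iter_partial is \<gamma> x) \<le> B)}"

definition schwartz_norm :: "nat \<Rightarrow> (real ^ 'n \<Rightarrow> complex) \<Rightarrow> real" where
  "schwartz_norm N \<gamma> =
     (\<Sum>is | length is \<le> N. SUP x. (1 + norm x) ^ N * cmod (iter_partial is \<gamma> x))"

lemma finite_partial_indices: "finite {is :: 'n::finite list. length is \<le> N}"
  using finite_lists_length_le[of "UNIV :: 'n set" N] by simp

text \<open>A distribution is a functional on all functions, of which only the values on
  \<^const>\<open>schwartz\<close> matter. Pairings are bilinear (no complex conjugation).\<close>

definition tempered_distribution :: "((real ^ 'n \<Rightarrow> complex) \<Rightarrow> complex) \<Rightarrow> bool" where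
  "tempered_distribution T \<longleftrightarrow>
     (\<forall>\<gamma>\<in>schwartz. \<forall>\<eta>\<in>schwartz. \<forall>c. T (\<lambda>x. c * \<gamma> x + \<eta> x) = c * T \<gamma> + T \<eta>) \<and>
     (\<exists>C N. \<forall>\<gamma>\<in>schwartz. cmod (T \<gamma>) \<le> C * schwartz_norm N \<gamma>)"

definition distr_of :: "(real ^ 'n \<Rightarrow> real) \<Rightarrow> (real ^ 'n \<Rightarrow> complex) \<Rightarrow> complex" where
  "distr_of f \<gamma> = (LINT x|lborel. complex_of_real (f x) * \<gamma> x)"

definition fourier :: "(real ^ 'n \<Rightarrow> complex) \<Rightarrow> real ^ 'n \<Rightarrow> complex" where
  "fourier \<gamma> \<omega> = complex_of_real ((2 * pi) powr (- real CARD('n) / 2)) *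
     (LINT x|lborel. \<gamma> x * exp (- (\<i> * complex_of_real (x \<bullet> \<omega>))))"

definition inv_fourier :: "(real ^ 'n \<Rightarrow> complex) \<Rightarrow> real ^ 'n \<Rightarrow> complex" where
  "inv_fourier \<gamma> x = complex_of_real ((2 * pi) powr (- real CARD('n) / 2)) *
     (LINT \<omega>|lborel. \<gamma> \<omega> * exp (\<i> * complex_of_real (x \<bullet> \<omega>)))"

definition fourier_distr ::
  "((real ^ 'n \<Rightarrow> complex) \<Rightarrow> complex) \<Rightarrow> (real ^ 'n \<Rightarrow> complex) \<Rightarrow> complex" where
  "fourier_distr T = (\<lambda>\<gamma>. T (fourier \<gamma>))"

definition inv_fourier_distr ::
  "((real ^ 'n \<Rightarrow> complex) \<Rightarrow> complex) \<Rightarrow> (real ^ 'n \<Rightarrow> complex) \<Rightarrow> complex" where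
  "inv_fourier_distr T = (\<lambda>\<gamma>. T (inv_fourier \<gamma>))"

definition mult_distr :: "(real ^ 'n \<Rightarrow> real) \<Rightarrow>
  ((real ^ 'n \<Rightarrow> complex) \<Rightarrow> complex) \<Rightarrow> (real ^ 'n \<Rightarrow> complex) \<Rightarrow> complex" where
  "mult_distr w T = (\<lambda>\<gamma>. T (\<lambda>\<omega>. complex_of_real (w \<omega>) * \<gamma> \<omega>))"

definition bessel_potential :: "real \<Rightarrow>
  ((real ^ 'n \<Rightarrow> complex) \<Rightarrow> complex) \<Rightarrow> (real ^ 'n \<Rightarrow> complex) \<Rightarrow> complex" where
  "bessel_potential s T =
     inv_fourier_distr (mult_distr (\<lambda>\<omega>. (1 + (norm \<omega>)\<^sup>2) powr (s / 2)) (fourier_distr T))"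

definition schwartz_vanishing :: "real \<Rightarrow> (real ^ 'n \<Rightarrow> complex) set" where
  "schwartz_vanishing m =
     {\<gamma> \<in> schwartz. \<exists>B. \<forall>\<omega>. \<omega> \<noteq> 0 \<longrightarrow> norm \<omega> powr (- m) * cmod (\<gamma> \<omega>) \<le> B}"

text \<open>The order may be a half-integer. The origin is a null set, so the value of \<open>g\<close>
  there is irrelevant.\<close>

definition has_gen_fourier :: "real \<Rightarrow>
  ((real ^ 'n \<Rightarrow> complex) \<Rightarrow> complex) \<Rightarrow> (real ^ 'n \<Rightarrow> complex) \<Rightarrow> bool" where
  "has_gen_fourier m T g \<longleftrightarrow>
     tempered_distribution T \<and>
     g \<in> borel_measurable (restrict_space borel (- {0})) \<and>
     (\<forall>\<gamma>\<in>schwartz_vanishing (2 * m).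
        integrable lborel (\<lambda>\<omega>. g \<omega> * \<gamma> \<omega>) \<and>
        (LINT \<omega>|lborel. g \<omega> * \<gamma> \<omega>) = T (fourier \<gamma>))"

text \<open>The generalized Fourier transform is determined almost everywhere, so the choice
  affects none of the integrals below.\<close>

definition gen_fourier :: "real \<Rightarrow>
  ((real ^ 'n \<Rightarrow> complex) \<Rightarrow> complex) \<Rightarrow> real ^ 'n \<Rightarrow> complex" where
  "gen_fourier m T = (SOME g. has_gen_fourier m T g)"

definition cond_pos_def :: "int \<Rightarrow> (real ^ 'n \<Rightarrow> real) \<Rightarrow> bool" where
  "cond_pos_def m \<phi> \<longleftrightarrow>
     (\<forall>\<Xi> a. finite \<Xi> \<longrightarrow>
        (\<forall>p\<in>polynomials (m - 1). (\<Sum>\<xi>\<in>\<Xi>. a \<xi> * p \<xi>) = 0) \<longrightarrow> (\<exists>\<xi>\<in>\<Xi>. a \<xi> \<noteq> 0) \<longrightarrow>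
        (\<Sum>\<xi>\<in>\<Xi>. \<Sum>\<zeta>\<in>\<Xi>. a \<xi> * a \<zeta> * \<phi> (\<xi> - \<zeta>)) > 0)"

definition radial_basis_function :: "int \<Rightarrow> (real ^ 'n \<Rightarrow> real) \<Rightarrow> bool" where
  "radial_basis_function m \<phi> \<longleftrightarrow>
     (\<forall>x y. norm x = norm y \<longrightarrow> \<phi> x = \<phi> y) \<and> cond_pos_def m \<phi>"

definition algebraic_growth :: "(real ^ 'n \<Rightarrow> real) \<Rightarrow> bool" where
  "algebraic_growth f \<longleftrightarrow> (\<exists>B k. \<forall>x. \<bar>f x\<bar> \<le> B * (1 + norm x) ^ k)"

definition rbf_space ::
  "int \<Rightarrow> (real ^ 'n \<Rightarrow> real) \<Rightarrow> (real ^ 'n) set \<Rightarrow> (real ^ 'n \<Rightarrow> real) set" where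
  "rbf_space m \<phi> \<Xi> =
     {u. \<exists>a. \<exists>p\<in>polynomials (m - 1).
        (\<forall>r\<in>polynomials (m - 1). (\<Sum>\<xi>\<in>\<Xi>. a \<xi> * r \<xi>) = 0) \<and>
        u = (\<lambda>x. (\<Sum>\<xi>\<in>\<Xi>. a \<xi> * \<phi> (x - \<xi>)) + p x)}"

text \<open>Both notions take the generalized Fourier transform \<open>w\<close> of the basis function as
  argument. Outside \<open>native_space\<close>, where the seminorm is infinite or undefined,
  \<open>native_seminorm\<close> has no meaning.\<close>

definition native_space ::
  "int \<Rightarrow> (real ^ 'n \<Rightarrow> real) \<Rightarrow> ((real ^ 'n \<Rightarrow> complex) \<Rightarrow> complex) set" where
  "native_space m w =
     {T. (\<exists>g. has_gen_fourier (of_int m / 2) T g) \<and>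
         integrable lborel (\<lambda>\<omega>. (cmod (gen_fourier (of_int m / 2) T \<omega>))\<^sup>2 / w \<omega>)}"

definition native_seminorm ::
  "int \<Rightarrow> (real ^ 'n \<Rightarrow> real) \<Rightarrow> ((real ^ 'n \<Rightarrow> complex) \<Rightarrow> complex) \<Rightarrow> real" where
  "native_seminorm m w T =
     sqrt (LINT \<omega>|lborel. (cmod (gen_fourier (of_int m / 2) T \<omega>))\<^sup>2 / w \<omega>)"

end

(* The generalized Fourier transform does not see the polynomial part of u, so that of u is
   phihat * A, where A is the exponential sum of the coefficients, and the squared seminorms of u and J_s u are the integrals
   of phihat |A|^2 and of (1 + |w|^2)^s phihat |A|^2. On |w| <= R/q the additional weight is at
   most of order q^(-2s). On |w| > R/q, phihat is comparable to |w|^(-2 tau), and there the energy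
   of A is controlled by its energy on |w| <= R/q: for points of separation q, both are comparable
   to the sum of the squared coefficients, because averages of |A|^2 against Gaussians of width of
   order 1/q are. *)

theory Submission
  imports Defs "HOL-Probability.Characteristic_Functions"
begin

section \<open>Integration on Euclidean space\<close>

text \<open>Near the origin phihat has no upper bound, so it is never estimated there: the weight is
  pulled out of the low-frequency integral, and integrability of phihat |A|^2 comes from the
  definition of the generalized transform, tested with |A|^2 times a Gaussian. This is admissible
  because the moment conditions make A vanish to order m0. The seminorm rests on a chosen transform,
  so almost everywhere uniqueness must be shown as well. The Gaussian averages are controlled by
  diagonal dominance: integrated against a Gaussian, |A|^2 gives the squared coefficients on the
  diagonal and, off it, the transformed Gaussian at differences of points, which is small for
  separated points. Its centre changes only phases, so one bound serves all centres. As a Gaussian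
  is not compactly supported, R has to be large enough to absorb what lies outside. The tail weight
  |w|^(-p), p = 2 tau - 2 s, is dominated by a superposition of Gaussians with centres distributed
  like (1 + |z|)^(-p); this needs p > d, the condition s < tau - d/2.\<close>

lemma nn_integral_lborel_affine:
  fixes t :: "'a::euclidean_space"
  assumes [measurable]: "f \<in> borel_measurable borel" and c: "c \<noteq> 0"
  shows "(\<integral>\<^sup>+x. f x \<partial>lborel) = ennreal (\<bar>c\<bar> ^ DIM('a)) * (\<integral>\<^sup>+x. f (t + c *\<^sub>R x) \<partial>lborel)"
  by (subst lborel_affine[OF c, of t])
     (simp add: nn_integral_density nn_integral_distr nn_integral_cmult)

lemma integral_lborel_affine:
  fixes f :: "'a::euclidean_space \<Rightarrow> 'b::{banach, second_countable_topology}"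
  assumes [measurable]: "f \<in> borel_measurable borel" and c: "c \<noteq> 0"
  shows "(LINT x|lborel. f x) = \<bar>c\<bar> ^ DIM('a) *\<^sub>R (LINT x|lborel. f (t + c *\<^sub>R x))"
  by (subst lborel_affine[OF c, of t])
     (simp add: integral_density integral_distr)

lemma integrable_lborel_affine:
  fixes f :: "'a::euclidean_space \<Rightarrow> 'b::{banach, second_countable_topology}"
  assumes f: "integrable lborel f" and c: "c \<noteq> 0"
  shows "integrable lborel (\<lambda>x. f (t + c *\<^sub>R x))"
proof -
  have [measurable]: "f \<in> borel_measurable borel"
    using f by auto
  have "(\<integral>\<^sup>+x. norm (f x) \<partial>lborel) < \<infinity>"
    using f by (simp add: integrable_iff_bounded)
  then have "(\<integral>\<^sup>+x. norm (f (t + c *\<^sub>R x)) \<partial>lborel) < \<infinity>"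
    using c by (subst (asm) nn_integral_lborel_affine[of _ c t])
      (auto simp: ennreal_mult_less_top)
  then show ?thesis by (simp add: integrable_iff_bounded)
qed

lemma integral_lborel_translate:
  fixes f :: "'a::euclidean_space \<Rightarrow> 'b::{banach, second_countable_topology}"
  assumes "f \<in> borel_measurable borel"
  shows "(LINT x|lborel. f (x + t)) = (LINT x|lborel. f x)"
  using integral_lborel_affine[OF assms, of 1 t] by (simp add: add.commute)

lemma integrable_lborel_translate:
  fixes f :: "'a::euclidean_space \<Rightarrow> 'b::{banach, second_countable_topology}"
  assumes "integrable lborel f"
  shows "integrable lborel (\<lambda>x. f (x + t))"
  using integrable_lborel_affine[OF assms, of 1 t] by (simp add: add.commute)

lemma ennreal_le_suminf:
  fixes f :: "nat \<Rightarrow> ennreal"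
  shows "f k \<le> (\<Sum>k. f k)"
  using sum_le_suminf[of f "{k}"] by simp

text \<open>Dyadic comparison: where 1 + |x| lies between 2^k and 2^(k+1) the integrand is at most
  2^(-kp), and the ball of radius 2^(k+1) has volume of order 2^(kd), so the total is bounded by a
  geometric series of ratio 2^(d-p) < 1.\<close>

lemma integrable_japanese_bracket:
  fixes p :: real
  assumes p: "p > DIM('a::euclidean_space)"
  shows "integrable lborel (\<lambda>x::'a. (1 + norm x) powr (-p))"
proof -
  define V where "V = unit_ball_vol DIM('a)"
  define r where "r = 2 powr (DIM('a) - p)"
  have r: "0 < r" "r < 1" using p unfolding r_def by (auto simp: powr_less_one)
  have V: "V \<ge> 0" unfolding V_def by simp
  have pw: "ennreal ((1 + norm x) powr (-p)) \<le>
      (\<Sum>k. ennreal ((2^k) powr (-p)) * indicator (ball 0 (2^(k+1))) x)" for x :: 'a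
  proof -
    define k where "k = nat \<lfloor>log 2 (1 + norm x)\<rfloor>"
    have l0: "0 \<le> log 2 (1 + norm x)"
      using zero_le_log_cancel_iff[of 2 "1 + norm x"] by (simp add: add_pos_nonneg)
    have kr: "real k \<le> log 2 (1 + norm x)" "log 2 (1 + norm x) < real (k+1)"
      unfolding k_def using l0 by linarith+
    have "2 powr (real k) \<le> 2 powr (log 2 (1 + norm x))" "2 powr (log 2 (1 + norm x)) < 2 powr (real (k+1))"
      using kr by (simp_all add: powr_less_mono)
    then have a: "2 ^ k \<le> 1 + norm x" "1 + norm x < 2^(k+1)"
      using norm_ge_zero[of x]
      using powr_realpow[of 2 k] powr_realpow[of 2 "k+1"]
      by (simp_all add: add_pos_nonneg del: of_nat_add power_Suc)
    have "(1 + norm x) powr (-p) \<le> (2^k) powr (-p)"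
      using a(1) p by (intro powr_mono2') auto
    moreover have "x \<in> ball 0 (2^(k+1))" using a(2) by simp
    ultimately have "ennreal ((1 + norm x) powr (-p)) \<le> ennreal ((2^k) powr (-p)) * indicator (ball 0 (2^(k+1))) x"
      by (auto intro!: ennreal_leI)
    also have "\<dots> \<le> (\<Sum>k. ennreal ((2^k) powr (-p)) * indicator (ball 0 (2^(k+1))) x)"
      by (rule ennreal_le_suminf)
    finally show ?thesis .
  qed
  have "integral\<^sup>N lborel (\<lambda>x::'a. ennreal ((1 + norm x) powr (-p))) \<le>
     integral\<^sup>N lborel (\<lambda>x::'a. (\<Sum>k. ennreal ((2^k) powr (-p)) * indicator (ball 0 (2^(k+1))) x))"
    by (intro nn_integral_mono pw)
  also have "\<dots> = (\<Sum>k. ennreal ((2^k) powr (-p)) * emeasure lborel (ball (0::'a) (2^(k+1))))"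
  proof (subst nn_integral_suminf)
    show "(\<lambda>x::'a. ennreal ((2^k) powr (-p)) * indicator (ball 0 (2^(k+1))) x) \<in> borel_measurable lborel" for k :: nat
      by (intro borel_measurable_times_ennreal borel_measurable_const borel_measurable_indicator) simp
    show "(\<Sum>k. integral\<^sup>N lborel (\<lambda>x::'a. ennreal ((2^k) powr (-p)) * indicator (ball 0 (2^(k+1))) x)) =
        (\<Sum>k. ennreal ((2^k) powr (-p)) * emeasure lborel (ball (0::'a) (2^(k+1))))"
      by (intro suminf_cong nn_integral_cmult_indicator) simp
  qed
  also have "\<dots> = (\<Sum>k. ennreal (V * 2^DIM('a) * r ^ k))"
  proof (intro suminf_cong)
    fix k :: nat
    have "(2^k) powr (-p) * (2^(k+1))^DIM('a) = 2^DIM('a) * r ^ k"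
    proof -
      have "(2::real)^k = 2 powr k" by (simp add: powr_realpow)
      moreover have "((2::real)^(k+1))^DIM('a) = 2 powr (real (k+1) * DIM('a))"
        unfolding power_mult[symmetric] of_nat_mult[symmetric] by (rule powr_realpow[symmetric]) simp
      moreover have "(2 powr k) powr (-p) * 2 powr (real (k+1) * DIM('a)) = 2 powr DIM('a) * (2 powr (DIM('a) - p)) powr k"
        unfolding powr_powr powr_add[symmetric] by (simp add: algebra_simps)
      ultimately have "(2^k) powr (-p) * (2^(k+1))^DIM('a) = 2 powr DIM('a) * (2 powr (DIM('a) - p)) powr k"
        by (simp only:)
      also have "\<dots> = 2^DIM('a) * r ^ k" using r by (simp add: r_def powr_realpow)
      finally show ?thesis .
    qed
    then show "ennreal ((2^k) powr (-p)) * emeasure lborel (ball (0::'a) (2^(k+1))) = ennreal (V * 2^DIM('a) * r ^ k)"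
      by (subst emeasure_ball) (auto simp: V_def[symmetric] ennreal_mult'[symmetric] mult_ac)
  qed
  also have "\<dots> < \<infinity>"
    unfolding infinity_ennreal_def less_top[symmetric]
    using r V by (intro ennreal_suminf_neq_top) (auto intro!: summable_mult summable_geometric)
  finally have "integral\<^sup>N lborel (\<lambda>x::'a. ennreal ((1 + norm x) powr (-p))) < \<infinity>" .
  then show ?thesis by (intro integrableI_nonneg) auto
qed

section \<open>Fourier transforms of Gaussians\<close>

lemma gaussian_fourier_real:
  "has_bochner_integral lborel (\<lambda>x. complex_of_real (exp (- x\<^sup>2 / 2)) * iexp (t * x))
     (complex_of_real (sqrt (2 * pi) * exp (- t\<^sup>2 / 2)))"
proof -
  have "complex_of_real (exp (- t\<^sup>2 / 2)) = (CLINT x|std_normal_distribution. iexp (t * x))"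
    using fun_cong[OF char_std_normal_distribution, of t] by (simp add: char_def)
  also have "\<dots> = (CLINT x|lborel. complex_of_real (std_normal_density x) * iexp (t * x))"
    by (subst integral_density) (auto simp: scaleR_conv_of_real)
  finally have eq: "(CLINT x|lborel. complex_of_real (std_normal_density x) * iexp (t * x)) = complex_of_real (exp (- t\<^sup>2 / 2))" ..
  have "integrable lborel (\<lambda>x. complex_of_real (std_normal_density x) * iexp (t * x))"
    by (rule Bochner_Integration.integrable_bound[of _ std_normal_density])
      (auto simp: norm_mult)
  with eq have "has_bochner_integral lborel (\<lambda>x. complex_of_real (std_normal_density x) * iexp (t * x)) (complex_of_real (exp (- t\<^sup>2 / 2)))"
    by (simp add: has_bochner_integral_iff)
  from has_bochner_integral_mult_right[OF this, of "complex_of_real (sqrt (2*pi))"]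
  show ?thesis
    by (simp add: std_normal_density_def field_simps exp_minus) 
qed

text \<open>\<open>lborel\<close> is the image of a product of real Lebesgue measures under the
  basis expansion. This lifts the one-dimensional Gaussian transform to all dimensions.\<close>

lemma has_bochner_integral_lborel_prod:
  fixes f :: "'a::euclidean_space \<Rightarrow> real \<Rightarrow> complex"
  assumes f: "\<And>b. b \<in> Basis \<Longrightarrow> has_bochner_integral lborel (f b) (v b)"
  shows "has_bochner_integral lborel (\<lambda>x::'a. \<Prod>b\<in>Basis. f b (x \<bullet> b)) (\<Prod>b\<in>Basis. v b)"
proof -
  interpret product_sigma_finite "\<lambda>_::'a. lborel::real measure" ..
  have [measurable]: "b \<in> Basis \<Longrightarrow> f b \<in> borel_measurable borel" for b
    using f[of b] by (auto simp: has_bochner_integral_iff)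
  have m: "(\<lambda>g. \<Sum>b\<in>Basis. g b *\<^sub>R b) \<in> measurable (\<Pi>\<^sub>M b\<in>Basis. lborel) (borel :: 'a measure)"
    by measurable
  have "has_bochner_integral (\<Pi>\<^sub>M b\<in>Basis. lborel) (\<lambda>x::'a\<Rightarrow>real. \<Prod>b\<in>Basis. f b (x b)) (\<Prod>b\<in>Basis. v b)"
    using f product_integrable_prod[of Basis f] product_integral_prod[of Basis f]
    by (auto simp: has_bochner_integral_iff intro!: prod.cong)
  then have "has_bochner_integral (\<Pi>\<^sub>M b\<in>Basis. lborel)
     (\<lambda>g. (\<lambda>x::'a. \<Prod>b\<in>Basis. f b (x \<bullet> b)) (\<Sum>b\<in>Basis. g b *\<^sub>R b)) (\<Prod>b\<in>Basis. v b)"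
    by (simp add: inner_sum_left inner_Basis if_distrib sum.delta cong: if_cong)
  then show ?thesis
    by (subst lborel_eq) (rule has_bochner_integral_distr, auto)
qed

lemma gaussian_fourier_std:
  fixes y :: "'a::euclidean_space"
  shows "has_bochner_integral lborel (\<lambda>x::'a. complex_of_real (exp (- (norm x)\<^sup>2 / 2)) * iexp (x \<bullet> y))
     (complex_of_real ((2 * pi) powr (DIM('a) / 2) * exp (- (norm y)\<^sup>2 / 2)))"
proof -
  have n: "(norm z)\<^sup>2 = (\<Sum>b\<in>Basis. (z \<bullet> b)\<^sup>2)" for z :: 'a
    by (subst power2_norm_eq_inner, subst euclidean_inner) (simp add: power2_eq_square)
  have "has_bochner_integral lborel (\<lambda>x::'a. \<Prod>b\<in>Basis. complex_of_real (exp (- (x\<bullet>b)\<^sup>2 / 2)) * iexp ((y \<bullet> b) * (x \<bullet> b)))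
     (\<Prod>b\<in>(Basis::'a set). complex_of_real (sqrt (2 * pi) * exp (- (y\<bullet>b)\<^sup>2 / 2)))"
    by (intro has_bochner_integral_lborel_prod gaussian_fourier_real)
  also have "(\<lambda>x::'a. \<Prod>b\<in>Basis. complex_of_real (exp (- (x\<bullet>b)\<^sup>2 / 2)) * iexp ((y \<bullet> b) * (x \<bullet> b))) =
    (\<lambda>x::'a. complex_of_real (exp (- (norm x)\<^sup>2 / 2)) * iexp (x \<bullet> y))"
  proof
    fix x :: 'a
    have "(\<Prod>b\<in>Basis. complex_of_real (exp (- (x\<bullet>b)\<^sup>2 / 2))) = complex_of_real (exp (- (norm x)\<^sup>2 / 2))"
      unfolding of_real_prod[symmetric] n
      by (simp add: exp_sum[symmetric] sum_negf sum_divide_distrib)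
    moreover have "(\<Prod>b\<in>Basis. iexp ((y \<bullet> b) * (x \<bullet> b))) = iexp (x \<bullet> y)"
      by (subst exp_sum[symmetric]) (simp_all add: sum_distrib_left[symmetric] euclidean_inner[of x y] mult_ac)
    ultimately show "(\<Prod>b\<in>Basis. complex_of_real (exp (- (x\<bullet>b)\<^sup>2 / 2)) * iexp ((y \<bullet> b) * (x \<bullet> b))) = complex_of_real (exp (- (norm x)\<^sup>2 / 2)) * iexp (x \<bullet> y)"
      by (simp add: prod.distrib)
  qed
  also have "(\<Prod>b\<in>(Basis::'a set). complex_of_real (sqrt (2 * pi) * exp (- (y\<bullet>b)\<^sup>2 / 2))) =
     complex_of_real ((2 * pi) powr (DIM('a) / 2) * exp (- (norm y)\<^sup>2 / 2))"
  proof -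
    have "(2 * pi) powr (DIM('a) / 2) = sqrt (2*pi) ^ DIM('a)"
      by (simp add: powr_half_sqrt[symmetric] powr_powr powr_realpow[symmetric])
    then show ?thesis
      unfolding of_real_prod[symmetric] n
      by (simp add: exp_sum[symmetric] sum_negf sum_divide_distrib prod.distrib)
  qed
  finally show ?thesis .
qed

text \<open>The substitution of c (x - z) reduces this to the standard Gaussian. Width 1/c becomes
  width c in \<open>y\<close>, and the centre \<open>z\<close> survives only as a phase. Inversion,
  uniqueness and the energy estimates all rest on this explicit integral.\<close>

lemma gaussian_fourier:
  fixes y z :: "'a::euclidean_space"
  assumes c: "c > 0"
  shows "has_bochner_integral lborel (\<lambda>x::'a. complex_of_real (exp (- (c * norm (x - z))\<^sup>2 / 2)) * iexp (x \<bullet> y))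
     (complex_of_real ((2 * pi) powr (DIM('a) / 2) / c ^ DIM('a) * exp (- (norm y / c)\<^sup>2 / 2)) * iexp (z \<bullet> y))"
proof -
  let ?f = "\<lambda>x::'a. complex_of_real (exp (- (c * norm (x - z))\<^sup>2 / 2)) * iexp (x \<bullet> y)"
  let ?g = "\<lambda>x::'a. complex_of_real (exp (- (norm x)\<^sup>2 / 2)) * iexp (x \<bullet> (y /\<^sub>R c))"
  note g = gaussian_fourier_std[of "y /\<^sub>R c"]
  have eq: "?f x = ?g (- c *\<^sub>R z + c *\<^sub>R x) * iexp (z \<bullet> y)" for x
  proof -
    have "norm (- c *\<^sub>R z + c *\<^sub>R x) = c * norm (x - z)"
    proof -
      have "- c *\<^sub>R z + c *\<^sub>R x = c *\<^sub>R (x - z)" by (simp add: algebra_simps)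
      then show ?thesis using c by simp
    qed
    moreover have "iexp ((- c *\<^sub>R z + c *\<^sub>R x) \<bullet> (y /\<^sub>R c)) * iexp (z \<bullet> y) = iexp (x \<bullet> y)"
    proof -
      have "(- c *\<^sub>R z + c *\<^sub>R x) \<bullet> (y /\<^sub>R c) + z \<bullet> y = x \<bullet> y"
        using c by (simp add: inner_add_left inner_diff_left field_simps)
      then show ?thesis
        by (simp only: exp_add[symmetric] distrib_left[symmetric] of_real_add[symmetric])
    qed
    ultimately show ?thesis by (simp add: mult.assoc)
  qed
  have int: "integrable lborel ?f"
  proof -
    have "integrable lborel (\<lambda>x. ?g (- c *\<^sub>R z + c *\<^sub>R x))"
      using g c by (intro integrable_lborel_affine) (auto simp: has_bochner_integral_iff)
    then show ?thesis unfolding eq by simp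
  qed
  have "(LINT x|lborel. ?f x) = (LINT x|lborel. ?g (- c *\<^sub>R z + c *\<^sub>R x)) * iexp (z \<bullet> y)"
    unfolding eq by simp
  also have "(LINT x|lborel. ?g (- c *\<^sub>R z + c *\<^sub>R x)) = (LINT x|lborel. ?g x) / complex_of_real (c ^ DIM('a))"
    using c by (subst (2) integral_lborel_affine[of _ c "- c *\<^sub>R z"]) (auto simp: scaleR_conv_of_real)
  also have "(LINT x|lborel. ?g x) = complex_of_real ((2 * pi) powr (DIM('a) / 2) * exp (- (norm (y /\<^sub>R c))\<^sup>2 / 2))"
    using g by (simp add: has_bochner_integral_iff)
  finally have val: "(LINT x|lborel. ?f x) = complex_of_real ((2 * pi) powr (DIM('a) / 2) * exp (- (norm (y /\<^sub>R c))\<^sup>2 / 2)) /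
      complex_of_real (c ^ DIM('a)) * iexp (z \<bullet> y)" .
  have "norm (y /\<^sub>R c) = norm y / c" using c by (simp add: divide_inverse mult.commute)
  then have "(LINT x|lborel. ?f x) =
      complex_of_real ((2 * pi) powr (DIM('a) / 2) / c ^ DIM('a) * exp (- (norm y / c)\<^sup>2 / 2)) * iexp (z \<bullet> y)"
    unfolding val of_real_divide[symmetric] by (simp only: times_divide_eq_left)
  with int show ?thesis by (simp only: has_bochner_integral_iff)
qed

section \<open>The Schwartz space\<close>

abbreviation pd :: "'n::finite \<Rightarrow> (real ^ 'n \<Rightarrow> complex) \<Rightarrow> real ^ 'n \<Rightarrow> complex" where
  "pd i f \<equiv> (\<lambda>x. frechet_derivative f (at x) (axis i 1))"

lemma pd_eqI:
  assumes "\<And>x. (f has_derivative f' x) (at x)"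
  shows "pd i f = (\<lambda>x. f' x (axis i 1))"
  using frechet_derivative_at[OF assms] by simp

lemma pd_add:
  assumes "\<And>x. f differentiable (at x)" "\<And>x. g differentiable (at x)"
  shows "pd i (\<lambda>x. f x + g x) = (\<lambda>x. pd i f x + pd i g x)"
  by (rule pd_eqI) (use assms in \<open>auto intro!: has_derivative_add simp: frechet_derivative_works\<close>)

lemma pd_mult:
  assumes "\<And>x. f differentiable (at x)" "\<And>x. g differentiable (at x)"
  shows "pd i (\<lambda>x. f x * g x) = (\<lambda>x. f x * pd i g x + pd i f x * g x)"
  by (rule pd_eqI) (use assms in \<open>auto intro!: has_derivative_mult simp: frechet_derivative_works\<close>)

lemma iter_partial_append: "iter_partial (is @ js) f = iter_partial is (iter_partial js f)"
  by (induction "is") simp_all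

lemma iter_partial_snoc: "iter_partial (is @ [i]) f = iter_partial is (pd i f)"
  by (simp add: iter_partial_append)

text \<open>An explicit algebra of multipliers of the Schwartz space. Listing generators instead of taking
  all smooth functions of polynomial growth makes closure under differentiation an induction.\<close>

inductive_set temper_mult :: "(real ^ 'n::finite \<Rightarrow> complex) set" where
  const: "(\<lambda>x. c) \<in> temper_mult"
| coord: "(\<lambda>x. complex_of_real (x $ i)) \<in> temper_mult"
| bracket: "(\<lambda>x. complex_of_real ((1 + (norm x)\<^sup>2) powr r)) \<in> temper_mult"
| char: "(\<lambda>x. iexp (x \<bullet> y)) \<in> temper_mult"
| gauss: "(\<lambda>x. complex_of_real (exp (- (c * norm (x - y))\<^sup>2 / 2))) \<in> temper_mult"
| add: "f \<in> temper_mult \<Longrightarrow> g \<in> temper_mult \<Longrightarrow> (\<lambda>x. f x + g x) \<in> temper_mult"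
| mult: "f \<in> temper_mult \<Longrightarrow> g \<in> temper_mult \<Longrightarrow> (\<lambda>x. f x * g x) \<in> temper_mult"

lemma has_derivative_of_real_vec:
  assumes "(f has_derivative f') (at x)"
  shows "((\<lambda>x. complex_of_real (f x)) has_derivative (\<lambda>v. complex_of_real (f' v))) (at x)"
  using assms by (rule bounded_linear.has_derivative[OF bounded_linear_of_real])

lemma has_derivative_gauss:
  fixes x y :: "real ^ 'n"
  shows "((\<lambda>x. complex_of_real (exp (- (c * norm (x - y))\<^sup>2 / 2))) has_derivative
     (\<lambda>v. complex_of_real (- c\<^sup>2 * ((x - y) \<bullet> v)) * complex_of_real (exp (- (c * norm (x - y))\<^sup>2 / 2)))) (at x)"
  unfolding of_real_mult[symmetric] power_mult_distrib power2_norm_eq_inner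
  by (rule has_derivative_of_real_vec)
     (auto intro!: derivative_eq_intros simp: inner_commute field_simps)

lemma has_derivative_bracket:
  fixes x :: "real ^ 'n"
  shows "((\<lambda>x. complex_of_real ((1 + (norm x)\<^sup>2) powr r)) has_derivative
     (\<lambda>v. complex_of_real (2 * r * (x \<bullet> v)) * complex_of_real ((1 + (norm x)\<^sup>2) powr (r - 1)))) (at x)"
proof -
  have p: "0 < 1 + x \<bullet> x" by (simp add: add_pos_nonneg)
  have "(1 + x \<bullet> x) powr (r - 1) = (1 + x \<bullet> x) powr r / (1 + x \<bullet> x)"
    using p by (simp add: powr_diff)
  then show ?thesis
    unfolding of_real_mult[symmetric] power2_norm_eq_inner
    by (intro has_derivative_of_real_vec)
       (use p in \<open>auto intro!: derivative_eq_intros simp: inner_commute field_simps\<close>)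
qed

lemma has_derivative_iexp:
  fixes x y :: "real ^ 'n"
  shows "((\<lambda>x. iexp (x \<bullet> y)) has_derivative (\<lambda>v. \<i> * complex_of_real (v \<bullet> y) * iexp (x \<bullet> y))) (at x)"
proof -
  have "((\<lambda>x. \<i> * complex_of_real (x \<bullet> y)) has_derivative (\<lambda>v. \<i> * complex_of_real (v \<bullet> y))) (at x)"
    by (intro has_derivative_mult_right has_derivative_of_real_vec) (auto intro!: derivative_eq_intros)
  from has_derivative_compose[OF this DERIV_exp[unfolded has_field_derivative_def]]
  show ?thesis by (simp add: mult_ac)
qed

lemma has_derivative_coord:
  fixes x :: "real ^ 'n"
  shows "((\<lambda>x. complex_of_real (x $ i)) has_derivative (\<lambda>v. complex_of_real (v $ i))) (at x)"
  by (intro has_derivative_of_real_vec bounded_linear_imp_has_derivative bounded_linear_vec_nth)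

lemma temper_mult_differentiable: "f \<in> temper_mult \<Longrightarrow> f differentiable (at x)"
  unfolding differentiable_def
  by (induction rule: temper_mult.induct)
     (blast intro: has_derivative_gauss has_derivative_bracket has_derivative_iexp
       has_derivative_coord has_derivative_const has_derivative_add has_derivative_mult)+

lemma temper_mult_sum:
  "finite A \<Longrightarrow> (\<And>a. a \<in> A \<Longrightarrow> f a \<in> temper_mult) \<Longrightarrow> (\<lambda>x. \<Sum>a\<in>A. f a x) \<in> temper_mult"
  by (induction A rule: finite_induct) (auto intro: temper_mult.const temper_mult.add)

lemma temper_mult_pd: "f \<in> temper_mult \<Longrightarrow> pd i f \<in> temper_mult"
proof (induction rule: temper_mult.induct)
  case (const c)
  have "pd i (\<lambda>x. c) = (\<lambda>x. 0)" by (rule pd_eqI) simp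
  then show ?case by (simp add: temper_mult.const)
next
  case (coord j)
  then show ?case
    by (subst pd_eqI[OF has_derivative_coord]) (rule temper_mult.const)
next
  case (bracket r)
  have "(\<lambda>x. complex_of_real (2 * r) * complex_of_real (x $ i) * complex_of_real ((1 + (norm x)\<^sup>2) powr (r - 1))) \<in> temper_mult"
    by (intro temper_mult.mult temper_mult.const temper_mult.coord temper_mult.bracket)
  then show ?case
    by (subst pd_eqI[OF has_derivative_bracket]) (simp add: inner_axis)
next
  case (char y)
  have "(\<lambda>x. (\<i> * complex_of_real (axis i 1 \<bullet> y)) * iexp (x \<bullet> y)) \<in> temper_mult"
    by (intro temper_mult.mult temper_mult.const temper_mult.char)
  then show ?case
    by (subst pd_eqI[OF has_derivative_iexp])
next
  case (gauss c y)
  have "(\<lambda>x. (complex_of_real (- c\<^sup>2) * (complex_of_real (x $ i) + complex_of_real (- y $ i))) * 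
     complex_of_real (exp (- (c * norm (x - y))\<^sup>2 / 2))) \<in> temper_mult"
    by (intro temper_mult.mult temper_mult.add temper_mult.const temper_mult.coord temper_mult.gauss)
  then show ?case
    by (subst pd_eqI[OF has_derivative_gauss]) (simp add: inner_axis algebra_simps)
next
  case (add f g)
  then show ?case by (subst pd_add) (auto intro: temper_mult_differentiable temper_mult.add)
next
  case (mult f g)
  then show ?case
    by (subst pd_mult) (auto intro!: temper_mult_differentiable temper_mult.add temper_mult.mult)
qed

text \<open>Together with closure under \<open>pd\<close> this bounds all derivatives polynomially,
  which is what makes the elements multipliers of the Schwartz space.\<close>

lemma temper_mult_growth:
  fixes f :: "real ^ 'n::finite \<Rightarrow> complex"
  shows "f \<in> temper_mult \<Longrightarrow> \<exists>B k. B \<ge> 0 \<and> (\<forall>x. cmod (f x) \<le> B * (1 + norm x) ^ k)"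
proof (induction rule: temper_mult.induct)
  case (const c)
  show ?case by (rule exI[of _ "cmod c"], rule exI[of _ 0]) simp
next
  case (coord i)
  show ?case
    by (rule exI[of _ 1], rule exI[of _ 1]) (auto intro: order_trans[OF component_le_norm_cart])
next
  case (bracket r)
  define k where "k = nat \<lceil>\<bar>r\<bar>\<rceil>"
  have "(1 + (norm x)\<^sup>2) powr r \<le> 1 * (1 + norm x) ^ (2 * k)" for x :: "real ^ 'n"
  proof -
    have "(1 + (norm x)\<^sup>2) powr r \<le> (1 + (norm x)\<^sup>2) powr (real k)"
      unfolding k_def by (intro powr_mono) (auto, linarith)
    also have "\<dots> = (1 + (norm x)\<^sup>2) ^ k" by (simp add: powr_realpow add_pos_nonneg)
    also have "\<dots> \<le> ((1 + norm x)\<^sup>2) ^ k"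
      by (intro power_mono) (auto simp: power2_eq_square algebra_simps)
    finally show ?thesis by (simp add: power_mult)
  qed
  then show ?case by (intro exI[of _ "1::real"] exI[of _ "2 * k"]) simp
next
  case (char y)
  show ?case by (rule exI[of _ 1], rule exI[of _ 0]) simp
next
  case (gauss c y)
  show ?case by (rule exI[of _ 1], rule exI[of _ 0]) simp
next
  case (add f g)
  then obtain B k C l where f: "B \<ge> 0" "\<And>x. cmod (f x) \<le> B * (1 + norm x) ^ k"
    and g: "C \<ge> 0" "\<And>x. cmod (g x) \<le> C * (1 + norm x) ^ l" by auto
  have "cmod (f x + g x) \<le> (B + C) * (1 + norm x) ^ (max k l)" for x
  proof -
    have "cmod (f x + g x) \<le> B * (1 + norm x) ^ k + C * (1 + norm x) ^ l"
      using f(2)[of x] g(2)[of x] norm_triangle_ineq[of "f x" "g x"] by linarith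
    also have "\<dots> \<le> B * (1 + norm x) ^ (max k l) + C * (1 + norm x) ^ (max k l)"
      using f(1) g(1) by (intro add_mono mult_left_mono power_increasing) auto
    finally show ?thesis by (simp add: algebra_simps)
  qed
  with f(1) g(1) show ?case by (intro exI[of _ "B + C"] exI[of _ "max k l"]) simp
next
  case (mult f g)
  then obtain B k C l where f: "B \<ge> 0" "\<And>x. cmod (f x) \<le> B * (1 + norm x) ^ k"
    and g: "C \<ge> 0" "\<And>x. cmod (g x) \<le> C * (1 + norm x) ^ l" by auto
  have "cmod (f x * g x) \<le> (B * C) * (1 + norm x) ^ (k + l)" for x
  proof -
    have "cmod (f x * g x) \<le> (B * (1 + norm x) ^ k) * (C * (1 + norm x) ^ l)"
      unfolding norm_mult using f g by (intro mult_mono) auto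
    then show ?thesis by (simp add: power_add mult_ac)
  qed
  with f(1) g(1) show ?case by (intro exI[of _ "B * C"] exI[of _ "k + l"]) simp
qed

text \<open>A family closed under \<open>pd\<close> contains every iterated partial derivative of
  its members, so decay has to be checked only for the members themselves. This spares a Leibniz
  formula for higher derivatives.\<close>

lemma schwartz_coinduct:
  assumes "f \<in> F"
    and diff: "\<And>f x. f \<in> F \<Longrightarrow> f differentiable (at x)"
    and pd: "\<And>f i. f \<in> F \<Longrightarrow> pd i f \<in> F"
    and decay: "\<And>f k. f \<in> F \<Longrightarrow> \<exists>B. \<forall>x. (1 + norm x) ^ k * cmod (f x) \<le> B"
  shows "f \<in> schwartz"
proof -
  have "iter_partial is f \<in> F" for "is"
    by (induction "is") (use assms(1) pd in auto)
  then show ?thesis using diff decay unfolding schwartz_def smooth_def by blast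
qed

lemma schwartz_differentiable: "\<gamma> \<in> schwartz \<Longrightarrow> \<gamma> differentiable (at x)"
  unfolding schwartz_def smooth_def by (auto dest: spec[of _ "[]"])

lemma schwartz_pd: "\<gamma> \<in> schwartz \<Longrightarrow> pd i \<gamma> \<in> schwartz"
  unfolding schwartz_def smooth_def by (auto simp: iter_partial_snoc[symmetric])

lemma schwartz_iter_partial: "\<gamma> \<in> schwartz \<Longrightarrow> iter_partial is \<gamma> \<in> schwartz"
  by (induction "is") (auto intro: schwartz_pd)

lemma schwartz_decay: "\<gamma> \<in> schwartz \<Longrightarrow> \<exists>B. \<forall>x. (1 + norm x) ^ k * cmod (\<gamma> x) \<le> B"
  unfolding schwartz_def by (auto dest: spec[of _ "[]"])

text \<open>Sums are included because the product rule turns one product into two; the set is then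
  closed under \<open>pd\<close> and fit for \<open>schwartz_coinduct\<close>.\<close>

inductive_set schwartz_module :: "(real ^ 'n::finite \<Rightarrow> complex) set" where
  mult: "f \<in> temper_mult \<Longrightarrow> \<gamma> \<in> schwartz \<Longrightarrow> (\<lambda>x. f x * \<gamma> x) \<in> schwartz_module"
| add: "\<gamma> \<in> schwartz_module \<Longrightarrow> \<eta> \<in> schwartz_module \<Longrightarrow> (\<lambda>x. \<gamma> x + \<eta> x) \<in> schwartz_module"

lemma schwartz_module_differentiable: "\<gamma> \<in> schwartz_module \<Longrightarrow> \<gamma> differentiable (at x)"
  by (induction rule: schwartz_module.induct)
     (auto intro!: differentiable_mult differentiable_add intro: temper_mult_differentiable schwartz_differentiable)

lemma schwartz_module_schwartz:
  fixes \<gamma> :: "real ^ 'n::finite \<Rightarrow> complex"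
  shows "\<gamma> \<in> schwartz_module \<Longrightarrow> \<gamma> \<in> schwartz"
proof (rule schwartz_coinduct[of _ schwartz_module])
  fix f :: "real ^ 'n \<Rightarrow> complex" and i
  assume "f \<in> schwartz_module"
  then show "pd i f \<in> schwartz_module"
  proof (induction rule: schwartz_module.induct)
    case (mult f \<gamma>)
    then show ?case
      using schwartz_module.add[OF schwartz_module.mult[OF mult(1) schwartz_pd[OF mult(2)]]
        schwartz_module.mult[OF temper_mult_pd[OF mult(1)] mult(2)], of i i]
      by (subst pd_mult) (auto intro: temper_mult_differentiable schwartz_differentiable)
  next
    case (add \<gamma> \<eta>)
    then show ?case
      by (subst pd_add) (auto intro!: schwartz_module_differentiable schwartz_module.add)
  qed
next
  fix f :: "real ^ 'n \<Rightarrow> complex" and k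
  assume "f \<in> schwartz_module"
  then show "\<exists>B. \<forall>x. (1 + norm x) ^ k * cmod (f x) \<le> B"
  proof (induction rule: schwartz_module.induct)
    case (mult f \<gamma>)
    obtain A l where A: "A \<ge> 0" "\<And>x. cmod (f x) \<le> A * (1 + norm x) ^ l"
      using temper_mult_growth[OF mult(1)] by blast
    obtain B where B: "\<And>x. (1 + norm x) ^ (k + l) * cmod (\<gamma> x) \<le> B"
      using schwartz_decay[OF mult(2)] by blast
    have "(1 + norm x) ^ k * cmod (f x * \<gamma> x) \<le> A * B" for x
    proof -
      have "(1 + norm x) ^ k * cmod (f x * \<gamma> x) \<le> (1 + norm x) ^ k * ((A * (1 + norm x) ^ l) * cmod (\<gamma> x))"
        unfolding norm_mult using A(2)[of x] by (intro mult_left_mono mult_right_mono) auto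
      also have "\<dots> = A * ((1 + norm x) ^ (k + l) * cmod (\<gamma> x))" by (simp add: power_add)
      also have "\<dots> \<le> A * B" using A(1) B[of x] by (intro mult_left_mono) auto
      finally show ?thesis .
    qed
    then show ?case by blast
  next
    case (add \<gamma> \<eta>)
    then obtain A B where AB: "\<And>x. (1 + norm x) ^ k * cmod (\<gamma> x) \<le> A" "\<And>x. (1 + norm x) ^ k * cmod (\<eta> x) \<le> B"
      by blast
    have "(1 + norm x) ^ k * cmod (\<gamma> x + \<eta> x) \<le> A + B" for x
    proof -
      have "(1 + norm x) ^ k * cmod (\<gamma> x + \<eta> x) \<le> (1 + norm x) ^ k * (cmod (\<gamma> x) + cmod (\<eta> x))"
        by (intro mult_left_mono norm_triangle_ineq) auto
      with AB[of x] show ?thesis by (simp add: algebra_simps)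
    qed
    then show ?case by blast
  qed
qed (blast intro: schwartz_module_differentiable)+

lemma schwartz_mult: "f \<in> temper_mult \<Longrightarrow> \<gamma> \<in> schwartz \<Longrightarrow> (\<lambda>x. f x * \<gamma> x) \<in> schwartz"
  by (rule schwartz_module_schwartz[OF schwartz_module.mult])

lemma schwartz_cmult: "\<gamma> \<in> schwartz \<Longrightarrow> (\<lambda>x. c * \<gamma> x) \<in> schwartz"
  by (rule schwartz_mult[OF temper_mult.const])

lemma schwartz_add:
  assumes "\<gamma> \<in> schwartz" "\<eta> \<in> schwartz" shows "(\<lambda>x. \<gamma> x + \<eta> x) \<in> schwartz"
  using schwartz_module_schwartz[OF schwartz_module.add[OF schwartz_module.mult[OF temper_mult.const[of 1] assms(1)]
    schwartz_module.mult[OF temper_mult.const[of 1] assms(2)]]] by simp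

text \<open>For positive \<open>k\<close> this combines 1 + v <= k (1 + v/k) with (1 + v/k)^k <= exp
  v; for \<open>k = 0\<close> the constant \<open>0 ^ 0\<close> is 1.\<close>

lemma one_plus_power_le_exp:
  fixes v :: real
  assumes "v \<ge> 0"
  shows "(1 + v) ^ k \<le> real k ^ k * exp v"
proof (cases "k = 0")
  case False
  have "(1 + v) ^ k \<le> (real k * (1 + v / real k)) ^ k"
    using assms False by (intro power_mono) (auto simp: field_simps)
  also have "\<dots> = real k ^ k * (1 + v / real k) ^ k" by (simp add: power_mult_distrib)
  also have "(1 + v / real k) ^ k \<le> exp v"
    using assms False by (intro exp_ge_one_plus_x_over_n_power_n) auto
  finally show ?thesis by (simp add: mult_left_mono)
qed (use assms in auto)

lemma gauss_decay:
  fixes y :: "real ^ 'n"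
  assumes c: "c \<noteq> 0"
  shows "\<exists>B\<ge>0. \<forall>x. (1 + norm x) ^ k * exp (- (c * norm (x - y))\<^sup>2 / 2) \<le> B"
proof -
  \<comment> \<open>Chosen so that 1 + |x| <= K (1 + v), where v is the exponent of the Gaussian up
    to sign. With r = |x - y| the factors come from 1 + |x| <= (1 + |y|)(1 + r), 1 + r <= 2 (1 +
    r^2) and 1 + r^2 <= (1 + 2/c^2)(1 + v).\<close>
  define K where "K = (1 + norm y) * (2 * (1 + 2 / c\<^sup>2))"
  have K: "K \<ge> 0" unfolding K_def by (auto intro!: mult_nonneg_nonneg)
  have "(1 + norm x) ^ k * exp (- (c * norm (x - y))\<^sup>2 / 2) \<le> K ^ k * real k ^ k" for x
  proof -
    define r v where "r = norm (x - y)" and "v = (c * r)\<^sup>2 / 2"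
    have r: "r \<ge> 0" and v: "v \<ge> 0" by (auto simp: r_def v_def)
    have "norm x \<le> norm y + r" unfolding r_def using norm_triangle_ineq[of y "x - y"] by simp
    also have "\<dots> \<le> norm y + r + norm y * r" using r by simp
    finally have 1: "1 + norm x \<le> (1 + norm y) * (1 + r)" by (simp add: algebra_simps)
    have 2: "1 + r \<le> 2 * (1 + r\<^sup>2)"
    proof -
      have "2 * r \<le> 1 + r\<^sup>2" using zero_le_power2[of "1 - r"] by (simp add: power2_diff)
      moreover have "0 \<le> r\<^sup>2" by simp
      moreover have "2 * (1 + r\<^sup>2) = 2 + 2 * r\<^sup>2" by simp
      ultimately show ?thesis using r by linarith
    qed
    have "1 + r\<^sup>2 \<le> (1 + 2 / c\<^sup>2) * (1 + v)"
      using c by (simp add: v_def field_simps)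
    then have "1 + r \<le> 2 * ((1 + 2 / c\<^sup>2) * (1 + v))"
      by (intro order_trans[OF 2] mult_left_mono) auto
    from order_trans[OF 1 mult_left_mono[OF this, of "1 + norm y"]]
    have "1 + norm x \<le> K * (1 + v)"
      by (simp add: K_def mult.assoc del: distrib_left_numeral)
    then have "(1 + norm x) ^ k \<le> K ^ k * (1 + v) ^ k"
      unfolding power_mult_distrib[symmetric] by (intro power_mono) auto
    also have "\<dots> \<le> K ^ k * (real k ^ k * exp v)"
      using K v by (intro mult_left_mono one_plus_power_le_exp) auto
    finally have "(1 + norm x) ^ k \<le> K ^ k * real k ^ k * exp v" by (simp add: mult_ac)
    then have "(1 + norm x) ^ k * exp (- v) \<le> (K ^ k * real k ^ k * exp v) * exp (- v)"
      by (rule mult_right_mono) simp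
    also have "\<dots> = K ^ k * real k ^ k" by (simp add: mult.assoc exp_add[symmetric])
    finally show ?thesis by (simp add: v_def r_def)
  qed
  then show ?thesis using K by (intro exI[of _ "K ^ k * real k ^ k"]) simp
qed

text \<open>The derivative of a Gaussian is an affine multiple of itself, so the multiples of one
  fixed Gaussian by elements of \<open>temper_mult\<close> are closed under \<open>pd\<close>, and
  \<open>gauss_decay\<close> beats the growth of the factor.\<close>

lemma schwartz_gauss:
  assumes c: "c \<noteq> 0" and f: "f \<in> temper_mult"
  shows "(\<lambda>x. f x * complex_of_real (exp (- (c * norm (x - y))\<^sup>2 / 2))) \<in> schwartz"
proof -
  define g where "g = (\<lambda>x. complex_of_real (exp (- (c * norm (x - y))\<^sup>2 / 2)))"
  have g: "g \<in> temper_mult" unfolding g_def by (rule temper_mult.gauss)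
  have pdg: "pd i g = (\<lambda>x. (complex_of_real (- c\<^sup>2) * (complex_of_real (x $ i) + complex_of_real (- y $ i))) * g x)" for i
    unfolding g_def by (subst pd_eqI[OF has_derivative_gauss]) (simp add: inner_axis algebra_simps)
  have "(\<lambda>x. f x * g x) \<in> schwartz"
  proof (rule schwartz_coinduct[of _ "{\<lambda>x. f x * g x |f. f \<in> temper_mult}"])
    fix h assume "h \<in> {\<lambda>x. f x * g x |f. f \<in> temper_mult}"
    then obtain f where h: "h = (\<lambda>x. f x * g x)" and f: "f \<in> temper_mult" by blast
    show "h differentiable (at x)" for x
      unfolding h by (intro temper_mult_differentiable temper_mult.mult f g)
    show "pd i h \<in> {\<lambda>x. f x * g x |f. f \<in> temper_mult}" for i
    proof -
      have "pd i h = (\<lambda>x. (f x * (complex_of_real (- c\<^sup>2) * (complex_of_real (x $ i) + complex_of_real (- y $ i))) + pd i f x) * g x)"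
        unfolding h by (subst pd_mult) (auto intro!: temper_mult_differentiable f g simp: fun_cong[OF pdg] algebra_simps)
      moreover have "(\<lambda>x. f x * (complex_of_real (- c\<^sup>2) * (complex_of_real (x $ i) + complex_of_real (- y $ i))) + pd i f x) \<in> temper_mult"
        by (intro temper_mult.intros temper_mult_pd f)
      ultimately show ?thesis by (auto simp only: mem_Collect_eq)
    qed
    show "\<exists>B. \<forall>x. (1 + norm x) ^ k * cmod (h x) \<le> B" for k
    proof -
      obtain A l where A: "A \<ge> 0" "\<And>x. cmod (f x) \<le> A * (1 + norm x) ^ l"
        using temper_mult_growth[OF f] by blast
      obtain B where B: "\<And>x. (1 + norm x) ^ (k + l) * cmod (g x) \<le> B"
        using gauss_decay[OF c, of "k + l" y] by (auto simp: g_def)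
      have "(1 + norm x) ^ k * cmod (h x) \<le> A * B" for x
      proof -
        have "(1 + norm x) ^ k * cmod (h x) \<le> (1 + norm x) ^ k * ((A * (1 + norm x) ^ l) * cmod (g x))"
          unfolding h norm_mult using A(2)[of x] by (intro mult_left_mono mult_right_mono) auto
        also have "\<dots> = A * ((1 + norm x) ^ (k + l) * cmod (g x))" by (simp add: power_add)
        also have "\<dots> \<le> A * B" using A(1) B[of x] by (intro mult_left_mono) auto
        finally show ?thesis .
      qed
      then show ?thesis by blast
    qed
  qed (use f in \<open>auto simp only: mem_Collect_eq\<close>)
  then show ?thesis by (simp add: g_def)
qed

section \<open>Seminorms and continuous operators on the Schwartz space\<close>

lemma schwartz_norm_bdd:
  "\<gamma> \<in> schwartz \<Longrightarrow> bdd_above (range (\<lambda>x. (1 + norm x) ^ k * cmod (iter_partial is \<gamma> x)))"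
  using schwartz_decay[OF schwartz_iter_partial, of \<gamma> k "is"] unfolding bdd_above_def by auto

lemma schwartz_norm_sup_nonneg:
  "\<gamma> \<in> schwartz \<Longrightarrow> 0 \<le> (SUP x. (1 + norm x) ^ k * cmod (iter_partial is \<gamma> x))"
  by (rule cSUP_upper2[OF schwartz_norm_bdd, where x = 0]) auto

lemma schwartz_norm_nonneg: "\<gamma> \<in> schwartz \<Longrightarrow> 0 \<le> schwartz_norm N \<gamma>"
  unfolding schwartz_norm_def by (intro sum_nonneg schwartz_norm_sup_nonneg)

lemma schwartz_norm_upper:
  assumes \<gamma>: "\<gamma> \<in> schwartz" and N: "length is \<le> N" "k \<le> N"
  shows "(1 + norm x) ^ k * cmod (iter_partial is \<gamma> x) \<le> schwartz_norm N \<gamma>"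
proof -
  have "(1 + norm x) ^ k * cmod (iter_partial is \<gamma> x) \<le> (1 + norm x) ^ N * cmod (iter_partial is \<gamma> x)"
    using N by (intro mult_right_mono power_increasing) auto
  also have "\<dots> \<le> (SUP x. (1 + norm x) ^ N * cmod (iter_partial is \<gamma> x))"
    by (rule cSUP_upper[OF _ schwartz_norm_bdd[OF \<gamma>]]) simp
  also have "\<dots> \<le> schwartz_norm N \<gamma>"
    unfolding schwartz_norm_def using N
    by (intro member_le_sum[of "is"] schwartz_norm_sup_nonneg \<gamma>) (auto simp: finite_partial_indices)
  finally show ?thesis .
qed

lemma schwartz_norm_mono:
  assumes \<gamma>: "\<gamma> \<in> schwartz" and N: "N \<le> M"
  shows "schwartz_norm N \<gamma> \<le> schwartz_norm M \<gamma>"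
proof -
  have "schwartz_norm N \<gamma> \<le> (\<Sum>is | length is \<le> N. SUP x. (1 + norm x) ^ M * cmod (iter_partial is \<gamma> x))"
    unfolding schwartz_norm_def using N
    by (intro sum_mono cSUP_mono schwartz_norm_bdd \<gamma>)
       (auto intro!: exI mult_right_mono power_increasing)
  also have "\<dots> \<le> schwartz_norm M \<gamma>"
    unfolding schwartz_norm_def using N
    by (intro sum_mono2 schwartz_norm_sup_nonneg \<gamma>) (auto simp: finite_partial_indices)
  finally show ?thesis .
qed

text \<open>Continuity for the Schwartz topology in seminorm form. It is what allows a tempered
  distribution to be composed with an operator; linearity is checked separately at that
  point.\<close>

definition schwartz_cont ::
  "((real ^ 'n::finite \<Rightarrow> complex) \<Rightarrow> real ^ 'n \<Rightarrow> complex) \<Rightarrow> bool" where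
  "schwartz_cont L \<longleftrightarrow> (\<forall>\<gamma>\<in>schwartz. L \<gamma> \<in> schwartz) \<and>
     (\<forall>N. \<exists>C\<ge>0. \<exists>M. \<forall>\<gamma>\<in>schwartz. schwartz_norm N (L \<gamma>) \<le> C * schwartz_norm M \<gamma>)"

text \<open>\<open>schwartz_norm\<close> is a sum over finitely many lists, and their bounds are
  merged by taking the maximum of the orders; so one derivative and one weight can be treated at a
  time.\<close>

lemma schwartz_contI:
  fixes L :: "(real ^ 'n::finite \<Rightarrow> complex) \<Rightarrow> real ^ 'n \<Rightarrow> complex"
  assumes L: "\<And>\<gamma>. \<gamma> \<in> schwartz \<Longrightarrow> L \<gamma> \<in> schwartz"
    and bound: "\<And>is k. \<exists>C\<ge>0. \<exists>M. \<forall>\<gamma>\<in>schwartz. \<forall>x.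
        (1 + norm x) ^ k * cmod (iter_partial is (L \<gamma>) x) \<le> C * schwartz_norm M \<gamma>"
  shows "schwartz_cont L"
proof -
  have "\<exists>C\<ge>0. \<exists>M. \<forall>\<gamma>\<in>schwartz. (\<Sum>is\<in>I. SUP x. (1 + norm x) ^ N * cmod (iter_partial is (L \<gamma>) x)) \<le> C * schwartz_norm M \<gamma>"
    if "finite I" for I N using that
  proof (induction I rule: finite_induct)
    case empty
    show ?case by (intro exI[of _ 0]) simp
  next
    case (insert j I)
    obtain C M where 1: "C \<ge> 0" "\<And>\<gamma>. \<gamma> \<in> schwartz \<Longrightarrow> (\<Sum>is\<in>I. SUP x. (1 + norm x) ^ N * cmod (iter_partial is (L \<gamma>) x)) \<le> C * schwartz_norm M \<gamma>"
      using insert.IH by blast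
    obtain D K where 2: "D \<ge> 0" "\<And>\<gamma> x. \<gamma> \<in> schwartz \<Longrightarrow> (1 + norm x) ^ N * cmod (iter_partial j (L \<gamma>) x) \<le> D * schwartz_norm K \<gamma>"
      using bound[of N j] by blast
    have "(\<Sum>is\<in>insert j I. SUP x. (1 + norm x) ^ N * cmod (iter_partial is (L \<gamma>) x)) \<le> (D + C) * schwartz_norm (max K M) \<gamma>"
      if \<gamma>: "\<gamma> \<in> schwartz" for \<gamma>
    proof -
      have "(SUP x. (1 + norm x) ^ N * cmod (iter_partial j (L \<gamma>) x)) \<le> D * schwartz_norm K \<gamma>"
        using 2(2)[OF \<gamma>] by (intro cSUP_least) auto
      also have "\<dots> \<le> D * schwartz_norm (max K M) \<gamma>"
        using 2(1) \<gamma> by (intro mult_left_mono schwartz_norm_mono) auto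
      finally have a: "(SUP x. (1 + norm x) ^ N * cmod (iter_partial j (L \<gamma>) x)) \<le> D * schwartz_norm (max K M) \<gamma>" .
      have "C * schwartz_norm M \<gamma> \<le> C * schwartz_norm (max K M) \<gamma>"
        using 1(1) \<gamma> by (intro mult_left_mono schwartz_norm_mono) auto
      with 1(2)[OF \<gamma>] a show ?thesis
        using insert.hyps by (simp add: algebra_simps)
    qed
    then show ?case using 1(1) 2(1) by (intro exI[of _ "D + C"] conjI exI[of _ "max K M"]) auto
  qed
  from this[OF finite_partial_indices] show ?thesis
    using L unfolding schwartz_cont_def schwartz_norm_def[of _ "L _"] by blast
qed

lemma schwartz_cont_schwartz: "schwartz_cont L \<Longrightarrow> \<gamma> \<in> schwartz \<Longrightarrow> L \<gamma> \<in> schwartz"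
  by (simp add: schwartz_cont_def)

lemma schwartz_cont_norm:
  "schwartz_cont L \<Longrightarrow> \<exists>C\<ge>0. \<exists>M. \<forall>\<gamma>\<in>schwartz. schwartz_norm N (L \<gamma>) \<le> C * schwartz_norm M \<gamma>"
  unfolding schwartz_cont_def by blast

lemma schwartz_cont_comp:
  assumes L: "schwartz_cont L" and K: "schwartz_cont K"
  shows "schwartz_cont (\<lambda>\<gamma>. L (K \<gamma>))"
  unfolding schwartz_cont_def
proof safe
  fix N
  obtain C M where 1: "C \<ge> 0" "\<And>\<gamma>. \<gamma> \<in> schwartz \<Longrightarrow> schwartz_norm N (L \<gamma>) \<le> C * schwartz_norm M \<gamma>"
    using schwartz_cont_norm[OF L, of N] by blast
  obtain D M' where 2: "D \<ge> 0" "\<And>\<gamma>. \<gamma> \<in> schwartz \<Longrightarrow> schwartz_norm M (K \<gamma>) \<le> D * schwartz_norm M' \<gamma>"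
    using schwartz_cont_norm[OF K, of M] by blast
  have "schwartz_norm N (L (K \<gamma>)) \<le> (C * D) * schwartz_norm M' \<gamma>" if "\<gamma> \<in> schwartz" for \<gamma>
    using 1(2)[OF schwartz_cont_schwartz[OF K that]] mult_left_mono[OF 2(2)[OF that] 1(1)]
    by (simp add: mult_ac)
  then show "\<exists>C\<ge>0. \<exists>M. \<forall>\<gamma>\<in>schwartz. schwartz_norm N (L (K \<gamma>)) \<le> C * schwartz_norm M \<gamma>"
    using 1(1) 2(1) by (intro exI[of _ "C * D"]) auto
qed (intro schwartz_cont_schwartz[OF L] schwartz_cont_schwartz[OF K])

lemma schwartz_cont_pd: "schwartz_cont (pd i)"
proof (rule schwartz_contI)
  fix "is" :: "'a list" and k
  have "(1 + norm x) ^ k * cmod (iter_partial is (pd i \<gamma>) x) \<le> 1 * schwartz_norm (max k (length is + 1)) \<gamma>"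
    if "\<gamma> \<in> schwartz" for \<gamma> and x :: "real ^ 'a"
    using schwartz_norm_upper[OF that, of "is @ [i]" "max k (length is + 1)" k x]
    by (simp add: iter_partial_snoc)
  then show "\<exists>C\<ge>0. \<exists>M. \<forall>\<gamma>\<in>schwartz. \<forall>x. (1 + norm x) ^ k * cmod (iter_partial is (pd i \<gamma>) x) \<le> C * schwartz_norm M \<gamma>"
    by (intro exI[of _ 1]) auto
qed (rule schwartz_pd)

lemma iter_partial_add:
  "\<gamma> \<in> schwartz \<Longrightarrow> \<eta> \<in> schwartz \<Longrightarrow>
    iter_partial is (\<lambda>x. \<gamma> x + \<eta> x) = (\<lambda>x. iter_partial is \<gamma> x + iter_partial is \<eta> x)"
  by (induction "is")
     (simp_all add: pd_add schwartz_differentiable[OF schwartz_iter_partial])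

lemma schwartz_cont_bound:
  assumes L: "schwartz_cont L"
  shows "\<exists>C\<ge>0. \<exists>M. \<forall>\<gamma>\<in>schwartz. \<forall>x. (1 + norm x) ^ k * cmod (iter_partial is (L \<gamma>) x) \<le> C * schwartz_norm M \<gamma>"
proof -
  obtain C M where 1: "C \<ge> 0" "\<And>\<gamma>. \<gamma> \<in> schwartz \<Longrightarrow> schwartz_norm (max k (length is)) (L \<gamma>) \<le> C * schwartz_norm M \<gamma>"
    using schwartz_cont_norm[OF L, of "max k (length is)"] by blast
  have "(1 + norm x) ^ k * cmod (iter_partial is (L \<gamma>) x) \<le> C * schwartz_norm M \<gamma>" if "\<gamma> \<in> schwartz" for \<gamma> x
    using schwartz_norm_upper[OF schwartz_cont_schwartz[OF L that], of "is" "max k (length is)" k x] 1(2)[OF that] by simp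
  with 1(1) show ?thesis by blast
qed

lemma schwartz_cont_add:
  assumes L: "schwartz_cont L" and K: "schwartz_cont K"
  shows "schwartz_cont (\<lambda>\<gamma> x. L \<gamma> x + K \<gamma> x)"
proof (rule schwartz_contI)
  fix "is" :: "'a list" and k
  obtain C M where 1: "C \<ge> 0" "\<And>\<gamma> x. \<gamma> \<in> schwartz \<Longrightarrow> (1 + norm x) ^ k * cmod (iter_partial is (L \<gamma>) x) \<le> C * schwartz_norm M \<gamma>"
    using schwartz_cont_bound[OF L] by blast
  obtain D M' where 2: "D \<ge> 0" "\<And>\<gamma> x. \<gamma> \<in> schwartz \<Longrightarrow> (1 + norm x) ^ k * cmod (iter_partial is (K \<gamma>) x) \<le> D * schwartz_norm M' \<gamma>"
    using schwartz_cont_bound[OF K] by blast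
  have "(1 + norm x) ^ k * cmod (iter_partial is (\<lambda>x. L \<gamma> x + K \<gamma> x) x) \<le> (C + D) * schwartz_norm (max M M') \<gamma>"
    if \<gamma>: "\<gamma> \<in> schwartz" for \<gamma> x
  proof -
    have "(1 + norm x) ^ k * cmod (iter_partial is (\<lambda>x. L \<gamma> x + K \<gamma> x) x) \<le>
       (1 + norm x) ^ k * cmod (iter_partial is (L \<gamma>) x) + (1 + norm x) ^ k * cmod (iter_partial is (K \<gamma>) x)"
      unfolding iter_partial_add[OF schwartz_cont_schwartz[OF L \<gamma>] schwartz_cont_schwartz[OF K \<gamma>]] distrib_left[symmetric]
      by (intro mult_left_mono norm_triangle_ineq) auto
    also have "\<dots> \<le> C * schwartz_norm M \<gamma> + D * schwartz_norm M' \<gamma>"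
      using 1 2 \<gamma> by (intro add_mono) auto
    also have "\<dots> \<le> C * schwartz_norm (max M M') \<gamma> + D * schwartz_norm (max M M') \<gamma>"
      using 1 2 \<gamma> by (intro add_mono mult_left_mono schwartz_norm_mono) auto
    finally show ?thesis by (simp add: algebra_simps)
  qed
  then show "\<exists>C\<ge>0. \<exists>M. \<forall>\<gamma>\<in>schwartz. \<forall>x. (1 + norm x) ^ k * cmod (iter_partial is (\<lambda>x. L \<gamma> x + K \<gamma> x) x) \<le> C * schwartz_norm M \<gamma>"
    using 1(1) 2(1) by (intro exI[of _ "C + D"]) auto
qed (intro schwartz_add schwartz_cont_schwartz[OF L] schwartz_cont_schwartz[OF K])

text \<open>Induction that removes the innermost derivative: there the product rule gives
  \<open>f\<close> times a derivative of the argument plus \<open>pd i f\<close> times the argument.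
  Both are products of the same kind, which is why the induction keeps \<open>f\<close>
  general.\<close>

lemma schwartz_cont_mult:
  assumes "f \<in> temper_mult"
  shows "schwartz_cont (\<lambda>\<gamma> x. f x * \<gamma> x)"
proof (rule schwartz_contI)
  fix "is" :: "'a list" and k
  show "\<exists>C\<ge>0. \<exists>M. \<forall>\<gamma>\<in>schwartz. \<forall>x. (1 + norm x) ^ k * cmod (iter_partial is (\<lambda>x. f x * \<gamma> x) x) \<le> C * schwartz_norm M \<gamma>"
    using assms
  proof (induction "is" arbitrary: f rule: rev_induct)
    case Nil
    obtain B l where B: "B \<ge> 0" "\<And>x. cmod (f x) \<le> B * (1 + norm x) ^ l"
      using temper_mult_growth[OF Nil] by blast
    have "(1 + norm x) ^ k * cmod (f x * \<gamma> x) \<le> B * schwartz_norm (k + l) \<gamma>" if \<gamma>: "\<gamma> \<in> schwartz" for \<gamma> x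
    proof -
      have "(1 + norm x) ^ k * cmod (f x * \<gamma> x) \<le> (1 + norm x) ^ k * ((B * (1 + norm x) ^ l) * cmod (\<gamma> x))"
        unfolding norm_mult using B(2)[of x] by (intro mult_left_mono mult_right_mono) auto
      also have "\<dots> = B * ((1 + norm x) ^ (k + l) * cmod (iter_partial [] \<gamma> x))" by (simp add: power_add)
      also have "\<dots> \<le> B * schwartz_norm (k + l) \<gamma>"
        using B(1) \<gamma> by (intro mult_left_mono schwartz_norm_upper) auto
      finally show ?thesis .
    qed
    then show ?case using B(1) by auto
  next
    case (snoc i "is")
    obtain C M where 1: "C \<ge> 0" "\<And>\<gamma> x. \<gamma> \<in> schwartz \<Longrightarrow> (1 + norm x) ^ k * cmod (iter_partial is (\<lambda>x. f x * \<gamma> x) x) \<le> C * schwartz_norm M \<gamma>"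
      using snoc.IH[OF snoc.prems] by blast
    obtain C' M' where 3: "C' \<ge> 0" "\<And>\<gamma>. \<gamma> \<in> schwartz \<Longrightarrow> schwartz_norm M (pd i \<gamma>) \<le> C' * schwartz_norm M' \<gamma>"
      using schwartz_cont_norm[OF schwartz_cont_pd[of i], of M] by blast
    obtain D K where 2: "D \<ge> 0" "\<And>\<gamma> x. \<gamma> \<in> schwartz \<Longrightarrow> (1 + norm x) ^ k * cmod (iter_partial is (\<lambda>x. pd i f x * \<gamma> x) x) \<le> D * schwartz_norm K \<gamma>"
      using snoc.IH[OF temper_mult_pd[OF snoc.prems]] by blast
    have "(1 + norm x) ^ k * cmod (iter_partial (is @ [i]) (\<lambda>x. f x * \<gamma> x) x) \<le> (C * C' + D) * schwartz_norm (max M' K) \<gamma>"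
      if \<gamma>: "\<gamma> \<in> schwartz" for \<gamma> x
    proof -
      have "iter_partial (is @ [i]) (\<lambda>x. f x * \<gamma> x) = iter_partial is (\<lambda>x. f x * pd i \<gamma> x + pd i f x * \<gamma> x)"
        unfolding iter_partial_snoc
        by (subst pd_mult) (auto intro: temper_mult_differentiable schwartz_differentiable snoc.prems \<gamma>)
      also have "\<dots> = (\<lambda>x. iter_partial is (\<lambda>x. f x * pd i \<gamma> x) x + iter_partial is (\<lambda>x. pd i f x * \<gamma> x) x)"
        by (intro iter_partial_add schwartz_mult snoc.prems temper_mult_pd schwartz_pd \<gamma>)
      finally have "(1 + norm x) ^ k * cmod (iter_partial (is @ [i]) (\<lambda>x. f x * \<gamma> x) x) \<le>
          (1 + norm x) ^ k * cmod (iter_partial is (\<lambda>x. f x * pd i \<gamma> x) x) + (1 + norm x) ^ k * cmod (iter_partial is (\<lambda>x. pd i f x * \<gamma> x) x)"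
        unfolding distrib_left[symmetric]
        by (auto intro!: mult_left_mono norm_triangle_ineq)
      also have "\<dots> \<le> C * schwartz_norm M (pd i \<gamma>) + D * schwartz_norm K \<gamma>"
        using 1(2)[OF schwartz_pd[OF \<gamma>]] 2(2)[OF \<gamma>] by (intro add_mono) auto
      also have "\<dots> \<le> C * (C' * schwartz_norm M' \<gamma>) + D * schwartz_norm K \<gamma>"
        using 1(1) 2(1) 3(2)[OF \<gamma>] schwartz_norm_nonneg[OF \<gamma>] by (intro add_mono mult_left_mono) auto
      also have "\<dots> \<le> C * (C' * schwartz_norm (max M' K) \<gamma>) + D * schwartz_norm (max M' K) \<gamma>"
        using 1(1) 2(1) 3(1) \<gamma> by (intro add_mono mult_left_mono schwartz_norm_mono) auto
      finally show ?thesis by (simp add: algebra_simps)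
    qed
    then show ?case using 1(1) 2(1) 3(1) by (intro exI[of _ "C * C' + D"]) auto
  qed
qed (intro schwartz_mult assms)

section \<open>Integrals of Schwartz functions\<close>

lemma schwartz_continuous: "\<gamma> \<in> schwartz \<Longrightarrow> continuous_on UNIV \<gamma>"
  using differentiable_imp_continuous_on[of \<gamma> UNIV]
  by (simp add: differentiable_on_def schwartz_differentiable)

lemma schwartz_measurable: "\<gamma> \<in> schwartz \<Longrightarrow> \<gamma> \<in> borel_measurable borel"
  by (intro borel_measurable_continuous_onI schwartz_continuous)

text \<open>The exponent exceeds the dimension, so that the weight is integrable, and is an integer,
  so that a seminorm \<open>schwartz_norm\<close> measures decay of this order.\<close>

definition decay_weight :: "real ^ 'n::finite \<Rightarrow> real" where
  "decay_weight x = (1 + norm x) powr (- (real CARD('n) + 1))"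

lemma decay_weight_integrable: "integrable lborel (decay_weight :: real ^ 'n \<Rightarrow> real)"
  using integrable_japanese_bracket[of "real CARD('n) + 1", where 'a = "real ^ 'n"]
  by (simp add: decay_weight_def[abs_def])

lemma decay_weight_nonneg: "0 \<le> decay_weight x"
  by (simp add: decay_weight_def)

lemma decay_weight_bound:
  fixes x :: "real ^ 'n"
  assumes "(1 + norm x) ^ (CARD('n) + 1) * a \<le> C"
  shows "a \<le> C * decay_weight x"
proof -
  have p: "0 < 1 + norm x" by (simp add: add_pos_nonneg)
  have "decay_weight x = 1 / (1 + norm x) ^ (CARD('n) + 1)"
    unfolding decay_weight_def powr_minus_divide
    using p powr_realpow[OF p, of "CARD('n) + 1"] by (simp add: algebra_simps del: power_Suc)
  then have "a = (1 + norm x) ^ (CARD('n) + 1) * a * decay_weight x" using p by simp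
  also have "\<dots> \<le> C * decay_weight x"
    using assms by (rule mult_right_mono) (simp add: decay_weight_def)
  finally show ?thesis .
qed

lemma schwartz_le_decay_weight:
  fixes \<gamma> :: "real ^ 'n::finite \<Rightarrow> complex"
  assumes "\<gamma> \<in> schwartz"
  shows "(1 + norm x) ^ k * cmod (\<gamma> x) \<le> schwartz_norm (CARD('n) + 1 + k) \<gamma> * decay_weight x"
  using schwartz_norm_upper[OF assms, of "[]" "CARD('n) + 1 + k" "CARD('n) + 1 + k" x]
  by (intro decay_weight_bound) (simp add: power_add mult_ac)

lemma schwartz_integrable:
  assumes "\<gamma> \<in> schwartz"
  shows "integrable lborel \<gamma>"
proof (rule Bochner_Integration.integrable_bound)
  show "integrable lborel (\<lambda>x. schwartz_norm (CARD('a) + 1 + 0) \<gamma> * decay_weight x)"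
    by (intro integrable_mult_right decay_weight_integrable)
  show "AE x in lborel. cmod (\<gamma> x) \<le> norm (schwartz_norm (CARD('a) + 1 + 0) \<gamma> * decay_weight x)"
    using order_trans[OF schwartz_le_decay_weight[OF assms, of _ 0] abs_ge_self] by simp
qed (use schwartz_measurable[OF assms] in simp)

text \<open>Of the orders in the seminorm, \<open>k\<close> absorb the growth of \<open>u\<close>
  and the others leave the integrable \<open>decay_weight\<close>. This serves both the continuity
  of \<open>distr_of\<close> and, with \<open>k = 0\<close>, the bound on the Fourier
  transform.\<close>

lemma integral_schwartz_bound:
  fixes u :: "real ^ 'n::finite \<Rightarrow> complex"
  assumes u: "u \<in> borel_measurable borel" "\<And>x. cmod (u x) \<le> B * (1 + norm x) ^ k" and B: "B \<ge> 0"
    and \<gamma>: "\<gamma> \<in> schwartz"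
  shows "integrable lborel (\<lambda>x. u x * \<gamma> x)"
    and "cmod (LINT x|lborel. u x * \<gamma> x) \<le>
      B * (LINT x|lborel. decay_weight (x :: real ^ 'n)) * schwartz_norm (CARD('n) + 1 + k) \<gamma>"
proof -
  let ?N = "schwartz_norm (CARD('n) + 1 + k) \<gamma>"
  have b: "cmod (u x * \<gamma> x) \<le> B * ?N * decay_weight x" for x
  proof -
    have "cmod (u x * \<gamma> x) \<le> B * ((1 + norm x) ^ k * cmod (\<gamma> x))"
      unfolding norm_mult using mult_right_mono[OF u(2)[of x], of "cmod (\<gamma> x)"] by (simp add: mult_ac)
    also have "\<dots> \<le> B * (?N * decay_weight x)"
      by (intro mult_left_mono schwartz_le_decay_weight \<gamma> B)
    finally show ?thesis by (simp add: mult_ac)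
  qed
  have int: "integrable lborel (\<lambda>x::real^'n. B * ?N * decay_weight x)"
    by (intro integrable_mult_right decay_weight_integrable)
  show i: "integrable lborel (\<lambda>x. u x * \<gamma> x)"
    using u(1) schwartz_measurable[OF \<gamma>] b order_trans[OF b abs_ge_self]
    by (intro Bochner_Integration.integrable_bound[OF int]) auto
  have "cmod (LINT x|lborel. u x * \<gamma> x) \<le> (LINT x|lborel. B * ?N * decay_weight (x :: real^'n))"
    by (rule Bochner_Integration.integral_norm_bound_integral[OF i int b])
  then show "cmod (LINT x|lborel. u x * \<gamma> x) \<le> B * (LINT x|lborel. decay_weight (x :: real ^ 'n)) * ?N"
    by (simp add: mult_ac)
qed

section \<open>Fourier inversion on the Schwartz space\<close>

lemma schwartz_cont_sum:
  "finite A \<Longrightarrow> (\<And>a. a \<in> A \<Longrightarrow> schwartz_cont (L a)) \<Longrightarrow> schwartz_cont (\<lambda>\<gamma> x. \<Sum>a\<in>A. L a \<gamma> x)"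
proof (induction A rule: finite_induct)
  case empty
  then show ?case using schwartz_cont_mult[OF temper_mult.const[of 0]] by simp
qed (simp add: schwartz_cont_add)

lemma schwartz_cont_id: "schwartz_cont (\<lambda>\<gamma>. \<gamma>)"
  using schwartz_cont_mult[OF temper_mult.const[of 1]] by simp

lemma schwartz_cont_power: "schwartz_cont L \<Longrightarrow> schwartz_cont (L ^^ k)"
  by (induction k) (simp_all add: schwartz_cont_id id_def comp_def schwartz_cont_comp)

text \<open>A shift by at most 1 changes 1 + |x| by a factor of at most 2. This is used to dominate
  difference quotients uniformly in their step.\<close>

lemma decay_weight_shift:
  fixes x y :: "real ^ 'n"
  assumes "norm y \<le> 1"
  shows "decay_weight (x + y) \<le> 2 ^ (CARD('n) + 1) * decay_weight x"
proof (rule decay_weight_bound)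
  have "1 + norm x \<le> 2 * (1 + norm (x + y))"
    using assms norm_triangle_ineq4[of "x + y" y] norm_ge_zero[of "x + y"] by (simp del: norm_ge_zero)
  then have "(1 + norm x) ^ (CARD('n) + 1) \<le> (2 * (1 + norm (x + y))) ^ (CARD('n) + 1)"
    by (intro power_mono) auto
  then have "(1 + norm x) ^ (CARD('n) + 1) * decay_weight (x + y) \<le>
      (2 * (1 + norm (x + y))) ^ (CARD('n) + 1) * decay_weight (x + y)"
    by (intro mult_right_mono decay_weight_nonneg)
  also have "\<dots> = 2 ^ (CARD('n) + 1) * ((1 + norm (x + y)) powr (CARD('n) + 1) * (1 + norm (x + y)) powr (- (real CARD('n) + 1)))"
    by (simp only: power_mult_distrib decay_weight_def powr_realpow[OF add_pos_nonneg[OF zero_less_one norm_ge_zero]] mult.assoc)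
  also have "\<dots> = 2 ^ (CARD('n) + 1)"
    unfolding powr_add[symmetric] by (simp add: add_pos_nonneg add_nonneg_eq_0_iff)
  finally show "(1 + norm x) ^ (CARD('n) + 1) * decay_weight (x + y) \<le> 2 ^ (CARD('n) + 1)" .
qed

lemma has_vector_derivative_line:
  fixes h :: "real ^ 'n \<Rightarrow> complex"
  assumes "h \<in> schwartz"
  shows "((\<lambda>t. h (x + t *\<^sub>R axis i 1)) has_vector_derivative pd i h (x + t *\<^sub>R axis i 1)) (at t)"
proof -
  have d: "(h has_derivative frechet_derivative h (at (x + t *\<^sub>R axis i 1))) (at (x + t *\<^sub>R axis i 1))"
    using schwartz_differentiable[OF assms] by (simp add: frechet_derivative_works)
  have "((\<lambda>t. x + t *\<^sub>R axis i 1) has_derivative (\<lambda>s. s *\<^sub>R axis i 1)) (at t)"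
    by (auto intro!: derivative_eq_intros)
  from has_derivative_compose[OF this d] show ?thesis
    unfolding has_vector_derivative_def
    using linear_frechet_derivative[OF schwartz_differentiable[OF assms]]
    by (simp add: linear_cmul)
qed

text \<open>By translation invariance every difference quotient integrates to 0; the quotients
  converge to the partial derivative and are dominated by the mean value inequality. This is the
  source of all integrations by parts.\<close>

lemma integral_pd_schwartz:
  fixes h :: "real ^ 'n \<Rightarrow> complex"
  assumes h: "h \<in> schwartz"
  shows "(LINT x|lborel. pd i h x) = 0"
proof -
  define d where "d m = 1 / real (Suc m)" for m
  define f where "f m x = (h (x + d m *\<^sub>R axis i 1) - h x) /\<^sub>R d m" for m x
  \<comment> \<open>The mean value inequality evaluates the derivative within distance 1 of
    \<open>x\<close>; the power of 2 is the loss in \<open>decay_weight_shift\<close>.\<close>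
  define C where "C = schwartz_norm (CARD('n) + 1 + 0) (pd i h) * 2 ^ (CARD('n) + 1)"
  note pdh = schwartz_pd[OF h, of i]
  have d: "0 < d m" "d m \<le> 1" for m by (auto simp: d_def)
  have dlim: "d \<longlonglongrightarrow> 0" unfolding d_def[abs_def] by (rule lim_1_over_n[THEN LIMSEQ_Suc])
  have [measurable]: "h \<in> borel_measurable borel" "pd i h \<in> borel_measurable borel"
    using h pdh by (auto intro: schwartz_measurable)
  have lim: "(\<lambda>m. f m x) \<longlonglongrightarrow> pd i h x" for x
  proof -
    have "((\<lambda>t. (h (x + t *\<^sub>R axis i 1) - h x) /\<^sub>R t) \<longlongrightarrow> pd i h x) (at 0)"
    proof (rule Lim_null[THEN iffD2], rule tendsto_norm_zero_cancel, rule Lim_transform_eventually)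
      show "((\<lambda>t. norm (h (x + (0 + t) *\<^sub>R axis i 1) - h (x + 0 *\<^sub>R axis i 1) - t *\<^sub>R pd i h (x + 0 *\<^sub>R axis i 1)) / norm t) \<longlongrightarrow> 0) (at 0)"
        using has_vector_derivative_line[OF h, of x i 0]
        unfolding has_vector_derivative_def has_derivative_at by (rule conjunct2)
      have "norm (h (x + (0 + t) *\<^sub>R axis i 1) - h (x + 0 *\<^sub>R axis i 1) - t *\<^sub>R pd i h (x + 0 *\<^sub>R axis i 1)) / norm t =
          norm ((h (x + t *\<^sub>R axis i 1) - h x) /\<^sub>R t - pd i h x)" if "t \<noteq> 0" for t
      proof -
        have "(h (x + t *\<^sub>R axis i 1) - h x) /\<^sub>R t - pd i h x =
            inverse t *\<^sub>R (h (x + t *\<^sub>R axis i 1) - h x - t *\<^sub>R pd i h x)"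
          using that by (simp add: scaleR_diff_right)
        then show ?thesis by (simp add: divide_inverse mult.commute)
      qed
      then show "\<forall>\<^sub>F t in at 0. norm (h (x + (0 + t) *\<^sub>R axis i 1) - h (x + 0 *\<^sub>R axis i 1) - t *\<^sub>R pd i h (x + 0 *\<^sub>R axis i 1)) / norm t =
          norm ((h (x + t *\<^sub>R axis i 1) - h x) /\<^sub>R t - pd i h x)"
        unfolding eventually_at_filter by (intro always_eventually allI impI)
    qed
    moreover have "filterlim d (at 0) sequentially"
      using dlim d by (intro filterlim_atI) (auto simp: less_imp_neq[OF d(1), symmetric])
    ultimately show ?thesis unfolding f_def by (rule filterlim_compose)
  qed
  have bound: "cmod (f m x) \<le> C * decay_weight x" for m x
  proof -
    have "norm (h (x + d m *\<^sub>R axis i 1) - h (x + 0 *\<^sub>R axis i 1)) \<le> (C * decay_weight x) * norm (d m - 0)"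
    proof (rule differentiable_bound[of "{0..d m}"])
      show "((\<lambda>t. h (x + t *\<^sub>R axis i 1)) has_derivative (\<lambda>s. s *\<^sub>R pd i h (x + t *\<^sub>R axis i 1))) (at t within {0..d m})" for t
        using has_vector_derivative_line[OF h, of x i t]
        by (simp add: has_vector_derivative_def has_derivative_at_withinI)
      show "onorm (\<lambda>s. s *\<^sub>R pd i h (x + t *\<^sub>R axis i 1)) \<le> C * decay_weight x" if t: "t \<in> {0..d m}" for t
      proof (rule onorm_bound)
        have "cmod (pd i h (x + t *\<^sub>R axis i 1)) \<le> schwartz_norm (CARD('n) + 1 + 0) (pd i h) * decay_weight (x + t *\<^sub>R axis i 1)"
          using schwartz_le_decay_weight[OF pdh, of _ 0] by simp
        also have "\<dots> \<le> schwartz_norm (CARD('n) + 1 + 0) (pd i h) * (2 ^ (CARD('n) + 1) * decay_weight x)"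
          using t d[of m] by (intro mult_left_mono decay_weight_shift schwartz_norm_nonneg pdh) (auto simp: norm_axis_1)
        finally have "cmod (pd i h (x + t *\<^sub>R axis i 1)) \<le> C * decay_weight x" by (simp add: C_def mult.assoc)
        then show "norm (s *\<^sub>R pd i h (x + t *\<^sub>R axis i 1)) \<le> C * decay_weight x * norm s" for s
          using mult_right_mono[of "cmod (pd i h (x + t *\<^sub>R axis i 1))" "C * decay_weight x" "\<bar>s\<bar>"]
          by (simp add: mult.commute[of "\<bar>s\<bar>"])
      qed (auto simp: C_def intro!: mult_nonneg_nonneg decay_weight_nonneg schwartz_norm_nonneg pdh)
    qed (use d(1)[of m] in auto)
    then show ?thesis using d(1)[of m] unfolding f_def by (simp add: divide_simps)
  qed
  have "(\<lambda>m. LINT x|lborel. f m x) \<longlonglongrightarrow> (LINT x|lborel. pd i h x)"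
    by (rule integral_dominated_convergence[where w = "\<lambda>x. C * decay_weight x"])
       (use lim bound decay_weight_integrable in \<open>auto simp: f_def\<close>)
  moreover have "(LINT x|lborel. f m x) = 0" for m
    unfolding f_def using schwartz_integrable[OF h]
    by (simp add: integrable_lborel_translate integral_lborel_translate)
  ultimately show ?thesis using LIMSEQ_unique[OF _ tendsto_const] by simp
qed

section \<open>The Fourier transform as an oscillatory integral with a sign\<close>

definition osc_const :: "'n::finite itself \<Rightarrow> real" where
  "osc_const _ = (2 * pi) powr (- real CARD('n) / 2)"

text \<open>\<sigma> = -1 gives the Fourier transform and \<sigma> = 1 its inverse, so that the
  calculus is proved once for both; decay statements ask for
  \<open>\<sigma>\<^sup>2 = 1\<close>.\<close>

definition osc :: "real \<Rightarrow> (real ^ 'n::finite \<Rightarrow> complex) \<Rightarrow> real ^ 'n \<Rightarrow> complex" where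
  "osc \<sigma> \<gamma> \<omega> = complex_of_real (osc_const TYPE('n)) * (LINT x|lborel. iexp (x \<bullet> (\<sigma> *\<^sub>R \<omega>)) * \<gamma> x)"

lemma osc_const_pos: "osc_const TYPE('n::finite) > 0"
  by (simp add: osc_const_def)

lemma fourier_eq_osc: "fourier \<gamma> = osc (-1) \<gamma>"
  by (rule ext) (simp add: fourier_def osc_def osc_const_def mult.commute)

lemma inv_fourier_eq_osc: "inv_fourier \<gamma> = osc 1 \<gamma>"
  by (rule ext) (simp add: inv_fourier_def osc_def osc_const_def mult.commute inner_commute)

lemma osc_integrable: "\<gamma> \<in> schwartz \<Longrightarrow> integrable lborel (\<lambda>x. iexp (x \<bullet> y) * \<gamma> x)"
  by (intro schwartz_integrable schwartz_mult temper_mult.char)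

lemma osc_bound:
  fixes \<gamma> :: "real ^ 'n::finite \<Rightarrow> complex"
  assumes "\<gamma> \<in> schwartz"
  shows "cmod (osc \<sigma> \<gamma> \<omega>) \<le> osc_const TYPE('n) * (LINT x|lborel. decay_weight (x :: real ^ 'n)) * schwartz_norm (CARD('n) + 1) \<gamma>"
proof -
  have "cmod (LINT x|lborel. iexp (x \<bullet> (\<sigma> *\<^sub>R \<omega>)) * \<gamma> x) \<le>
      1 * (LINT x|lborel. decay_weight (x :: real ^ 'n)) * schwartz_norm (CARD('n) + 1 + 0) \<gamma>"
    by (rule integral_schwartz_bound(2)) (use assms in \<open>auto intro!: borel_measurable_continuous_onI continuous_intros\<close>)
  then show ?thesis
    using osc_const_pos[where 'n='n] by (simp add: osc_def norm_mult mult.assoc mult_left_mono)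
qed

lemma osc_cmult: "osc \<sigma> (\<lambda>x. c * \<gamma> x) \<omega> = c * osc \<sigma> \<gamma> \<omega>"
  unfolding osc_def by (simp add: mult.left_commute[of _ c])

lemma osc_add: 
  "\<gamma> \<in> schwartz \<Longrightarrow> \<eta> \<in> schwartz \<Longrightarrow> osc \<sigma> (\<lambda>x. \<gamma> x + \<eta> x) \<omega> = osc \<sigma> \<gamma> \<omega> + osc \<sigma> \<eta> \<omega>"
  unfolding osc_def by (simp add: distrib_left osc_integrable del: inner_scaleR_right)

lemma schwartz_sum:
  "finite A \<Longrightarrow> (\<And>a. a \<in> A \<Longrightarrow> \<gamma> a \<in> schwartz) \<Longrightarrow> (\<lambda>x. \<Sum>a\<in>A. \<gamma> a x) \<in> schwartz"
proof (induction A rule: finite_induct)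
  case empty
  show ?case using schwartz_cmult[OF schwartz_gauss[OF _ temper_mult.const, of 1], of 0] by simp
qed (simp add: schwartz_add)

lemma osc_sum:
  "finite A \<Longrightarrow> (\<And>a. a \<in> A \<Longrightarrow> \<gamma> a \<in> schwartz) \<Longrightarrow> osc \<sigma> (\<lambda>x. \<Sum>a\<in>A. \<gamma> a x) \<omega> = (\<Sum>a\<in>A. osc \<sigma> (\<gamma> a) \<omega>)"
  unfolding osc_def by (simp add: sum_distrib_left osc_integrable del: inner_scaleR_right)

lemma osc_modulate:
  "osc \<sigma> (\<lambda>x. iexp (x \<bullet> (\<sigma> *\<^sub>R y)) * \<gamma> x) \<omega> = osc \<sigma> \<gamma> (\<omega> + y)"
  unfolding osc_def by (simp add: scaleR_add_right inner_add_right distrib_left exp_add mult_ac)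

text \<open>The factor that differentiation of \<open>osc\<close> in direction \<open>i\<close>
  brings down from the exponential; see \<open>osc_pd\<close>.\<close>

definition coord_op :: "real \<Rightarrow> 'n::finite \<Rightarrow> (real ^ 'n \<Rightarrow> complex) \<Rightarrow> real ^ 'n \<Rightarrow> complex" where
  "coord_op \<sigma> i \<gamma> = (\<lambda>x. (\<i> * complex_of_real \<sigma> * complex_of_real (x $ i)) * \<gamma> x)"

lemma schwartz_cont_coord_op: "schwartz_cont (coord_op \<sigma> i)"
  unfolding coord_op_def by (intro schwartz_cont_mult temper_mult.intros)

lemma iexp_taylor1: "cmod (iexp (a + b) - iexp a - \<i> * complex_of_real b * iexp a) \<le> b\<^sup>2 / 2"
proof -
  have "cmod (iexp b - (1 + \<i> * b)) \<le> b\<^sup>2 / 2"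
    using iexp_approx1[of b 1] by (simp add: power2_eq_square)
  moreover have "iexp (a + b) - iexp a - \<i> * complex_of_real b * iexp a = iexp a * (iexp b - (1 + \<i> * b))"
    by (simp add: exp_add algebra_simps)
  ultimately show ?thesis by (simp add: norm_mult)
qed

text \<open>Subtracting the first-order Taylor polynomial of the exponential leaves a remainder
  bounded by |x|^2 times the square of the increment. The second absolute moment of a Schwartz
  function is finite, so the total error is quadratic in the increment.\<close>

lemma osc_has_derivative:
  fixes \<gamma> :: "real ^ 'n::finite \<Rightarrow> complex"
  assumes \<gamma>: "\<gamma> \<in> schwartz"
  shows "(osc \<sigma> \<gamma> has_derivative (\<lambda>v. \<Sum>i\<in>UNIV. complex_of_real (v $ i) * osc \<sigma> (coord_op \<sigma> i \<gamma>) \<omega>)) (at \<omega>)"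
proof -
  let ?D = "\<lambda>v. \<Sum>i\<in>UNIV. complex_of_real (v $ i) * osc \<sigma> (coord_op \<sigma> i \<gamma>) \<omega>"
  define C where "C = osc_const TYPE('n) * (\<sigma>\<^sup>2 / 2 * (LINT x|lborel. (norm x)\<^sup>2 * cmod (\<gamma> x)))"
  have sq: "integrable lborel (\<lambda>x. (norm x)\<^sup>2 * cmod (\<gamma> x))"
  proof (rule Bochner_Integration.integrable_bound)
    show "integrable lborel (\<lambda>x. schwartz_norm (CARD('n) + 1 + 2) \<gamma> * decay_weight x)"
      by (intro integrable_mult_right decay_weight_integrable)
    have "(norm x)\<^sup>2 * cmod (\<gamma> x) \<le> schwartz_norm (CARD('n) + 1 + 2) \<gamma> * decay_weight x" for x
    proof -
      have "(norm x)\<^sup>2 * cmod (\<gamma> x) \<le> (1 + norm x)\<^sup>2 * cmod (\<gamma> x)"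
        by (intro mult_right_mono power_mono) auto
      then show ?thesis using schwartz_le_decay_weight[OF \<gamma>, of x 2] by linarith
    qed
    then show "AE x in lborel. norm ((norm x)\<^sup>2 * cmod (\<gamma> x)) \<le> norm (schwartz_norm (CARD('n) + 1 + 2) \<gamma> * decay_weight x)"
      using order_trans[OF _ abs_ge_self] by auto
  qed (use schwartz_measurable[OF \<gamma>] in simp)
  have D: "?D v = complex_of_real (osc_const TYPE('n)) * (LINT x|lborel. \<i> * complex_of_real (x \<bullet> (\<sigma> *\<^sub>R v)) * iexp (x \<bullet> (\<sigma> *\<^sub>R \<omega>)) * \<gamma> x)"
    and Dint: "integrable lborel (\<lambda>x. \<i> * complex_of_real (x \<bullet> (\<sigma> *\<^sub>R v)) * iexp (x \<bullet> (\<sigma> *\<^sub>R \<omega>)) * \<gamma> x)" for v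
  proof -
    have e: "\<i> * complex_of_real (x \<bullet> (\<sigma> *\<^sub>R v)) * iexp (x \<bullet> (\<sigma> *\<^sub>R \<omega>)) * \<gamma> x =
       iexp (x \<bullet> (\<sigma> *\<^sub>R \<omega>)) * (\<Sum>i\<in>UNIV. complex_of_real (v $ i) * coord_op \<sigma> i \<gamma> x)" for x
    proof -
      have "complex_of_real (x \<bullet> (\<sigma> *\<^sub>R v)) = (\<Sum>i\<in>UNIV. complex_of_real \<sigma> * (complex_of_real (x $ i) * complex_of_real (v $ i)))"
        by (simp add: inner_vec_def sum_distrib_left mult_ac)
      then show ?thesis
        by (simp add: coord_op_def sum_distrib_left sum_distrib_right mult_ac del: inner_scaleR_right)
    qed
    have s: "(\<lambda>x. complex_of_real (v $ i) * coord_op \<sigma> i \<gamma> x) \<in> schwartz" for i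
      by (intro schwartz_cmult schwartz_cont_schwartz[OF schwartz_cont_coord_op] \<gamma>)
    have "?D v = osc \<sigma> (\<lambda>x. \<Sum>i\<in>UNIV. complex_of_real (v $ i) * coord_op \<sigma> i \<gamma> x) \<omega>"
      using s by (subst osc_sum) (simp_all add: osc_cmult)
    then show "?D v = complex_of_real (osc_const TYPE('n)) * (LINT x|lborel. \<i> * complex_of_real (x \<bullet> (\<sigma> *\<^sub>R v)) * iexp (x \<bullet> (\<sigma> *\<^sub>R \<omega>)) * \<gamma> x)"
      unfolding e osc_def .
    show "integrable lborel (\<lambda>x. \<i> * complex_of_real (x \<bullet> (\<sigma> *\<^sub>R v)) * iexp (x \<bullet> (\<sigma> *\<^sub>R \<omega>)) * \<gamma> x)"
      unfolding e by (intro osc_integrable schwartz_sum s) simp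
  qed
  have bound: "cmod (osc \<sigma> \<gamma> y - osc \<sigma> \<gamma> \<omega> - ?D (y - \<omega>)) \<le> C * (norm (y - \<omega>))\<^sup>2" for y
  proof -
    define v where "v = y - \<omega>"
    have y: "y = \<omega> + v" by (simp add: v_def)
    let ?r = "\<lambda>x. iexp (x \<bullet> (\<sigma> *\<^sub>R \<omega>) + x \<bullet> (\<sigma> *\<^sub>R v)) - iexp (x \<bullet> (\<sigma> *\<^sub>R \<omega>)) - \<i> * complex_of_real (x \<bullet> (\<sigma> *\<^sub>R v)) * iexp (x \<bullet> (\<sigma> *\<^sub>R \<omega>))"
    have i1: "integrable lborel (\<lambda>x. iexp (x \<bullet> (\<sigma> *\<^sub>R \<omega>) + x \<bullet> (\<sigma> *\<^sub>R v)) * \<gamma> x)"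
      using osc_integrable[OF \<gamma>, of "\<sigma> *\<^sub>R \<omega> + \<sigma> *\<^sub>R v"] by (simp add: inner_add_right del: inner_scaleR_right)
    have i2: "integrable lborel (\<lambda>x. iexp (x \<bullet> (\<sigma> *\<^sub>R \<omega>)) * \<gamma> x)" by (rule osc_integrable[OF \<gamma>])
    have eq: "osc \<sigma> \<gamma> y - osc \<sigma> \<gamma> \<omega> - ?D v = complex_of_real (osc_const TYPE('n)) * (LINT x|lborel. ?r x * \<gamma> x)"
      unfolding D unfolding osc_def y scaleR_add_right inner_add_right left_diff_distrib
      using i1 i2 Dint[of v] by (simp add: right_diff_distrib del: inner_scaleR_right)
    have int: "integrable lborel (\<lambda>x. ?r x * \<gamma> x)"
      unfolding left_diff_distrib by (intro Bochner_Integration.integrable_diff i1 i2 Dint)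
    have "cmod (LINT x|lborel. ?r x * \<gamma> x) \<le> (LINT x|lborel. (\<sigma>\<^sup>2 / 2 * (norm v)\<^sup>2) * ((norm x)\<^sup>2 * cmod (\<gamma> x)))"
    proof (rule Bochner_Integration.integral_norm_bound_integral[OF int])
      show "integrable lborel (\<lambda>x. (\<sigma>\<^sup>2 / 2 * (norm v)\<^sup>2) * ((norm x)\<^sup>2 * cmod (\<gamma> x)))"
        by (intro integrable_mult_right sq)
      fix x
      have "cmod (?r x) \<le> (x \<bullet> (\<sigma> *\<^sub>R v))\<^sup>2 / 2" by (rule iexp_taylor1)
      also have "(x \<bullet> (\<sigma> *\<^sub>R v))\<^sup>2 \<le> (norm x * norm (\<sigma> *\<^sub>R v))\<^sup>2"
        by (intro power2_le_iff_abs_le[THEN iffD2] Cauchy_Schwarz_ineq2) auto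
      finally have "cmod (?r x) \<le> (\<sigma>\<^sup>2 / 2 * (norm v)\<^sup>2) * (norm x)\<^sup>2"
        by (simp add: power_mult_distrib mult_ac)
      from mult_right_mono[OF this, of "cmod (\<gamma> x)"]
      show "cmod (?r x * \<gamma> x) \<le> (\<sigma>\<^sup>2 / 2 * (norm v)\<^sup>2) * ((norm x)\<^sup>2 * cmod (\<gamma> x))"
        by (simp only: norm_mult mult.assoc norm_ge_zero)
    qed
    also have "\<dots> = (\<sigma>\<^sup>2 / 2 * (norm v)\<^sup>2) * (LINT x|lborel. (norm x)\<^sup>2 * cmod (\<gamma> x))" by simp
    finally show ?thesis
      unfolding v_def[symmetric] eq C_def norm_mult
      using osc_const_pos[where 'n='n] mult_left_mono[of _ _ "osc_const TYPE('n)"]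
      by (simp add: mult_ac)
  qed
  show ?thesis
  proof (rule has_derivativeI_sandwich[where e = 1 and H = "\<lambda>y. C * norm (y - \<omega>)"])
    show "bounded_linear ?D"
      by (intro bounded_linear_sum bounded_linear_mult_left[THEN bounded_linear_compose]
        bounded_linear_of_real[THEN bounded_linear_compose] bounded_linear_vec_nth)
    show "((\<lambda>y. C * norm (y - \<omega>)) \<longlongrightarrow> 0) (at \<omega>)"
      by (auto intro!: tendsto_eq_intros)
    fix y assume "y \<noteq> \<omega>"
    then show "norm (osc \<sigma> \<gamma> y - osc \<sigma> \<gamma> \<omega> - ?D (y - \<omega>)) / norm (y - \<omega>) \<le> C * norm (y - \<omega>)"
      using bound[of y] by (simp add: divide_le_eq power2_eq_square mult.assoc)
  qed simp
qed

lemma osc_pd: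
  fixes \<gamma> :: "real ^ 'n::finite \<Rightarrow> complex"
  assumes \<gamma>: "\<gamma> \<in> schwartz"
  shows "pd i (osc \<sigma> \<gamma>) = osc \<sigma> (coord_op \<sigma> i \<gamma>)"
proof -
  have "(\<Sum>j\<in>UNIV. complex_of_real ((axis i 1 :: real ^ 'n) $ j) * z j) = z i" for z
    by (simp add: axis_def if_distrib[of complex_of_real] if_distrib[of "\<lambda>x. x * _"] cong: if_cong)
  then show ?thesis by (subst pd_eqI[OF osc_has_derivative[OF \<gamma>]]) simp
qed

text \<open>Integration by parts: the partial derivative of the exponential times \<gamma>
  integrates to 0, and the product rule splits it into the two sides.\<close>

lemma osc_coord:
  fixes \<gamma> :: "real ^ 'n::finite \<Rightarrow> complex"
  assumes \<gamma>: "\<gamma> \<in> schwartz"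
  shows "\<i> * complex_of_real \<sigma> * complex_of_real (\<omega> $ i) * osc \<sigma> \<gamma> \<omega> = - osc \<sigma> (pd i \<gamma>) \<omega>"
proof -
  let ?e = "\<lambda>x. iexp (x \<bullet> (\<sigma> *\<^sub>R \<omega>))"
  have "0 = (LINT x|lborel. pd i (\<lambda>x. ?e x * \<gamma> x) x)"
    by (intro integral_pd_schwartz[symmetric] schwartz_mult temper_mult.char \<gamma>)
  also have "pd i (\<lambda>x. ?e x * \<gamma> x) = (\<lambda>x. ?e x * pd i \<gamma> x + pd i ?e x * \<gamma> x)"
    by (rule pd_mult) (rule temper_mult_differentiable[OF temper_mult.char] schwartz_differentiable[OF \<gamma>])+
  also have "pd i ?e = (\<lambda>x. \<i> * complex_of_real (axis i 1 \<bullet> (\<sigma> *\<^sub>R \<omega>)) * ?e x)"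
    by (rule pd_eqI[OF has_derivative_iexp])
  also have "(LINT x|lborel. ?e x * pd i \<gamma> x + (\<i> * complex_of_real (axis i 1 \<bullet> (\<sigma> *\<^sub>R \<omega>)) * ?e x) * \<gamma> x) =
     (LINT x|lborel. ?e x * pd i \<gamma> x) + (\<i> * complex_of_real (axis i 1 \<bullet> (\<sigma> *\<^sub>R \<omega>))) * (LINT x|lborel. ?e x * \<gamma> x)"
    using osc_integrable[OF \<gamma>, of "\<sigma> *\<^sub>R \<omega>"] osc_integrable[OF schwartz_pd[OF \<gamma>], of "\<sigma> *\<^sub>R \<omega>"]
    by (simp add: mult.assoc del: inner_scaleR_right)
  finally have "(LINT x|lborel. ?e x * pd i \<gamma> x) + (\<i> * complex_of_real (axis i 1 \<bullet> (\<sigma> *\<^sub>R \<omega>))) * (LINT x|lborel. ?e x * \<gamma> x) = 0"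
    by (rule sym)
  from minus_unique[OF this, symmetric]
  have "(\<i> * complex_of_real (axis i 1 \<bullet> (\<sigma> *\<^sub>R \<omega>))) * (LINT x|lborel. ?e x * \<gamma> x) = - (LINT x|lborel. ?e x * pd i \<gamma> x)" .
  then show ?thesis
    by (simp add: osc_def inner_axis' mult_ac)
qed

text \<open>The operator 1 minus the Laplacian, with symbol 1 + |\<omega>|^2. Its iterates trade
  smoothness of the argument for decay of the transform.\<close>

definition bessel_op :: "(real ^ 'n::finite \<Rightarrow> complex) \<Rightarrow> real ^ 'n \<Rightarrow> complex" where
  "bessel_op \<gamma> = (\<lambda>x. \<gamma> x + (\<Sum>i\<in>UNIV. (-1) * pd i (pd i \<gamma>) x))"

lemma schwartz_cont_bessel_op: "schwartz_cont bessel_op"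
  unfolding bessel_op_def
  by (intro schwartz_cont_add schwartz_cont_id schwartz_cont_sum finite
      schwartz_cont_comp[OF schwartz_cont_mult[OF temper_mult.const]]
      schwartz_cont_comp[OF schwartz_cont_pd] schwartz_cont_pd)

lemma osc_bessel_op:
  fixes \<gamma> :: "real ^ 'n::finite \<Rightarrow> complex"
  assumes \<sigma>: "\<sigma>\<^sup>2 = 1" and \<gamma>: "\<gamma> \<in> schwartz"
  shows "osc \<sigma> (bessel_op \<gamma>) \<omega> = complex_of_real (1 + (norm \<omega>)\<^sup>2) * osc \<sigma> \<gamma> \<omega>"
proof -
  have 1: "(\<lambda>x. (-1) * pd i (pd i \<gamma>) x) \<in> schwartz" for i
    by (intro schwartz_cmult schwartz_pd \<gamma>)
  have 2: "osc \<sigma> (pd i (pd i \<gamma>)) \<omega> = - complex_of_real ((\<omega> $ i)\<^sup>2) * osc \<sigma> \<gamma> \<omega>" for i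
  proof -
    have "osc \<sigma> (pd i (pd i \<gamma>)) \<omega> = (\<i> * complex_of_real \<sigma> * complex_of_real (\<omega> $ i))\<^sup>2 * osc \<sigma> \<gamma> \<omega>"
      using osc_coord[OF \<gamma>, of \<sigma> \<omega> i] osc_coord[OF schwartz_pd[OF \<gamma>], of \<sigma> \<omega> i i]
      by (simp add: power2_eq_square mult.assoc)
    also have "(\<i> * complex_of_real \<sigma> * complex_of_real (\<omega> $ i))\<^sup>2 = - complex_of_real (\<sigma>\<^sup>2) * complex_of_real ((\<omega> $ i)\<^sup>2)"
      by (simp add: power_mult_distrib)
    finally show ?thesis by (simp add: \<sigma>)
  qed
  have "osc \<sigma> (bessel_op \<gamma>) \<omega> = osc \<sigma> \<gamma> \<omega> + (\<Sum>i\<in>UNIV. (-1) * osc \<sigma> (pd i (pd i \<gamma>)) \<omega>)"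
    unfolding bessel_op_def
    by (subst osc_add[OF \<gamma> schwartz_sum[OF _ 1]]) (simp_all only: osc_sum[OF _ 1] osc_cmult finite)
  also have "\<dots> = osc \<sigma> \<gamma> \<omega> + (\<Sum>i\<in>UNIV. complex_of_real ((\<omega> $ i)\<^sup>2)) * osc \<sigma> \<gamma> \<omega>"
    by (simp add: 2 sum_distrib_right)
  also have "(\<Sum>i\<in>UNIV. complex_of_real ((\<omega> $ i)\<^sup>2)) = complex_of_real ((norm \<omega>)\<^sup>2)"
    unfolding power2_norm_eq_inner by (simp add: inner_vec_def power2_eq_square)
  finally show ?thesis by (simp add: algebra_simps)
qed

text \<open>The symbol of the k-th iterate is (1 + |\<omega>|^2)^k, and 1 + |\<omega>| <= 2 (1 +
  |\<omega>|^2) accounts for the power of 2.\<close>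

lemma osc_decay:
  fixes \<gamma> :: "real ^ 'n::finite \<Rightarrow> complex"
  assumes \<sigma>: "\<sigma>\<^sup>2 = 1" and \<gamma>: "\<gamma> \<in> schwartz"
  shows "(1 + norm \<omega>) ^ k * cmod (osc \<sigma> \<gamma> \<omega>) \<le> 2 ^ k * cmod (osc \<sigma> ((bessel_op ^^ k) \<gamma>) \<omega>)"
proof -
  have eq: "osc \<sigma> ((bessel_op ^^ k) \<gamma>) \<omega> = complex_of_real (1 + (norm \<omega>)\<^sup>2) ^ k * osc \<sigma> \<gamma> \<omega>" for k
  proof (induction k)
    case (Suc k)
    have "(bessel_op ^^ k) \<gamma> \<in> schwartz"
      by (rule schwartz_cont_schwartz[OF schwartz_cont_power[OF schwartz_cont_bessel_op] \<gamma>])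
    from osc_bessel_op[OF \<sigma> this] Suc show ?case by simp
  qed simp
  have "1 + norm \<omega> \<le> 2 * (1 + (norm \<omega>)\<^sup>2)"
  proof -
    have "0 \<le> (1 - norm \<omega>)\<^sup>2" "0 \<le> (norm \<omega>)\<^sup>2" by auto
    moreover have "(1 - norm \<omega>)\<^sup>2 = 1 - 2 * norm \<omega> + (norm \<omega>)\<^sup>2" by (simp add: power2_diff)
    moreover have "2 * (1 + (norm \<omega>)\<^sup>2) = 2 + 2 * (norm \<omega>)\<^sup>2" by simp
    ultimately show ?thesis by linarith
  qed
  then have "(1 + norm \<omega>) ^ k \<le> (2 * (1 + (norm \<omega>)\<^sup>2)) ^ k" by (intro power_mono) auto
  from mult_right_mono[OF this, of "cmod (osc \<sigma> \<gamma> \<omega>)"]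
  have "(1 + norm \<omega>) ^ k * cmod (osc \<sigma> \<gamma> \<omega>) \<le> 2 ^ k * ((1 + (norm \<omega>)\<^sup>2) ^ k * cmod (osc \<sigma> \<gamma> \<omega>))"
    by (simp add: power_mult_distrib mult_ac del: distrib_left_numeral distrib_right_numeral)
  also have "(1 + (norm \<omega>)\<^sup>2) ^ k = cmod (complex_of_real (1 + (norm \<omega>)\<^sup>2) ^ k)"
    by (simp only: norm_power norm_of_real) (simp add: abs_of_nonneg)
  finally show ?thesis unfolding eq norm_mult .
qed

text \<open>Coinduction on the image of the Schwartz space: \<open>osc_pd\<close> keeps derivatives
  in the image, and \<open>osc_decay\<close> reduces decay to the boundedness of another
  transform.\<close>

lemma schwartz_osc:
  fixes \<gamma> :: "real ^ 'n::finite \<Rightarrow> complex"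
  assumes \<sigma>: "\<sigma>\<^sup>2 = 1" and \<gamma>: "\<gamma> \<in> schwartz"
  shows "osc \<sigma> \<gamma> \<in> schwartz"
proof (rule schwartz_coinduct[of _ "osc \<sigma> ` schwartz"])
  fix f :: "real ^ 'n \<Rightarrow> complex" assume "f \<in> osc \<sigma> ` schwartz"
  then obtain \<eta> where f: "f = osc \<sigma> \<eta>" and \<eta>: "\<eta> \<in> schwartz" by auto
  show "f differentiable (at x)" for x
    using osc_has_derivative[OF \<eta>] unfolding f differentiable_def by blast
  show "pd i f \<in> osc \<sigma> ` schwartz" for i
    unfolding f osc_pd[OF \<eta>] by (intro imageI schwartz_cont_schwartz[OF schwartz_cont_coord_op] \<eta>)
  show "\<exists>B. \<forall>x. (1 + norm x) ^ k * cmod (f x) \<le> B" for k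
  proof -
    have b: "(bessel_op ^^ k) \<eta> \<in> schwartz"
      by (rule schwartz_cont_schwartz[OF schwartz_cont_power[OF schwartz_cont_bessel_op] \<eta>])
    have "(1 + norm x) ^ k * cmod (f x) \<le> 2 ^ k * (osc_const TYPE('n) *
        (LINT x|lborel. decay_weight (x :: real ^ 'n)) * schwartz_norm (CARD('n) + 1) ((bessel_op ^^ k) \<eta>))" for x
      unfolding f
    proof (rule order_trans[OF osc_decay[OF \<sigma> \<eta>]])
      show "2 ^ k * cmod (osc \<sigma> ((bessel_op ^^ k) \<eta>) x) \<le> 2 ^ k * (osc_const TYPE('n) *
        (LINT x|lborel. decay_weight (x :: real ^ 'n)) * schwartz_norm (CARD('n) + 1) ((bessel_op ^^ k) \<eta>))"
        by (rule mult_left_mono[OF osc_bound[OF b]]) (rule zero_le_power, simp)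
    qed
    then show ?thesis by blast
  qed
qed (use \<gamma> in simp)

text \<open>Derivatives of the transform pass inside as \<open>coord_op\<close> and weights as
  iterates of \<open>bessel_op\<close>. Both are continuous, and \<open>osc_bound\<close> finishes
  with a fixed order of the seminorm.\<close>

lemma schwartz_cont_osc:
  assumes \<sigma>: "\<sigma>\<^sup>2 = 1"
  shows "schwartz_cont (osc \<sigma> :: (real ^ 'n::finite \<Rightarrow> complex) \<Rightarrow> _)"
proof (rule schwartz_contI)
  fix "is" :: "'n list" and k
  have "\<exists>L. schwartz_cont L \<and> (\<forall>\<gamma>\<in>schwartz. iter_partial is (osc \<sigma> \<gamma>) = osc \<sigma> (L \<gamma>))"
  proof (induction "is")
    case Nil
    show ?case by (intro exI[of _ "\<lambda>\<gamma>. \<gamma>"]) (simp add: schwartz_cont_id)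
  next
    case (Cons i "is")
    then obtain L where L: "schwartz_cont L" "\<And>\<gamma>. \<gamma> \<in> schwartz \<Longrightarrow> iter_partial is (osc \<sigma> \<gamma>) = osc \<sigma> (L \<gamma>)" by blast
    show ?case
      by (intro exI[of _ "\<lambda>\<gamma>. coord_op \<sigma> i (L \<gamma>)"])
         (use L in \<open>auto intro!: schwartz_cont_comp[OF schwartz_cont_coord_op] simp: osc_pd schwartz_cont_schwartz\<close>)
  qed
  then obtain L where L: "schwartz_cont L" "\<And>\<gamma>. \<gamma> \<in> schwartz \<Longrightarrow> iter_partial is (osc \<sigma> \<gamma>) = osc \<sigma> (L \<gamma>)" by blast
  have B: "schwartz_cont (\<lambda>\<gamma>. (bessel_op ^^ k) (L \<gamma>))"
    by (intro schwartz_cont_comp[OF schwartz_cont_power[OF schwartz_cont_bessel_op]] L)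
  obtain C M where C: "C \<ge> 0" "\<And>\<gamma>. \<gamma> \<in> schwartz \<Longrightarrow> schwartz_norm (CARD('n) + 1) ((bessel_op ^^ k) (L \<gamma>)) \<le> C * schwartz_norm M \<gamma>"
    using schwartz_cont_norm[OF B, of "CARD('n) + 1"] by blast
  define A where "A = 2 ^ k * (osc_const TYPE('n) * (LINT x|lborel. decay_weight (x :: real ^ 'n)))"
  have A: "A \<ge> 0"
    unfolding A_def using osc_const_pos[where 'n='n]
    by (auto intro!: mult_nonneg_nonneg integral_nonneg_AE AE_I2 decay_weight_nonneg)
  have "(1 + norm x) ^ k * cmod (iter_partial is (osc \<sigma> \<gamma>) x) \<le> (A * C) * schwartz_norm M \<gamma>"
    if \<gamma>: "\<gamma> \<in> schwartz" for \<gamma> x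
  proof -
    have "(1 + norm x) ^ k * cmod (iter_partial is (osc \<sigma> \<gamma>) x) \<le> 2 ^ k * cmod (osc \<sigma> ((bessel_op ^^ k) (L \<gamma>)) x)"
      unfolding L(2)[OF \<gamma>] by (intro osc_decay[OF \<sigma>] schwartz_cont_schwartz[OF L(1)] \<gamma>)
    also have "\<dots> \<le> 2 ^ k * (osc_const TYPE('n) * (LINT x|lborel. decay_weight (x :: real ^ 'n)) *
        schwartz_norm (CARD('n) + 1) ((bessel_op ^^ k) (L \<gamma>)))"
      by (intro mult_left_mono osc_bound schwartz_cont_schwartz[OF B] \<gamma>) simp
    also have "\<dots> = A * schwartz_norm (CARD('n) + 1) ((bessel_op ^^ k) (L \<gamma>))" by (simp add: A_def mult_ac)
    also have "\<dots> \<le> A * (C * schwartz_norm M \<gamma>)" by (intro mult_left_mono C A \<gamma>)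
    finally show ?thesis by (simp add: mult_ac)
  qed
  then show "\<exists>C\<ge>0. \<exists>M. \<forall>\<gamma>\<in>schwartz. \<forall>x. (1 + norm x) ^ k * cmod (iter_partial is (osc \<sigma> \<gamma>) x) \<le> C * schwartz_norm M \<gamma>"
    using A C(1) by (intro exI[of _ "A * C"]) auto
qed (rule schwartz_osc[OF \<sigma>])

text \<open>The integrand is dominated by the tensor product of \<open>f\<close> and
  \<open>g\<close>; the kernel will be a phase or a Gaussian.\<close>

lemma fubini_bounded_kernel:
  fixes f g :: "'a::euclidean_space \<Rightarrow> complex"
  assumes f: "integrable lborel f" and g: "integrable lborel g"
    and k: "case_prod k \<in> borel_measurable (borel \<Otimes>\<^sub>M borel)" "\<And>x y. cmod (k x y) \<le> 1"
  shows "(LINT y|lborel. LINT x|lborel. f x * g y * k x y) = (LINT x|lborel. LINT y|lborel. f x * g y * k x y)"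
proof (rule lborel_pair.Fubini_integral)
  have [measurable]: "f \<in> borel_measurable borel" "g \<in> borel_measurable borel" using f g by auto
  note k(1)[measurable]
  have fg: "integrable (lborel \<Otimes>\<^sub>M lborel) (\<lambda>(x, y). f x * g y)"
    using f g by (intro lborel_pair.Fubini_integrable) (auto simp: norm_mult)
  show "integrable (lborel \<Otimes>\<^sub>M lborel) (\<lambda>(x, y). f x * g y * k x y)"
  proof (rule Bochner_Integration.integrable_bound[OF fg])
    show "AE z in lborel \<Otimes>\<^sub>M lborel. norm (case z of (x, y) \<Rightarrow> f x * g y * k x y) \<le> norm (case z of (x, y) \<Rightarrow> f x * g y)"
      using k(2) by (auto simp: norm_mult mult_left_le)
    have "(\<lambda>z. f (fst z) * g (snd z) * case_prod k z) \<in> borel_measurable (borel \<Otimes>\<^sub>M borel)"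
      by measurable
    then show "(\<lambda>(x, y). f x * g y * k x y) \<in> borel_measurable (lborel \<Otimes>\<^sub>M lborel)"
      by (simp add: case_prod_unfold cong: measurable_cong_sets sets_pair_measure_cong)
  qed
qed

text \<open>Gaussian regularisation: both sides of the inversion formula are limits of the same integrals.\<close>

lemma osc_inversion:
  fixes \<gamma> :: "real ^ 'n::finite \<Rightarrow> complex"
  assumes \<gamma>: "\<gamma> \<in> schwartz"
  shows "osc 1 (osc (-1) \<gamma>) x = \<gamma> x"
proof -
  let ?k = "complex_of_real (osc_const TYPE('n))"
  define G where "G c \<omega> = complex_of_real (exp (- (c * norm (\<omega> - 0))\<^sup>2 / 2))" for c and \<omega> :: "real ^ 'n"
  define d where "d m = 1 / real (Suc m)" for m
  define A where "A m = (LINT \<omega>|lborel. iexp (\<omega> \<bullet> x) * osc (-1) \<gamma> \<omega> * G (d m) \<omega>)" for m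
  define P where "P = complex_of_real ((2 * pi) powr (CARD('n) / 2))"
  have d: "0 < d m" for m by (simp add: d_def)
  have dlim: "d \<longlonglongrightarrow> 0" unfolding d_def[abs_def] by (rule lim_1_over_n[THEN LIMSEQ_Suc])
  have F: "osc (-1) \<gamma> \<in> schwartz" by (rule schwartz_osc[OF _ \<gamma>]) simp
  have [measurable]: "\<gamma> \<in> borel_measurable borel" "osc (-1) \<gamma> \<in> borel_measurable borel"
    using \<gamma> F by (auto intro: schwartz_measurable)
  have Gm [measurable]: "G c \<in> borel_measurable borel" for c unfolding G_def by measurable
  have G1: "cmod (G c \<omega>) \<le> 1" for c \<omega> by (simp add: G_def)
  \<comment> \<open>The normalisations of the two transforms each cancel one factor
    \<open>P\<close>: one comes from the transform of the Gaussian, the other from the total mass of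
    \<open>G 1\<close>.\<close>
  have kP: "?k * P = 1"
    unfolding P_def osc_const_def of_real_mult[symmetric] powr_add[symmetric] by simp
  have "A \<longlonglongrightarrow> (LINT \<omega>|lborel. iexp (\<omega> \<bullet> x) * osc (-1) \<gamma> \<omega>)"
    unfolding A_def
  proof (rule integral_dominated_convergence[where w = "\<lambda>\<omega>. cmod (osc (-1) \<gamma> \<omega>)"])
    show "integrable lborel (\<lambda>\<omega>. cmod (osc (-1) \<gamma> \<omega>))" using schwartz_integrable[OF F] by simp
    have "(\<lambda>m. iexp (\<omega> \<bullet> x) * osc (-1) \<gamma> \<omega> * G (d m) \<omega>) \<longlonglongrightarrow> iexp (\<omega> \<bullet> x) * osc (-1) \<gamma> \<omega> * complex_of_real (exp (- (0 * norm (\<omega> - 0))\<^sup>2 / 2))" for \<omega>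
      unfolding G_def by (intro tendsto_intros dlim) auto
    then show "AE \<omega> in lborel. (\<lambda>m. iexp (\<omega> \<bullet> x) * osc (-1) \<gamma> \<omega> * G (d m) \<omega>) \<longlonglongrightarrow> iexp (\<omega> \<bullet> x) * osc (-1) \<gamma> \<omega>" by simp
    show "AE \<omega> in lborel. cmod (iexp (\<omega> \<bullet> x) * osc (-1) \<gamma> \<omega> * G (d m) \<omega>) \<le> cmod (osc (-1) \<gamma> \<omega>)" for m
      using G1 by (simp add: norm_mult mult_left_le)
  qed simp_all
  moreover have "A \<longlonglongrightarrow> ?k * (P * (P * \<gamma> x))"
  proof -
    \<comment> \<open>Integrating over the frequency first turns the Gaussian factor into a kernel
      of width \<open>d m\<close> around \<open>x\<close>. Rescaling freezes this kernel as
      \<open>G 1\<close> and moves the small parameter into the argument of \<gamma>, where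
      continuity applies.\<close>
    have val: "A m = ?k * (P * (LINT z|lborel. \<gamma> (x + d m *\<^sub>R z) * G 1 z))" for m
    proof -
      have Gi: "integrable lborel (\<lambda>\<omega>. G (d m) \<omega> * iexp (\<omega> \<bullet> y))" 
        and Gv: "(LINT \<omega>|lborel. G (d m) \<omega> * iexp (\<omega> \<bullet> y)) = P * complex_of_real (exp (- (norm y / d m)\<^sup>2 / 2) / d m ^ CARD('n))" for y
        using gaussian_fourier[OF d, of m "0 :: real ^ 'n" y] unfolding has_bochner_integral_iff G_def P_def by simp_all
      have "A m = ?k * (LINT \<omega>|lborel. LINT y|lborel. \<gamma> y * G (d m) \<omega> * iexp (\<omega> \<bullet> (x - y)))"
      proof -
        have "iexp (\<omega> \<bullet> x) * osc (-1) \<gamma> \<omega> * G (d m) \<omega> = ?k * (LINT y|lborel. \<gamma> y * G (d m) \<omega> * iexp (\<omega> \<bullet> (x - y)))" for \<omega>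
        proof -
          have "(LINT y|lborel. \<gamma> y * G (d m) \<omega> * iexp (\<omega> \<bullet> (x - y))) =
             (LINT y|lborel. (iexp (\<omega> \<bullet> x) * G (d m) \<omega>) * (iexp (y \<bullet> ((-1) *\<^sub>R \<omega>)) * \<gamma> y))"
            by (intro Bochner_Integration.integral_cong)
               (simp_all add: inner_diff_right inner_commute exp_diff exp_minus divide_inverse right_diff_distrib mult_ac)
          also have "\<dots> = (iexp (\<omega> \<bullet> x) * G (d m) \<omega>) * (LINT y|lborel. iexp (y \<bullet> ((-1) *\<^sub>R \<omega>)) * \<gamma> y)"
            by (rule integral_mult_right_zero)
          finally have e: "(LINT y|lborel. \<gamma> y * G (d m) \<omega> * iexp (\<omega> \<bullet> (x - y))) =
            (iexp (\<omega> \<bullet> x) * G (d m) \<omega>) * (LINT y|lborel. iexp (y \<bullet> ((-1) *\<^sub>R \<omega>)) * \<gamma> y)" .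
          show ?thesis
            unfolding e osc_def by (simp only: mult_ac)
        qed
        then show ?thesis unfolding A_def by simp
      qed
      also have "(LINT \<omega>|lborel. LINT y|lborel. \<gamma> y * G (d m) \<omega> * iexp (\<omega> \<bullet> (x - y))) =
          (LINT y|lborel. LINT \<omega>|lborel. \<gamma> y * G (d m) \<omega> * iexp (\<omega> \<bullet> (x - y)))"
      proof (rule fubini_bounded_kernel)
        show "integrable lborel (G (d m))" using Gi[of 0] by simp
        show "(\<lambda>(y, \<omega>). iexp (\<omega> \<bullet> (x - y))) \<in> borel_measurable (borel \<Otimes>\<^sub>M borel)" by measurable
      qed (use schwartz_integrable[OF \<gamma>] in simp_all)
      also have "\<dots> = (LINT y|lborel. P * (\<gamma> y * complex_of_real (exp (- (norm (x - y) / d m)\<^sup>2 / 2) / d m ^ CARD('n))))"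
        by (simp add: mult.assoc Gv) (simp add: mult_ac)
      also have "\<dots> = P * (LINT z|lborel. \<gamma> (x + d m *\<^sub>R z) * G 1 z)"
      proof (subst integral_lborel_affine[of _ "d m" x])
        have "P * (\<gamma> (x + d m *\<^sub>R z) * complex_of_real (exp (- (norm (x - (x + d m *\<^sub>R z)) / d m)\<^sup>2 / 2) / d m ^ CARD('n))) =
            (P / complex_of_real (d m ^ CARD('n))) * (\<gamma> (x + d m *\<^sub>R z) * G 1 z)" for z
          using d[of m] by (simp add: G_def)
        then show "\<bar>d m\<bar> ^ DIM(real ^ 'n) *\<^sub>R (LINT z|lborel. P * (\<gamma> (x + d m *\<^sub>R z) *
            complex_of_real (exp (- (norm (x - (x + d m *\<^sub>R z)) / d m)\<^sup>2 / 2) / d m ^ CARD('n)))) =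
            P * (LINT z|lborel. \<gamma> (x + d m *\<^sub>R z) * G 1 z)"
          using d[of m] by (simp only: integral_mult_right_zero) (simp add: scaleR_conv_of_real[of "_ ^ _"])
      qed (use d[of m] in simp_all)
      finally show ?thesis .
    qed
    obtain B where B: "\<And>y. cmod (\<gamma> y) \<le> B" using schwartz_decay[OF \<gamma>, of 0] by auto
    have G1i: "has_bochner_integral lborel (G 1) P"
      using gaussian_fourier[of 1 "0 :: real ^ 'n" 0] unfolding G_def P_def by simp
    have cont: "isCont \<gamma> y" for y
      using schwartz_differentiable[OF \<gamma>] by (rule differentiable_imp_continuous_within)
    have "(\<lambda>m. LINT z|lborel. \<gamma> (x + d m *\<^sub>R z) * G 1 z) \<longlonglongrightarrow> (LINT z|lborel. \<gamma> x * G 1 z)"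
    proof (rule integral_dominated_convergence[where w = "\<lambda>z. B * cmod (G 1 z)"])
      show "integrable lborel (\<lambda>z. B * cmod (G 1 z))"
        using G1i by (simp add: has_bochner_integral_iff)
      have "(\<lambda>m. x + d m *\<^sub>R z) \<longlonglongrightarrow> x + 0 *\<^sub>R z" for z by (intro tendsto_intros dlim)
      then have "(\<lambda>m. \<gamma> (x + d m *\<^sub>R z) * G 1 z) \<longlonglongrightarrow> \<gamma> x * G 1 z" for z
        by (intro tendsto_intros isCont_tendsto_compose[OF cont]) simp
      then show "AE z in lborel. (\<lambda>m. \<gamma> (x + d m *\<^sub>R z) * G 1 z) \<longlonglongrightarrow> \<gamma> x * G 1 z" by simp
      show "AE z in lborel. cmod (\<gamma> (x + d m *\<^sub>R z) * G 1 z) \<le> B * cmod (G 1 z)" for m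
        using B by (simp add: norm_mult mult_right_mono)
    qed simp_all
    also have "(LINT z|lborel. \<gamma> x * G 1 z) = P * \<gamma> x"
      using G1i by (simp add: has_bochner_integral_iff)
    finally show ?thesis unfolding val[abs_def] by (intro tendsto_intros)
  qed
  ultimately have "(LINT \<omega>|lborel. iexp (\<omega> \<bullet> x) * osc (-1) \<gamma> \<omega>) = ?k * (P * (P * \<gamma> x))"
    by (rule LIMSEQ_unique)
  then have "osc 1 (osc (-1) \<gamma>) x = (?k * P) * (?k * P) * \<gamma> x"
    unfolding osc_def[of 1] by (simp add: mult_ac)
  then show ?thesis by (simp add: kP)
qed

section \<open>Generalized Fourier transforms, polynomials and exponential sums\<close>

text \<open>The positive and the negative part, taken as densities, give finite measures that agree
  on boxes. Boxes are an intersection-stable generator, so the measures and hence their densities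
  agree.\<close>

lemma AE_zero_of_box_integrals_real:
  fixes u :: "'a::euclidean_space \<Rightarrow> real"
  assumes u: "integrable lborel u"
    and box: "\<And>a b. (LINT x|lborel. u x * indicator (box a b) x) = 0"
  shows "AE x in lborel. u x = 0"
proof -
  let ?P = "density lborel (\<lambda>x. ennreal (u x))" and ?N = "density lborel (\<lambda>x. ennreal (- u x))"
  have [measurable]: "u \<in> borel_measurable borel" using u by auto
  have fin: "(\<integral>\<^sup>+x. ennreal (u x) \<partial>lborel) \<noteq> \<infinity>" "(\<integral>\<^sup>+x. ennreal (- u x) \<partial>lborel) \<noteq> \<infinity>"
    using u by (simp_all add: real_integrable_def)
  have fin': "(\<integral>\<^sup>+x. ennreal (u x) * indicator A x \<partial>lborel) \<noteq> \<infinity>" "(\<integral>\<^sup>+x. ennreal (- u x) * indicator A x \<partial>lborel) \<noteq> \<infinity>" for A :: "'a set"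
  proof -
    have "(\<integral>\<^sup>+x. ennreal (u x) * indicator A x \<partial>lborel) \<le> (\<integral>\<^sup>+x. ennreal (u x) \<partial>lborel)"
      "(\<integral>\<^sup>+x. ennreal (- u x) * indicator A x \<partial>lborel) \<le> (\<integral>\<^sup>+x. ennreal (- u x) \<partial>lborel)"
      by (auto intro!: nn_integral_mono simp: indicator_def)
    then show "(\<integral>\<^sup>+x. ennreal (u x) * indicator A x \<partial>lborel) \<noteq> \<infinity>" "(\<integral>\<^sup>+x. ennreal (- u x) * indicator A x \<partial>lborel) \<noteq> \<infinity>"
      using fin by (auto simp: top_unique)
  qed
  have eq: "emeasure ?P (box a b) = emeasure ?N (box a b)" for a b
  proof -
    have int: "integrable lborel (\<lambda>x. u x * indicator (box a b) x)"
      using u by (intro integrable_real_mult_indicator) auto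
    have i: "ennreal (u x * indicator (box a b) x) = ennreal (u x) * indicator (box a b) x"
      "ennreal (- (u x * indicator (box a b) x)) = ennreal (- u x) * indicator (box a b) x" for x
      by (auto simp: indicator_def)
    from box[of a b] have "enn2real (\<integral>\<^sup>+x. ennreal (u x) * indicator (box a b) x \<partial>lborel) =
      enn2real (\<integral>\<^sup>+x. ennreal (- u x) * indicator (box a b) x \<partial>lborel)"
      by (simp add: real_lebesgue_integral_def[OF int] i)
    then have e: "ennreal (enn2real (\<integral>\<^sup>+x. ennreal (u x) * indicator (box a b) x \<partial>lborel)) =
      ennreal (enn2real (\<integral>\<^sup>+x. ennreal (- u x) * indicator (box a b) x \<partial>lborel))"
      by (rule arg_cong)
    have r: "ennreal (enn2real z) = z" if "z \<noteq> \<infinity>" for z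
      using that by (simp add: less_top)
    have "(\<integral>\<^sup>+x. ennreal (u x) * indicator (box a b) x \<partial>lborel) =
      (\<integral>\<^sup>+x. ennreal (- u x) * indicator (box a b) x \<partial>lborel)"
      using e unfolding r[OF fin'(1)] r[OF fin'(2)] .
    then show ?thesis by (subst (1 2) emeasure_density) simp_all
  qed
  have "?P = ?N"
  proof (rule measure_eqI_generator_eq[where \<Omega> = UNIV and E = "range (\<lambda>(a, b). box a b)" and A = "\<lambda>n. box (- (real n *\<^sub>R One)) (real n *\<^sub>R One)"])
    show "Int_stable (range (\<lambda>(a, b). box a b :: 'a set))"
      by (auto simp: Int_stable_def box_Int_box)
    show "sets ?P = sigma_sets UNIV (range (\<lambda>(a, b). box a b))"
      "sets ?N = sigma_sets UNIV (range (\<lambda>(a, b). box a b))"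
      by (simp_all add: borel_eq_box)
    show "range (\<lambda>n. box (- (real n *\<^sub>R One)) (real n *\<^sub>R One) :: 'a set) \<subseteq> range (\<lambda>(a, b). box a b)"
      by auto
    show "(\<Union>n. box (- (real n *\<^sub>R One)) (real n *\<^sub>R One) :: 'a set) = UNIV"
      by (rule UN_box_eq_UNIV)
    show "emeasure ?P (box (- (real n *\<^sub>R One)) (real n *\<^sub>R One)) \<noteq> \<infinity>" for n
      using fin' by (simp add: emeasure_density)
  qed (auto simp: eq)
  then have "AE x in lborel. ennreal (u x) = ennreal (- u x)"
    using fin by (subst (asm) finite_density_unique) auto
  then show ?thesis
  proof eventually_elim
    case (elim x)
    \<comment> \<open>\<open>ennreal\<close> sends negative numbers to 0, so the equality is read
      off at its zeros: \<open>u x\<close> and \<open>- u x\<close> are nonpositive together, which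
      forces \<open>u x = 0\<close>.\<close>
    have "u x \<le> 0 \<longleftrightarrow> - u x \<le> 0"
      unfolding ennreal_eq_0_iff[symmetric] elim ..
    then show ?case by linarith
  qed
qed

lemma AE_zero_of_box_integrals:
  fixes u :: "'a::euclidean_space \<Rightarrow> complex"
  assumes u: "integrable lborel u"
    and box: "\<And>a b. (LINT x|lborel. u x * indicator (box a b) x) = 0"
  shows "AE x in lborel. u x = 0"
proof -
  have int: "integrable lborel (\<lambda>x. u x * indicator (box a b) x)" for a b
  proof (rule Bochner_Integration.integrable_bound[OF u])
    show "(\<lambda>x. u x * indicator (box a b) x) \<in> borel_measurable lborel" using u by simp
  qed (auto simp: indicator_def)
  have "AE x in lborel. Re (u x) = 0"
  proof (rule AE_zero_of_box_integrals_real)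
    have "(LINT x|lborel. Re (u x) * indicator (box a b) x) = Re (LINT x|lborel. u x * indicator (box a b) x)" for a b
      by (subst integral_Re[OF int, symmetric]) (auto intro!: Bochner_Integration.integral_cong simp: indicator_def)
    then show "(LINT x|lborel. Re (u x) * indicator (box a b) x) = 0" for a b by (simp add: box)
  qed (use u in simp)
  moreover have "AE x in lborel. Im (u x) = 0"
  proof (rule AE_zero_of_box_integrals_real)
    have "(LINT x|lborel. Im (u x) * indicator (box a b) x) = Im (LINT x|lborel. u x * indicator (box a b) x)" for a b
      by (subst integral_Im[OF int, symmetric]) (auto intro!: Bochner_Integration.integral_cong simp: indicator_def)
    then show "(LINT x|lborel. Im (u x) * indicator (box a b) x) = 0" for a b by (simp add: box)
  qed (use u in simp)
  ultimately show ?thesis by eventually_elim (simp add: complex_eq_iff)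
qed

text \<open>The indicator of a box is mollified by Gaussians of width \<open>d m\<close>. By Fubini
  \<open>h\<close> annihilates each mollification, and these converge boundedly to a nonzero
  multiple of the indicator off the boundary of the box, a null set.\<close>

lemma AE_zero_of_gaussian_integrals:
  fixes h :: "'a::euclidean_space \<Rightarrow> complex"
  assumes h: "integrable lborel h"
    and gauss: "\<And>c y. c > 0 \<Longrightarrow> (LINT x|lborel. h x * complex_of_real (exp (- (c * norm (x - y))\<^sup>2 / 2))) = 0"
  shows "AE x in lborel. h x = 0"
proof (rule AE_zero_of_box_integrals[OF h])
  fix a b :: 'a
  have [measurable]: "h \<in> borel_measurable borel" using h by auto
  define f where "f = (indicator (box a b) :: 'a \<Rightarrow> complex)"
  define G where "G z = complex_of_real (exp (- (1 * norm (z - 0))\<^sup>2 / 2))" for z :: 'a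
  define P where "P = complex_of_real ((2 * pi) powr (DIM('a) / 2))"
  define d where "d m = 1 / real (Suc m)" for m
  have d: "0 < d m" for m by (simp add: d_def)
  have dlim: "d \<longlonglongrightarrow> 0" unfolding d_def[abs_def] by (rule lim_1_over_n[THEN LIMSEQ_Suc])
  have [measurable]: "f \<in> borel_measurable borel" by (simp add: f_def)
  have [measurable]: "G \<in> borel_measurable borel" unfolding G_def by measurable
  have f1: "cmod (f x) \<le> 1" for x by (simp add: f_def indicator_def)
  have fi: "integrable lborel f"
    unfolding f_def
  proof (rule Bochner_Integration.integrable_bound)
    show "integrable lborel (indicat_real (box a b))"
      by (rule integrable_real_indicator) (auto simp: emeasure_lborel_box_eq)
  qed (auto simp: indicator_def)
  have G: "has_bochner_integral lborel G P"
    using gaussian_fourier[of 1 "0 :: 'a" 0] unfolding G_def P_def by simp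
  then have Gi: "integrable lborel G" "integral\<^sup>L lborel G = P" by (auto simp: has_bochner_integral_iff)
  have P0: "P \<noteq> 0" by (simp add: P_def)
  define F where "F m x = (LINT z|lborel. f (x + d m *\<^sub>R z) * G z)" for m x
  have Fz: "(LINT x|lborel. h x * F m x) = 0" for m
  proof -
    let ?k = "\<lambda>x y :: 'a. complex_of_real (exp (- (1 / d m * norm (x - y))\<^sup>2 / 2))"
    have F: "F m x = complex_of_real ((1 / d m) ^ DIM('a)) * (LINT y|lborel. f y * ?k x y)" for x
    proof -
      have "(LINT y|lborel. f y * ?k x y) = \<bar>d m\<bar> ^ DIM('a) *\<^sub>R (LINT z|lborel. f (x + d m *\<^sub>R z) * ?k x (x + d m *\<^sub>R z))"
        using d[of m] by (intro integral_lborel_affine) auto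
      also have "(\<lambda>z. f (x + d m *\<^sub>R z) * ?k x (x + d m *\<^sub>R z)) = (\<lambda>z. f (x + d m *\<^sub>R z) * G z)"
        using d[of m] by (simp add: G_def)
      finally show ?thesis using d[of m] unfolding F_def
        by (simp add: scaleR_conv_of_real[of "_ ^ _"] power_divide)
    qed
    have "(LINT x|lborel. LINT y|lborel. h x * f y * ?k x y) = (LINT y|lborel. LINT x|lborel. h x * f y * ?k x y)"
    proof (rule fubini_bounded_kernel[symmetric])
      show "(\<lambda>(x, y). ?k x y) \<in> borel_measurable (borel \<Otimes>\<^sub>M borel)"
        by measurable
    qed (use h fi in auto)
    also have "\<dots> = (LINT y|lborel. f y * (LINT x|lborel. h x * ?k x y))"
      by (simp only: mult.left_commute[of "h _"] mult.assoc integral_mult_right_zero)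
    also have "\<dots> = 0" using gauss[of "1 / d m"] d[of m] by simp
    finally have "(LINT x|lborel. h x * (LINT y|lborel. f y * ?k x y)) = 0"
      by (simp add: mult.assoc)
    then show ?thesis unfolding F by (simp add: mult.left_commute[of "h _"])
  qed
  have "(\<lambda>m. LINT x|lborel. h x * F m x) \<longlonglongrightarrow> (LINT x|lborel. h x * (f x * P))"
  proof (rule integral_dominated_convergence[where w = "\<lambda>x. cmod (h x) * (LINT z|lborel. cmod (G z))"])
    show "(\<lambda>x. h x * (f x * P)) \<in> borel_measurable lborel" by simp
    show "(\<lambda>x. h x * F m x) \<in> borel_measurable lborel" for m unfolding F_def by measurable
    show "integrable lborel (\<lambda>x. cmod (h x) * (LINT z|lborel. cmod (G z)))" using h by simp
    have "cmod (F m x) \<le> (LINT z|lborel. cmod (G z))" for m x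
      unfolding F_def
    proof (rule Bochner_Integration.integral_norm_bound_integral)
      show "integrable lborel (\<lambda>z. f (x + d m *\<^sub>R z) * G z)"
        using f1 by (intro Bochner_Integration.integrable_bound[OF Gi(1)]) (auto simp: norm_mult mult_left_le_one_le)
    qed (use f1 Gi(1) in \<open>auto simp: norm_mult mult_left_le_one_le\<close>)
    then show "AE x in lborel. norm (h x * F m x) \<le> cmod (h x) * (LINT z|lborel. cmod (G z))" for m
      by (simp add: norm_mult mult_left_mono)
    have conv: "(\<lambda>m. h x * F m x) \<longlonglongrightarrow> h x * (f x * P)" if x: "x \<notin> cbox a b - box a b" for x
    proof -
      have ev: "eventually (\<lambda>m. f (x + d m *\<^sub>R z) = f x) sequentially" for z
      proof -
        have lim: "(\<lambda>m. x + d m *\<^sub>R z) \<longlonglongrightarrow> x"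
          by (rule tendsto_eq_intros dlim | simp)+
        show ?thesis
        proof (cases "x \<in> box a b")
          case True
          from topological_tendstoD[OF lim open_box True] show ?thesis
            by eventually_elim (use True in \<open>simp add: f_def\<close>)
        next
          case False
          with x have "x \<in> - cbox a b" by auto
          from topological_tendstoD[OF lim _ this] have "eventually (\<lambda>m. x + d m *\<^sub>R z \<in> - cbox a b) sequentially"
            by (simp add: closed_cbox open_Compl)
          then show ?thesis
            by eventually_elim (use False box_subset_cbox[of a b] in \<open>auto simp: f_def indicator_def\<close>)
        qed
      qed
      have "(\<lambda>m. F m x) \<longlonglongrightarrow> (LINT z|lborel. f x * G z)"
        unfolding F_def
      proof (rule integral_dominated_convergence[where w = "\<lambda>z. cmod (G z)"])
        have "(\<lambda>m. f (x + d m *\<^sub>R z) * G z) \<longlonglongrightarrow> f x * G z" for z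
          by (rule tendsto_eventually) (use ev[of z] in \<open>auto elim: eventually_mono\<close>)
        then show "AE z in lborel. (\<lambda>m. f (x + d m *\<^sub>R z) * G z) \<longlonglongrightarrow> f x * G z" by simp
        show "AE z in lborel. cmod (f (x + d m *\<^sub>R z) * G z) \<le> cmod (G z)" for m
          using f1 by (simp add: norm_mult mult_left_le_one_le)
      qed (use Gi(1) in auto)
      then show ?thesis using Gi by (intro tendsto_mult_left) simp
    qed
    have "cbox a b - box a b \<in> null_sets lborel"
      using negligible_frontier_interval[of a b]
      by (simp add: negligible_iff_null_sets null_sets_completion_iff)
    then show "AE x in lborel. (\<lambda>m. h x * F m x) \<longlonglongrightarrow> h x * (f x * P)"
      by (rule AE_I') (use conv in auto)
  qed
  then have "(LINT x|lborel. h x * (f x * P)) = 0"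
    unfolding Fz by (rule LIMSEQ_unique[OF _ tendsto_const])
  moreover have "(LINT x|lborel. h x * (f x * P)) = (LINT x|lborel. h x * f x) * P"
    by (simp add: mult.assoc[symmetric])
  ultimately show "(LINT x|lborel. h x * indicator (box a b) x) = 0"
    using P0 by (simp add: f_def)
qed

section \<open>Test functions vanishing at the origin and uniqueness of the transform\<close>

lemma schwartz_vanishing_schwartz: "\<gamma> \<in> schwartz_vanishing m \<Longrightarrow> \<gamma> \<in> schwartz"
  by (simp add: schwartz_vanishing_def)

lemma norm_powr_le:
  assumes "p \<ge> 0"
  shows "norm \<omega> powr p \<le> (1 + norm \<omega>) ^ nat \<lceil>p\<rceil>"
proof -
  have "norm \<omega> powr p \<le> (1 + norm \<omega>) powr p" using assms by (intro powr_mono2) auto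
  also have "\<dots> \<le> (1 + norm \<omega>) powr (real (nat \<lceil>p\<rceil>))" using assms by (intro powr_mono) auto
  also have "\<dots> = (1 + norm \<omega>) ^ nat \<lceil>p\<rceil>" by (simp add: powr_realpow add_pos_nonneg)
  finally show ?thesis .
qed

text \<open>After division by |\<omega>|^m a power of exponent p - m >= 0 remains, and the Schwartz
  decay of \<eta> absorbs it.\<close>

lemma schwartz_vanishingI:
  assumes \<gamma>: "\<gamma> \<in> schwartz" and \<eta>: "\<eta> \<in> schwartz" and p: "m \<le> p"
    and b: "\<And>\<omega>. \<omega> \<noteq> 0 \<Longrightarrow> cmod (\<gamma> \<omega>) \<le> norm \<omega> powr p * cmod (\<eta> \<omega>)"
  shows "\<gamma> \<in> schwartz_vanishing m"
proof -
  obtain B where B: "\<And>\<omega>. (1 + norm \<omega>) ^ nat \<lceil>p - m\<rceil> * cmod (\<eta> \<omega>) \<le> B"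
    using schwartz_decay[OF \<eta>] by blast
  have "norm \<omega> powr (- m) * cmod (\<gamma> \<omega>) \<le> B" if "\<omega> \<noteq> 0" for \<omega>
  proof -
    have "norm \<omega> powr (- m) * cmod (\<gamma> \<omega>) \<le> norm \<omega> powr (- m) * (norm \<omega> powr p * cmod (\<eta> \<omega>))"
      by (intro mult_left_mono b that) auto
    also have "\<dots> = norm \<omega> powr (p - m) * cmod (\<eta> \<omega>)"
      unfolding mult.assoc[symmetric] powr_add[symmetric] by (simp add: add.commute)
    also have "\<dots> \<le> (1 + norm \<omega>) ^ nat \<lceil>p - m\<rceil> * cmod (\<eta> \<omega>)"
      using p by (intro mult_right_mono norm_powr_le) auto
    finally show ?thesis using B[of \<omega>] by linarith
  qed
  then show ?thesis using \<gamma> unfolding schwartz_vanishing_def by blast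
qed

lemma schwartz_vanishing_nonpos: "m \<le> 0 \<Longrightarrow> \<gamma> \<in> schwartz \<Longrightarrow> \<gamma> \<in> schwartz_vanishing m"
  by (rule schwartz_vanishingI[where \<eta> = \<gamma> and p = 0]) auto

text \<open>In the unit ball \<open>f\<close> is bounded and the vanishing is that of \<gamma>;
  outside it the weight is at most a power of 1 + |\<omega>|, against which the Schwartz product
  decays. The absolute value of \<open>m\<close> covers negative orders.\<close>

lemma schwartz_vanishing_mult:
  assumes f: "f \<in> temper_mult" and \<gamma>: "\<gamma> \<in> schwartz_vanishing m"
  shows "(\<lambda>\<omega>. f \<omega> * \<gamma> \<omega>) \<in> schwartz_vanishing m"
proof -
  have s: "(\<lambda>\<omega>. f \<omega> * \<gamma> \<omega>) \<in> schwartz"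
    by (intro schwartz_mult f schwartz_vanishing_schwartz[OF \<gamma>])
  obtain B where B: "\<And>\<omega>. \<omega> \<noteq> 0 \<Longrightarrow> norm \<omega> powr (- m) * cmod (\<gamma> \<omega>) \<le> B"
    using \<gamma> unfolding schwartz_vanishing_def by blast
  obtain A k where A: "A \<ge> 0" "\<And>x. cmod (f x) \<le> A * (1 + norm x) ^ k"
    using temper_mult_growth[OF f] by blast
  obtain D where D: "\<And>\<omega>. (1 + norm \<omega>) ^ nat \<lceil>\<bar>m\<bar>\<rceil> * cmod (f \<omega> * \<gamma> \<omega>) \<le> D"
    using schwartz_decay[OF s] by blast
  have "norm \<omega> powr (- m) * cmod (f \<omega> * \<gamma> \<omega>) \<le> max (A * 2 ^ k * B) D" if w: "\<omega> \<noteq> 0" for \<omega>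
  proof (cases "norm \<omega> \<le> 1")
    case True
    have "cmod (f \<omega>) \<le> A * 2 ^ k"
      using True by (intro order_trans[OF A(2)] mult_left_mono power_mono A(1)) auto
    then have "cmod (f \<omega>) * (norm \<omega> powr (- m) * cmod (\<gamma> \<omega>)) \<le> (A * 2 ^ k) * B"
      using B[OF w] A(1) by (intro mult_mono) auto
    then show ?thesis by (simp add: norm_mult mult_ac)
  next
    case False
    then have "norm \<omega> powr (- m) \<le> norm \<omega> powr \<bar>m\<bar>" by (intro powr_mono) auto
    also have "\<dots> \<le> (1 + norm \<omega>) ^ nat \<lceil>\<bar>m\<bar>\<rceil>" by (rule norm_powr_le) simp
    finally have "norm \<omega> powr (- m) * cmod (f \<omega> * \<gamma> \<omega>) \<le> (1 + norm \<omega>) ^ nat \<lceil>\<bar>m\<bar>\<rceil> * cmod (f \<omega> * \<gamma> \<omega>)"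
      by (rule mult_right_mono) simp
    with D[of \<omega>] show ?thesis by simp
  qed
  then show ?thesis using s unfolding schwartz_vanishing_def by blast
qed

lemma temper_mult_power: "f \<in> temper_mult \<Longrightarrow> (\<lambda>x. f x ^ k) \<in> temper_mult"
  by (induction k) (auto intro: temper_mult.const temper_mult.mult)

lemma temper_mult_norm_sq: "(\<lambda>x. complex_of_real ((norm x)\<^sup>2)) \<in> temper_mult"
proof -
  have "(\<lambda>x. complex_of_real ((1 + (norm x)\<^sup>2) powr 1) + (-1)) \<in> temper_mult"
    by (intro temper_mult.intros)
  then show ?thesis by (simp add: powr_one add_nonneg_nonneg)
qed

lemma borel_measurable_punctured:
  fixes g :: "real ^ 'n \<Rightarrow> complex"
  assumes "g \<in> borel_measurable (restrict_space borel (- {0}))"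
  shows "g \<in> borel_measurable borel"
  by (rule measurable_restrict_countable[of "{0}"]) (use assms in auto)

text \<open>Only test functions vanishing at the origin are available, so the difference is first
  multiplied by a fixed \<open>W\<close> that vanishes there to sufficient order. All its products
  with Gaussians are then admissible, as \<open>AE_zero_of_gaussian_integrals\<close> requires, and
  \<open>W\<close> has no zero elsewhere.\<close>

lemma gen_fourier_unique:
  fixes T :: "(real ^ 'n::finite \<Rightarrow> complex) \<Rightarrow> complex"
  assumes g1: "has_gen_fourier m T g1" and g2: "has_gen_fourier m T g2"
  shows "AE \<omega> in lborel. g1 \<omega> = g2 \<omega>"
proof -
  define k where "k = nat \<lceil>m\<rceil>"
  define W where "W \<omega> = complex_of_real ((norm \<omega>)\<^sup>2) ^ k * complex_of_real (exp (- (1 * norm (\<omega> - 0))\<^sup>2 / 2))" for \<omega> :: "real ^ 'n"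
  define h where "h \<omega> = (g1 \<omega> - g2 \<omega>) * W \<omega>" for \<omega>
  let ?G = "\<lambda>c y (\<omega> :: real ^ 'n). complex_of_real (exp (- (c * norm (\<omega> - y))\<^sup>2 / 2))"
  have test: "(\<lambda>\<omega>. W \<omega> * ?G c y \<omega>) \<in> schwartz_vanishing (2 * m)" for c y
  proof (rule schwartz_vanishingI)
    have 1: "(\<lambda>\<omega>. ?G c y \<omega> * ?G 1 0 \<omega>) \<in> schwartz"
      by (intro schwartz_gauss temper_mult.gauss) simp
    show "(\<lambda>\<omega>. ?G c y \<omega> * ?G 1 0 \<omega>) \<in> schwartz" by (rule 1)
    have "(\<lambda>\<omega>. complex_of_real ((norm \<omega>)\<^sup>2) ^ k * (?G c y \<omega> * ?G 1 0 \<omega>)) \<in> schwartz"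
      by (intro schwartz_mult 1 temper_mult_power temper_mult_norm_sq)
    then show "(\<lambda>\<omega>. W \<omega> * ?G c y \<omega>) \<in> schwartz"
      by (simp add: W_def mult_ac)
    show "2 * m \<le> real (2 * k)" unfolding k_def by linarith
    show "cmod (W \<omega> * ?G c y \<omega>) \<le> norm \<omega> powr real (2 * k) * cmod (?G c y \<omega> * ?G 1 0 \<omega>)" if "\<omega> \<noteq> 0" for \<omega>
      using that by (simp add: W_def norm_mult norm_power powr_realpow power_mult[symmetric] del: of_nat_mult)
  qed
  have int: "integrable lborel (\<lambda>\<omega>. h \<omega> * ?G c y \<omega>)"
    and zero: "(LINT \<omega>|lborel. h \<omega> * ?G c y \<omega>) = 0" for c y
  proof -
    note 1 = g1[unfolded has_gen_fourier_def, THEN conjunct2, THEN conjunct2, rule_format, OF test[of c y]]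
    note 2 = g2[unfolded has_gen_fourier_def, THEN conjunct2, THEN conjunct2, rule_format, OF test[of c y]]
    have e: "h \<omega> * ?G c y \<omega> = g1 \<omega> * (W \<omega> * ?G c y \<omega>) - g2 \<omega> * (W \<omega> * ?G c y \<omega>)" for \<omega>
      by (simp add: h_def algebra_simps)
    show "integrable lborel (\<lambda>\<omega>. h \<omega> * ?G c y \<omega>)" "(LINT \<omega>|lborel. h \<omega> * ?G c y \<omega>) = 0"
      unfolding e using 1 2 by simp_all
  qed
  have "AE \<omega> in lborel. h \<omega> = 0"
  proof (rule AE_zero_of_gaussian_integrals)
    \<comment> \<open>With \<open>c = 0\<close> the Gaussian is the constant 1; the Gaussian inside
      \<open>W\<close> keeps even this case in the Schwartz space.\<close>
    show "integrable lborel h" using int[of 0 0] by simp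
  qed (rule zero)
  moreover have "AE \<omega> in lborel. \<omega> \<noteq> (0 :: real ^ 'n)"
    by (rule AE_lborel_singleton)
  ultimately show ?thesis
    by eventually_elim (auto simp: h_def W_def)
qed

section \<open>Polynomials and exponential sums\<close>

lemma polynomials_add:
  assumes "p \<in> polynomials k" "r \<in> polynomials k"
  shows "(\<lambda>x. p x + r x) \<in> polynomials k"
proof -
  from assms obtain c d where "\<And>x. p x = (\<Sum>\<alpha>\<in>multi_indices k. c \<alpha> * (\<Prod>i\<in>UNIV. (x $ i) ^ \<alpha> i))"
    "\<And>x. r x = (\<Sum>\<alpha>\<in>multi_indices k. d \<alpha> * (\<Prod>i\<in>UNIV. (x $ i) ^ \<alpha> i))"
    unfolding polynomials_def by blast
  then show ?thesis
    unfolding polynomials_def by (auto intro!: exI[of _ "\<lambda>\<alpha>. c \<alpha> + d \<alpha>"] simp: sum.distrib distrib_right)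
qed

lemma polynomials_cmult:
  assumes "p \<in> polynomials k"
  shows "(\<lambda>x. a * p x) \<in> polynomials k"
proof -
  from assms obtain c where "\<And>x. p x = (\<Sum>\<alpha>\<in>multi_indices k. c \<alpha> * (\<Prod>i\<in>UNIV. (x $ i) ^ \<alpha> i))"
    unfolding polynomials_def by blast
  then show ?thesis
    unfolding polynomials_def by (auto intro!: exI[of _ "\<lambda>\<alpha>. a * c \<alpha>"] simp: sum_distrib_left mult_ac)
qed

lemma polynomials_zero: "(\<lambda>x. 0) \<in> polynomials k"
  unfolding polynomials_def by (auto intro!: exI[of _ "\<lambda>_. 0"])

lemma polynomials_sum:
  "finite A \<Longrightarrow> (\<And>a. a \<in> A \<Longrightarrow> p a \<in> polynomials k) \<Longrightarrow> (\<lambda>x. \<Sum>a\<in>A. p a x) \<in> polynomials k"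
  by (induction A rule: finite_induct) (auto intro: polynomials_zero polynomials_add)

lemma polynomials_mono:
  assumes p: "p \<in> polynomials j" and jk: "j \<le> k"
  shows "p \<in> polynomials k"
proof -
  from p obtain c where c: "\<And>x. p x = (\<Sum>\<alpha>\<in>multi_indices j. c \<alpha> * (\<Prod>i\<in>UNIV. (x $ i) ^ \<alpha> i))"
    unfolding polynomials_def by blast
  have pe: "p x = (\<Sum>\<alpha>\<in>multi_indices k. (if \<alpha> \<in> multi_indices j then c \<alpha> else 0) * (\<Prod>i\<in>UNIV. (x $ i) ^ \<alpha> i))" for x
    unfolding c using jk
    by (intro sum.mono_neutral_cong_left) (auto simp: finite_multi_indices, auto simp: multi_indices_def)
  show ?thesis
    unfolding polynomials_def by (intro CollectI exI allI) (rule pe)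
qed

lemma polynomials_one: "(\<lambda>x::real ^ 'n. 1) \<in> polynomials 0"
proof -
  have "multi_indices 0 = {\<lambda>_::'n. 0}"
    by (auto simp: multi_indices_def of_nat_sum[symmetric] simp del: of_nat_sum)
  then show ?thesis
    unfolding polynomials_def by (auto intro!: exI[of _ "\<lambda>_. 1"])
qed

lemma polynomials_coord_mult:
  fixes p :: "real ^ 'n \<Rightarrow> real"
  assumes p: "p \<in> polynomials k"
  shows "(\<lambda>x. x $ i * p x) \<in> polynomials (k + 1)"
proof -
  from p obtain c where c: "\<And>x. p x = (\<Sum>\<alpha>\<in>multi_indices k. c \<alpha> * (\<Prod>i\<in>UNIV. (x $ i) ^ \<alpha> i))"
    unfolding polynomials_def by blast
  let ?up = "\<lambda>\<alpha> :: 'n \<Rightarrow> nat. \<alpha>(i := Suc (\<alpha> i))"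
  let ?down = "\<lambda>\<alpha> :: 'n \<Rightarrow> nat. \<alpha>(i := \<alpha> i - 1)"
  have up_sum: "sum (?up \<alpha>) UNIV = sum \<alpha> UNIV + 1" for \<alpha>
  proof -
    have "sum (?up \<alpha>) UNIV = (\<Sum>j\<in>UNIV. \<alpha> j + (if j = i then 1 else 0))"
      by (intro sum.cong) auto
    then show ?thesis by (simp add: sum.distrib)
  qed
  have img: "?up ` multi_indices k \<subseteq> multi_indices (k + 1)"
    unfolding multi_indices_def by (auto simp: up_sum simp del: of_nat_sum fun_upd_apply)
  have inj: "inj_on ?up (multi_indices k)"
    by (rule inj_on_inverseI[of _ ?down]) (auto simp: fun_eq_iff)
  have mon: "(\<Prod>j\<in>UNIV. (x $ j) ^ (?up \<alpha>) j) = x $ i * (\<Prod>j\<in>UNIV. (x $ j) ^ \<alpha> j)" for x :: "real ^ 'n" and \<alpha>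
  proof -
    have "(\<Prod>j\<in>UNIV. (x $ j) ^ (?up \<alpha>) j) = (\<Prod>j\<in>UNIV. (if j = i then x $ j else 1) * (x $ j) ^ \<alpha> j)"
      by (intro prod.cong) auto
    then show ?thesis by (simp add: prod.distrib)
  qed
  \<comment> \<open>Coefficients move along the injective shift \<open>?up\<close> of indices; an
    index that is not a shift gets coefficient 0.\<close>
  define d where "d \<beta> = (if \<beta> \<in> ?up ` multi_indices k then c (?down \<beta>) else 0)" for \<beta>
  have "x $ i * p x = (\<Sum>\<beta>\<in>multi_indices (k + 1). d \<beta> * (\<Prod>i\<in>UNIV. (x $ i) ^ \<beta> i))" for x
  proof -
    have "(\<Sum>\<beta>\<in>multi_indices (k + 1). d \<beta> * (\<Prod>i\<in>UNIV. (x $ i) ^ \<beta> i)) =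
        (\<Sum>\<beta>\<in>?up ` multi_indices k. d \<beta> * (\<Prod>i\<in>UNIV. (x $ i) ^ \<beta> i))"
      by (intro sum.mono_neutral_right finite_multi_indices img) (auto simp: d_def)
    also have "\<dots> = (\<Sum>\<alpha>\<in>multi_indices k. d (?up \<alpha>) * (\<Prod>j\<in>UNIV. (x $ j) ^ (?up \<alpha>) j))"
      by (subst sum.reindex[OF inj]) simp
    also have "\<dots> = (\<Sum>\<alpha>\<in>multi_indices k. c \<alpha> * (x $ i * (\<Prod>j\<in>UNIV. (x $ j) ^ \<alpha> j)))"
      unfolding mon by (intro sum.cong) (auto simp: d_def)
    also have "\<dots> = x $ i * p x" by (simp add: c sum_distrib_left mult_ac)
    finally show ?thesis ..
  qed
  then show ?thesis unfolding polynomials_def by blast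
qed

text \<open>Brings the Taylor terms of the exponentials within reach of the moment
  conditions.\<close>

lemma polynomials_inner_power: "(\<lambda>x. (x \<bullet> w) ^ j) \<in> polynomials (int j)"
proof (induction j)
  case 0
  then show ?case by (simp add: polynomials_one)
next
  case (Suc j)
  have "(\<lambda>x. \<Sum>i\<in>UNIV. w $ i * (x $ i * (x \<bullet> w) ^ j)) \<in> polynomials (int j + 1)"
    by (intro polynomials_sum polynomials_cmult polynomials_coord_mult Suc) simp
  moreover have "(\<Sum>i\<in>UNIV. w $ i * (x $ i * (x \<bullet> w) ^ j)) = (x \<bullet> w) ^ Suc j" for x
    by (simp add: inner_vec_def[of x w] sum_distrib_right mult_ac)
  ultimately show ?case by (simp add: add.commute)
qed

text \<open>Up to normalisation the Fourier transform of the measure with mass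
  \<open>a \<xi>\<close> at each \<xi>. The sign sits on the vector so that every exponential is
  literally a generator \<open>temper_mult.char\<close>.\<close>

definition expsum :: "(real ^ 'n) set \<Rightarrow> (real ^ 'n \<Rightarrow> real) \<Rightarrow> real ^ 'n \<Rightarrow> complex" where
  "expsum \<Xi> a \<omega> = (\<Sum>\<xi>\<in>\<Xi>. complex_of_real (a \<xi>) * iexp (\<omega> \<bullet> (- \<xi>)))"

lemma temper_mult_expsum: "finite \<Xi> \<Longrightarrow> expsum \<Xi> a \<in> temper_mult"
  unfolding expsum_def by (intro temper_mult_sum temper_mult.intros)

lemma expsum_measurable:
  "finite \<Xi> \<Longrightarrow> expsum \<Xi> a \<in> borel_measurable borel"
  by (intro borel_measurable_continuous_onI continuous_at_imp_continuous_on ballI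
      differentiable_imp_continuous_within temper_mult_differentiable temper_mult_expsum)

lemma expsum_le_sum_abs: "cmod (expsum \<Xi> a \<omega>) \<le> (\<Sum>\<xi>\<in>\<Xi>. \<bar>a \<xi>\<bar>)"
  unfolding expsum_def by (rule order_trans[OF norm_sum]) (simp add: norm_mult)

text \<open>The Taylor terms of degree below \<open>m\<close> are powers of an inner product, hence
  polynomials in \<xi> that the moment conditions kill; the remainder is of order |\<omega>|^m. For
  \<open>m \<le> 0\<close> this degenerates to boundedness.\<close>

lemma expsum_vanishing:
  assumes \<Xi>: "finite \<Xi>"
    and mom: "\<And>r. r \<in> polynomials (m - 1) \<Longrightarrow> (\<Sum>\<xi>\<in>\<Xi>. a \<xi> * r \<xi>) = 0"
  shows "\<exists>C\<ge>0. \<forall>\<omega>. cmod (expsum \<Xi> a \<omega>) \<le> C * norm \<omega> ^ nat m"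
proof (cases "nat m")
  case 0
  then show ?thesis
    using expsum_le_sum_abs[of \<Xi> a] by (intro exI[of _ "\<Sum>\<xi>\<in>\<Xi>. \<bar>a \<xi>\<bar>"]) (auto intro: sum_nonneg)
next
  case (Suc n)
  define C where "C = (\<Sum>\<xi>\<in>\<Xi>. \<bar>a \<xi>\<bar> * norm \<xi> ^ Suc n)"
  have "cmod (expsum \<Xi> a \<omega>) \<le> C * norm \<omega> ^ Suc n" for \<omega>
  proof -
    let ?t = "\<lambda>\<xi>. \<omega> \<bullet> (- \<xi>)"
    have "(\<Sum>\<xi>\<in>\<Xi>. complex_of_real (a \<xi>) * ((\<i> * complex_of_real (?t \<xi>)) ^ k / fact k)) = 0" if "k \<le> n" for k
    proof -
      have "(\<lambda>\<xi>. (\<xi> \<bullet> (- \<omega>)) ^ k) \<in> polynomials (m - 1)"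
        by (rule polynomials_mono[OF polynomials_inner_power]) (use that Suc in linarith)
      from mom[OF this] have "complex_of_real (\<Sum>\<xi>\<in>\<Xi>. a \<xi> * (\<xi> \<bullet> (- \<omega>)) ^ k) * (\<i> ^ k / fact k) = 0" by simp
      moreover have "complex_of_real (a \<xi>) * ((\<i> * complex_of_real (?t \<xi>)) ^ k / fact k) =
          complex_of_real (a \<xi> * (\<xi> \<bullet> (- \<omega>)) ^ k) * (\<i> ^ k / fact k)" for \<xi>
      proof -
        have "?t \<xi> = \<xi> \<bullet> (- \<omega>)" by (simp add: inner_commute)
        then show ?thesis by (simp only: power_mult_distrib of_real_mult of_real_power) simp
      qed
      ultimately show ?thesis
        by (simp only: sum_distrib_right[symmetric] of_real_sum[symmetric])
    qed
    then have "(\<Sum>\<xi>\<in>\<Xi>. complex_of_real (a \<xi>) * (\<Sum>k\<le>n. (\<i> * complex_of_real (?t \<xi>)) ^ k / fact k)) = 0"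
      unfolding sum_distrib_left by (subst sum.swap) (auto intro!: sum.neutral)
    then have "expsum \<Xi> a \<omega> = (\<Sum>\<xi>\<in>\<Xi>. complex_of_real (a \<xi>) * (iexp (?t \<xi>) - (\<Sum>k\<le>n. (\<i> * complex_of_real (?t \<xi>)) ^ k / fact k)))"
      unfolding expsum_def right_diff_distrib sum_subtractf by simp
    also have "cmod \<dots> \<le> (\<Sum>\<xi>\<in>\<Xi>. \<bar>a \<xi>\<bar> * norm \<xi> ^ Suc n * norm \<omega> ^ Suc n)"
    proof (rule order_trans[OF norm_sum], rule sum_mono)
      fix \<xi>
      have "cmod (iexp (?t \<xi>) - (\<Sum>k\<le>n. (\<i> * complex_of_real (?t \<xi>)) ^ k / fact k)) \<le> \<bar>?t \<xi>\<bar> ^ Suc n / fact (Suc n)"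
        by (rule iexp_approx1)
      also have "\<dots> \<le> \<bar>?t \<xi>\<bar> ^ Suc n"
        using fact_ge_1[of "Suc n", where 'a = real] by (simp add: divide_le_eq mult_left_le mult_le_cancel_left1 del: fact_Suc power_Suc)
      also have "\<dots> \<le> (norm \<xi> * norm \<omega>) ^ Suc n"
        using Cauchy_Schwarz_ineq2[of \<omega> "- \<xi>"] by (intro power_mono) (auto simp: mult.commute)
      finally have "\<bar>a \<xi>\<bar> * cmod (iexp (?t \<xi>) - (\<Sum>k\<le>n. (\<i> * complex_of_real (?t \<xi>)) ^ k / fact k)) \<le> \<bar>a \<xi>\<bar> * (norm \<xi> * norm \<omega>) ^ Suc n"
        by (rule mult_left_mono) simp
      then show "cmod (complex_of_real (a \<xi>) * (iexp (?t \<xi>) - (\<Sum>k\<le>n. (\<i> * complex_of_real (?t \<xi>)) ^ k / fact k))) \<le>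
          \<bar>a \<xi>\<bar> * norm \<xi> ^ Suc n * norm \<omega> ^ Suc n"
        by (simp only: norm_mult norm_of_real power_mult_distrib mult.assoc)
    qed
    also have "\<dots> = C * norm \<omega> ^ Suc n" unfolding C_def sum_distrib_right ..
    finally show ?thesis .
  qed
  moreover have "C \<ge> 0" unfolding C_def by (intro sum_nonneg) auto
  ultimately show ?thesis unfolding Suc by blast
qed

section \<open>The transform of a basis function expansion\<close>

lemma schwartz_vanishing_bound:
  fixes \<gamma> :: "real ^ 'n::finite \<Rightarrow> complex"
  assumes \<gamma>: "\<gamma> \<in> schwartz_vanishing (real m)"
  shows "\<exists>B\<ge>0. \<forall>\<omega>. cmod (\<gamma> \<omega>) \<le> B * norm \<omega> ^ m"
proof -
  obtain B0 where B0: "\<And>\<omega>. \<omega> \<noteq> 0 \<Longrightarrow> norm \<omega> powr (- real m) * cmod (\<gamma> \<omega>) \<le> B0"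
    using \<gamma> unfolding schwartz_vanishing_def by blast
  define B where "B = max 0 B0"
  have b: "cmod (\<gamma> \<omega>) \<le> B * norm \<omega> ^ m" if "\<omega> \<noteq> 0" for \<omega>
  proof -
    have "norm \<omega> powr (- real m) * cmod (\<gamma> \<omega>) \<le> B" using B0[OF that] by (simp add: B_def)
    then show ?thesis using that by (simp add: powr_minus powr_realpow field_simps)
  qed
  \<comment> \<open>The test space prescribes nothing at the origin itself; continuity extends the
    bound to it.\<close>
  have "cmod (\<gamma> 0) \<le> B * norm (0 :: real ^ 'n) ^ m"
  proof (rule tendsto_le)
    show "((\<lambda>\<omega>. B * norm \<omega> ^ m) \<longlongrightarrow> B * norm (0 :: real ^ 'n) ^ m) (at (0 :: real ^ 'n))"
      by (intro tendsto_mult tendsto_const tendsto_power tendsto_norm tendsto_ident_at)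
    have "isCont \<gamma> 0"
      using schwartz_differentiable[OF schwartz_vanishing_schwartz[OF \<gamma>]] by (rule differentiable_imp_continuous_within)
    then show "((\<lambda>\<omega>. cmod (\<gamma> \<omega>)) \<longlongrightarrow> cmod (\<gamma> 0)) (at 0)" by (intro tendsto_intros) (simp add: isCont_def)
    show "\<forall>\<^sub>F \<omega> in at 0. cmod (\<gamma> \<omega>) \<le> B * norm \<omega> ^ m"
      unfolding eventually_at_filter using b by (intro always_eventually) auto
  qed simp
  then have "cmod (\<gamma> \<omega>) \<le> B * norm \<omega> ^ m" for \<omega> using b by (cases "\<omega> = 0") auto
  then show ?thesis by (intro exI[of _ B]) (auto simp: B_def)
qed

text \<open>By Fourier inversion, integrating \<open>exp_diff_prod t is\<close> against the transform of \<open>\<gamma>\<close> gives an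
  iterated finite difference of \<open>\<gamma>\<close> at 0. Dividing by \<open>t\<close> to the power \<open>length is\<close> and letting
  \<open>t\<close> tend to 0 turns the order of vanishing of \<open>\<gamma>\<close> into vanishing moments of its transform.\<close>

definition exp_diff_prod :: "real \<Rightarrow> 'n list \<Rightarrow> real ^ 'n \<Rightarrow> complex" where
  "exp_diff_prod t is x = prod_list (map (\<lambda>i. iexp (x \<bullet> (t *\<^sub>R axis i 1)) - 1) is)"

lemma temper_mult_exp_diff_prod: "exp_diff_prod t is \<in> temper_mult"
proof (induction "is")
  case Nil
  show ?case unfolding exp_diff_prod_def by (simp add: temper_mult.const)
next
  case (Cons i "is")
  have "(\<lambda>x. (iexp (x \<bullet> (t *\<^sub>R axis i 1)) + (-1)) * exp_diff_prod t is x) \<in> temper_mult"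
    by (intro temper_mult.mult temper_mult.add temper_mult.char temper_mult.const Cons)
  then show ?case by (simp add: exp_diff_prod_def)
qed

text \<open>Each factor is a modulation minus the identity, hence a difference of two evaluations of
  \<gamma>. So every list element doubles the number of terms and moves the evaluation point by at
  most |t|, which is why \<open>y\<close> is general in the induction. The base case is the
  inversion formula, whose normalisation leaves \<open>osc_const\<close> in the denominator.\<close>

lemma integral_exp_diff_prod_bound:
  fixes \<gamma> :: "real ^ 'n::finite \<Rightarrow> complex"
  assumes \<gamma>: "\<gamma> \<in> schwartz" and B: "B \<ge> 0" "\<And>\<omega>. cmod (\<gamma> \<omega>) \<le> B * norm \<omega> ^ m"
  shows "cmod (LINT x|lborel. exp_diff_prod t is x * (iexp (x \<bullet> y) * osc (-1) \<gamma> x)) \<le>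
     2 ^ length is * (B / osc_const TYPE('n)) * (real (length is) * \<bar>t\<bar> + norm y) ^ m"
proof (induction "is" arbitrary: y)
  case Nil
  have "complex_of_real (osc_const TYPE('n)) * (LINT x|lborel. iexp (x \<bullet> y) * osc (-1) \<gamma> x) = \<gamma> y"
    using osc_inversion[OF \<gamma>, of y] by (simp add: osc_def[of 1])
  then have "osc_const TYPE('n) * cmod (LINT x|lborel. iexp (x \<bullet> y) * osc (-1) \<gamma> x) = cmod (\<gamma> y)"
    using osc_const_pos[where 'n = 'n] by (metis abs_of_pos norm_mult norm_of_real)
  then show ?case
    using osc_const_pos[where 'n = 'n] B(2)[of y] by (simp add: exp_diff_prod_def field_simps)
next
  case (Cons i "is")
  have F: "osc (-1) \<gamma> \<in> schwartz" by (rule schwartz_osc[OF _ \<gamma>]) simp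
  let ?e = "t *\<^sub>R axis i 1 :: real ^ 'n"
  let ?K = "2 ^ length is * (B / osc_const TYPE('n))"
  have K: "?K \<ge> 0" using B(1) osc_const_pos[where 'n = 'n] by simp
  have int: "integrable lborel (\<lambda>x. exp_diff_prod t is x * (iexp (x \<bullet> y) * osc (-1) \<gamma> x))" for y
    by (intro schwartz_integrable schwartz_mult temper_mult_exp_diff_prod temper_mult.char F)
  have e: "exp_diff_prod t (i # is) x * (iexp (x \<bullet> y) * osc (-1) \<gamma> x) =
     exp_diff_prod t is x * (iexp (x \<bullet> (y + ?e)) * osc (-1) \<gamma> x) - exp_diff_prod t is x * (iexp (x \<bullet> y) * osc (-1) \<gamma> x)" for x
  proof -
    have "iexp (x \<bullet> (y + ?e)) = iexp (x \<bullet> y) * iexp (x \<bullet> ?e)"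
      by (simp only: inner_add_right of_real_add distrib_left exp_add)
    moreover have "exp_diff_prod t (i # is) x = (iexp (x \<bullet> ?e) - 1) * exp_diff_prod t is x"
      by (simp add: exp_diff_prod_def)
    ultimately show ?thesis by (simp only:) (simp only: algebra_simps mult_1)
  qed
  have "norm (y + ?e) \<le> norm y + \<bar>t\<bar>"
    using norm_triangle_ineq[of y ?e] by (simp add: norm_axis_1)
  then have le1: "real (length is) * \<bar>t\<bar> + norm (y + ?e) \<le> real (length (i # is)) * \<bar>t\<bar> + norm y"
    by (simp add: algebra_simps)
  have le2: "real (length is) * \<bar>t\<bar> + norm y \<le> real (length (i # is)) * \<bar>t\<bar> + norm y"
    by (simp add: mult_right_mono)
  have "cmod (LINT x|lborel. exp_diff_prod t (i # is) x * (iexp (x \<bullet> y) * osc (-1) \<gamma> x)) \<le>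
    cmod (LINT x|lborel. exp_diff_prod t is x * (iexp (x \<bullet> (y + ?e)) * osc (-1) \<gamma> x)) +
    cmod (LINT x|lborel. exp_diff_prod t is x * (iexp (x \<bullet> y) * osc (-1) \<gamma> x))"
    unfolding e by (subst Bochner_Integration.integral_diff[OF int int]) (rule norm_triangle_ineq4)
  also have "\<dots> \<le> ?K * (real (length is) * \<bar>t\<bar> + norm (y + ?e)) ^ m + ?K * (real (length is) * \<bar>t\<bar> + norm y) ^ m"
    by (intro add_mono Cons)
  also have "\<dots> \<le> ?K * (real (length (i # is)) * \<bar>t\<bar> + norm y) ^ m + ?K * (real (length (i # is)) * \<bar>t\<bar> + norm y) ^ m"
    by (intro add_mono mult_left_mono power_mono le1 le2 K) auto
  also have "\<dots> = 2 ^ length (i # is) * (B / osc_const TYPE('n)) * (real (length (i # is)) * \<bar>t\<bar> + norm y) ^ m"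
    by simp
  finally show ?case .
qed

lemma iexp_minus_one_le: "cmod (iexp b - 1) \<le> \<bar>b\<bar>"
  using iexp_approx1[of b 0] by simp

lemma integral_monomial_osc:
  fixes \<gamma> :: "real ^ 'n::finite \<Rightarrow> complex"
  assumes \<gamma>: "\<gamma> \<in> schwartz_vanishing (real m)" and len: "length is < m"
  shows "(LINT x|lborel. complex_of_real (prod_list (map (\<lambda>i. x $ i) is)) * osc (-1) \<gamma> x) = 0"
proof -
  have \<gamma>s: "\<gamma> \<in> schwartz" by (rule schwartz_vanishing_schwartz[OF \<gamma>])
  obtain B where B: "B \<ge> 0" "\<And>\<omega>. cmod (\<gamma> \<omega>) \<le> B * norm \<omega> ^ m"
    using schwartz_vanishing_bound[OF \<gamma>] by blast
  define \<psi> where "\<psi> = osc (-1) \<gamma>"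
  have \<psi>: "\<psi> \<in> schwartz" unfolding \<psi>_def by (rule schwartz_osc[OF _ \<gamma>s]) simp
  define l where "l = length is"
  define d where "d k = 1 / real (Suc k)" for k
  have d: "0 < d k" for k by (simp add: d_def)
  have dlim: "d \<longlonglongrightarrow> 0" unfolding d_def[abs_def] by (rule lim_1_over_n[THEN LIMSEQ_Suc])
  \<comment> \<open>\<open>?Q\<close> is the product of difference quotients of the exponential at
    0; its pointwise limit \<open>?P\<close> is the monomial up to a power of the imaginary
    unit.\<close>
  let ?Q = "\<lambda>is k x. exp_diff_prod (d k) is x / complex_of_real (d k ^ length is)"
  let ?P = "\<lambda>is x. prod_list (map (\<lambda>i. \<i> * complex_of_real (x $ i)) is)"
  have Q_Cons: "?Q (i # js) k x = (iexp (d k * x $ i) - 1) / complex_of_real (d k) * ?Q js k x" for i js k and x :: "real ^ 'n"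
    by (simp add: exp_diff_prod_def inner_axis)
  have Qlim: "(\<lambda>k. ?Q js k x) \<longlonglongrightarrow> ?P js x" for js and x :: "real ^ 'n"
  proof (induction js)
    case Nil
    show ?case by (simp add: exp_diff_prod_def)
  next
    case (Cons i js)
    have "(\<lambda>k. (iexp (d k * x $ i) - 1) / complex_of_real (d k)) \<longlonglongrightarrow> \<i> * complex_of_real (x $ i)"
    proof (rule LIM_zero_cancel, rule tendsto_norm_zero_cancel, rule tendsto_sandwich)
      show "\<forall>\<^sub>F k in sequentially. 0 \<le> cmod ((iexp (d k * x $ i) - 1) / complex_of_real (d k) - \<i> * complex_of_real (x $ i))" by simp
      show "(\<lambda>k. d k * ((x $ i)\<^sup>2 / 2)) \<longlonglongrightarrow> 0"
        using tendsto_mult_right[OF dlim, of "(x $ i)\<^sup>2 / 2"] by simp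
      have "cmod ((iexp (d k * x $ i) - 1) / complex_of_real (d k) - \<i> * complex_of_real (x $ i)) \<le> d k * ((x $ i)\<^sup>2 / 2)" for k
      proof -
        have eq: "(iexp (d k * x $ i) - 1) / complex_of_real (d k) - \<i> * complex_of_real (x $ i) =
          (iexp (0 + d k * x $ i) - iexp 0 - \<i> * complex_of_real (d k * x $ i) * iexp 0) / complex_of_real (d k)"
          using d[of k] by (simp add: field_simps)
        have "cmod ((iexp (d k * x $ i) - 1) / complex_of_real (d k) - \<i> * complex_of_real (x $ i)) \<le> ((d k * x $ i)\<^sup>2 / 2) / d k"
          unfolding eq norm_divide norm_of_real abs_of_pos[OF d]
          by (rule divide_right_mono[OF iexp_taylor1 less_imp_le[OF d]])
        also have "\<dots> = d k * ((x $ i)\<^sup>2 / 2)" using d[of k] by (simp add: power2_eq_square field_simps)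
        finally show ?thesis .
      qed
      then show "\<forall>\<^sub>F k in sequentially. cmod ((iexp (d k * x $ i) - 1) / complex_of_real (d k) - \<i> * complex_of_real (x $ i)) \<le> d k * ((x $ i)\<^sup>2 / 2)"
        by simp
    qed simp
    from tendsto_mult[OF this Cons] show ?case unfolding Q_Cons by simp
  qed
  have Qb: "cmod (?Q js k x) \<le> (1 + norm x) ^ length js" for js k and x :: "real ^ 'n"
  proof (induction js)
    case Nil
    show ?case by (simp add: exp_diff_prod_def)
  next
    case (Cons i js)
    have "cmod ((iexp (d k * x $ i) - 1) / complex_of_real (d k)) \<le> \<bar>x $ i\<bar>"
      using iexp_minus_one_le[of "d k * x $ i"] d[of k] by (simp add: norm_divide divide_le_eq abs_mult mult.commute)
    also have "\<dots> \<le> 1 + norm x" using component_le_norm_cart[of x i] by linarith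
    finally have "cmod ((iexp (d k * x $ i) - 1) / complex_of_real (d k)) * cmod (?Q js k x) \<le> (1 + norm x) * (1 + norm x) ^ length js"
      by (intro mult_mono Cons) auto
    then show ?case unfolding Q_Cons norm_mult by simp
  qed
  have Pmeas: "?P js \<in> temper_mult" for js :: "'n list"
    by (induction js) (auto intro!: temper_mult.mult temper_mult.coord intro: temper_mult.const)
  have "(\<lambda>k. LINT x|lborel. ?Q is k x * \<psi> x) \<longlonglongrightarrow> (LINT x|lborel. ?P is x * \<psi> x)"
  proof (rule integral_dominated_convergence[where w = "\<lambda>x. schwartz_norm (CARD('n) + 1 + l) \<psi> * decay_weight x"])
    show "(\<lambda>x. ?P is x * \<psi> x) \<in> borel_measurable lborel"
      using schwartz_measurable[OF schwartz_mult[OF Pmeas \<psi>]] by simp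
    show "(\<lambda>x. ?Q is k x * \<psi> x) \<in> borel_measurable lborel" for k
      using schwartz_measurable[OF schwartz_mult[OF temper_mult_exp_diff_prod \<psi>]] by simp
    show "integrable lborel (\<lambda>x. schwartz_norm (CARD('n) + 1 + l) \<psi> * decay_weight x)"
      by (intro integrable_mult_right decay_weight_integrable)
    show "AE x in lborel. (\<lambda>k. ?Q is k x * \<psi> x) \<longlonglongrightarrow> ?P is x * \<psi> x"
      by (intro AE_I2 tendsto_mult Qlim tendsto_const)
    have "cmod (?Q is k x * \<psi> x) \<le> schwartz_norm (CARD('n) + 1 + l) \<psi> * decay_weight x" for k x
    proof -
      have "cmod (?Q is k x * \<psi> x) \<le> (1 + norm x) ^ l * cmod (\<psi> x)"
        unfolding norm_mult l_def by (intro mult_right_mono Qb) auto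
      also have "\<dots> \<le> schwartz_norm (CARD('n) + 1 + l) \<psi> * decay_weight x"
        by (rule schwartz_le_decay_weight[OF \<psi>])
      finally show ?thesis .
    qed
    then show "AE x in lborel. cmod (?Q is k x * \<psi> x) \<le> schwartz_norm (CARD('n) + 1 + l) \<psi> * decay_weight x" for k
      by simp
  qed
  moreover have "(\<lambda>k. LINT x|lborel. ?Q is k x * \<psi> x) \<longlonglongrightarrow> 0"
  proof (rule tendsto_norm_zero_cancel, rule tendsto_sandwich)
    \<comment> \<open>The finite difference at the origin is of order \<open>d k ^ m\<close>; after
      division by \<open>d k ^ l\<close> a positive power of the step is left, because
      \<open>l < m\<close>.\<close>
    define K where "K = 2 ^ l * (B / osc_const TYPE('n)) * real l ^ m"
    show "\<forall>\<^sub>F k in sequentially. 0 \<le> cmod (LINT x|lborel. ?Q is k x * \<psi> x)" by simp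
    show "(\<lambda>k. K * d k ^ (m - l)) \<longlonglongrightarrow> 0"
    proof -
      have "(\<lambda>k. K * d k ^ (m - l)) \<longlonglongrightarrow> K * 0 ^ (m - l)" by (intro tendsto_intros dlim)
      then show ?thesis using len by (simp add: l_def power_0_left)
    qed
    have "cmod (LINT x|lborel. ?Q is k x * \<psi> x) \<le> K * d k ^ (m - l)" for k
    proof -
      have "(LINT x|lborel. ?Q is k x * \<psi> x) = (LINT x|lborel. exp_diff_prod (d k) is x * (iexp (x \<bullet> 0) * osc (-1) \<gamma> x)) / complex_of_real (d k ^ l)"
        by (simp add: \<psi>_def l_def)
      then have eq: "cmod (LINT x|lborel. ?Q is k x * \<psi> x) =
          cmod (LINT x|lborel. exp_diff_prod (d k) is x * (iexp (x \<bullet> 0) * osc (-1) \<gamma> x)) / d k ^ l"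
        using d[of k] by (simp add: norm_divide norm_power)
      have "cmod (LINT x|lborel. ?Q is k x * \<psi> x) \<le> (2 ^ l * (B / osc_const TYPE('n)) * (real l * d k) ^ m) / d k ^ l"
        unfolding eq using integral_exp_diff_prod_bound[OF \<gamma>s B, of "d k" "is" 0] d[of k]
        by (intro divide_right_mono) (simp_all add: l_def)
      also have "\<dots> = K * (d k ^ m / d k ^ l)" by (simp add: K_def power_mult_distrib)
      also have "d k ^ m / d k ^ l = d k ^ (m - l)" using d[of k] len by (simp add: l_def power_diff)
      finally show ?thesis .
    qed
    then show "\<forall>\<^sub>F k in sequentially. cmod (LINT x|lborel. ?Q is k x * \<psi> x) \<le> K * d k ^ (m - l)" by simp
  qed simp
  ultimately have "(LINT x|lborel. ?P is x * \<psi> x) = 0" by (rule LIMSEQ_unique)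
  moreover have "?P is x = \<i> ^ length is * complex_of_real (prod_list (map (\<lambda>i. x $ i) is))" for x
    by (induction "is") (simp_all add: mult_ac)
  ultimately show ?thesis by (simp add: \<psi>_def mult.assoc)
qed

text \<open>Translates the multi-indices of \<open>polynomials\<close> into the coordinate lists of
  \<open>exp_diff_prod\<close>: coordinate \<open>i\<close> is repeated \<open>\<alpha> i\<close>
  times.\<close>

lemma monomial_as_prod_list:
  fixes \<alpha> :: "'n::finite \<Rightarrow> nat"
  assumes "finite S"
  shows "\<exists>is. length is = sum \<alpha> S \<and> (\<forall>x::real ^ 'n. prod_list (map (\<lambda>i. x $ i) is) = (\<Prod>i\<in>S. (x $ i) ^ \<alpha> i))"
  using assms
proof (induction S rule: finite_induct)
  case empty
  show ?case by (intro exI[of _ "[]"]) simp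
next
  case (insert i S)
  then obtain "is" where "length is = sum \<alpha> S" "\<And>x::real ^ 'n. prod_list (map (\<lambda>i. x $ i) is) = (\<Prod>i\<in>S. (x $ i) ^ \<alpha> i)" by blast
  then show ?case using insert.hyps
    by (intro exI[of _ "replicate (\<alpha> i) i @ is"]) (simp add: map_replicate prod_list_replicate)
qed

lemma temper_mult_prod:
  "finite A \<Longrightarrow> (\<And>a. a \<in> A \<Longrightarrow> f a \<in> temper_mult) \<Longrightarrow> (\<lambda>x. \<Prod>a\<in>A. f a x) \<in> temper_mult"
  by (induction A rule: finite_induct) (auto intro: temper_mult.const temper_mult.mult)

lemma temper_mult_polynomial:
  fixes p :: "real ^ 'n \<Rightarrow> real"
  assumes "p \<in> polynomials k"
  shows "(\<lambda>x. complex_of_real (p x)) \<in> temper_mult"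
proof -
  from assms obtain c where c: "\<And>x. p x = (\<Sum>\<alpha>\<in>multi_indices k. c \<alpha> * (\<Prod>i\<in>UNIV. (x $ i) ^ \<alpha> i))"
    unfolding polynomials_def by blast
  have "(\<lambda>x::real ^ 'n. \<Sum>\<alpha>\<in>multi_indices k. complex_of_real (c \<alpha>) * (\<Prod>i\<in>UNIV. complex_of_real (x $ i) ^ \<alpha> i)) \<in> temper_mult"
    by (intro temper_mult_sum temper_mult.mult temper_mult_prod temper_mult_power temper_mult.const temper_mult.coord finite_multi_indices) simp
  then show ?thesis by (simp add: c)
qed

text \<open>Moments of the transform correspond to derivatives of \<gamma> at the origin, and those
  of order below \<open>m\<close> vanish. Hence the polynomial part has generalized transform 0 of
  order m/2. For \<open>m \<le> 0\<close> there are no multi-indices to consider.\<close>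

lemma integral_polynomial_osc:
  fixes \<gamma> :: "real ^ 'n::finite \<Rightarrow> complex"
  assumes \<gamma>: "\<gamma> \<in> schwartz_vanishing (of_int m)" and p: "p \<in> polynomials (m - 1)"
  shows "(LINT x|lborel. complex_of_real (p x) * osc (-1) \<gamma> x) = 0"
proof -
  from p obtain c where c: "\<And>x. p x = (\<Sum>\<alpha>\<in>multi_indices (m - 1). c \<alpha> * (\<Prod>i\<in>UNIV. (x $ i) ^ \<alpha> i))"
    unfolding polynomials_def by blast
  have F: "osc (-1) \<gamma> \<in> schwartz" by (rule schwartz_osc[OF _ schwartz_vanishing_schwartz[OF \<gamma>]]) simp
  have "(LINT x|lborel. complex_of_real (p x) * osc (-1) \<gamma> x) =
     (LINT x|lborel. (\<Sum>\<alpha>\<in>multi_indices (m - 1). complex_of_real (c \<alpha>) * ((\<Prod>i\<in>UNIV. complex_of_real (x $ i) ^ \<alpha> i) * osc (-1) \<gamma> x)))"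
    by (simp add: c sum_distrib_right mult.assoc)
  also have "\<dots> = (\<Sum>\<alpha>\<in>multi_indices (m - 1). complex_of_real (c \<alpha>) * (LINT x|lborel. (\<Prod>i\<in>UNIV. complex_of_real (x $ i) ^ \<alpha> i) * osc (-1) \<gamma> x))"
    by (subst Bochner_Integration.integral_sum)
       (auto intro!: integrable_mult_right schwartz_integrable schwartz_mult F temper_mult_prod temper_mult_power temper_mult.coord temper_mult.const)
  also have "\<dots> = 0"
  proof (rule sum.neutral, rule ballI)
    fix \<alpha> :: "'n \<Rightarrow> nat" assume "\<alpha> \<in> multi_indices (m - 1)"
    then have \<alpha>: "int (sum \<alpha> UNIV) \<le> m - 1" unfolding multi_indices_def mem_Collect_eq .
    obtain "is" where l: "length is = sum \<alpha> UNIV" and i: "\<And>x::real ^ 'n. prod_list (map (\<lambda>i. x $ i) is) = (\<Prod>i\<in>UNIV. (x $ i) ^ \<alpha> i)"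
      using monomial_as_prod_list[of UNIV \<alpha>] by auto
    have "0 \<le> m" using \<alpha> by linarith
    then have m: "real (nat m) = of_int m" by simp
    have "length is < nat m" using \<alpha> l by linarith
    then have "(LINT x|lborel. complex_of_real (prod_list (map (\<lambda>i. x $ i) is)) * osc (-1) \<gamma> x) = 0"
      using \<gamma> unfolding m[symmetric] by (intro integral_monomial_osc)
    then show "complex_of_real (c \<alpha>) * (LINT x|lborel. (\<Prod>i\<in>UNIV. complex_of_real (x $ i) ^ \<alpha> i) * osc (-1) \<gamma> x) = 0"
      unfolding i by simp
  qed
  finally show ?thesis .
qed

section \<open>Functions of algebraic growth as tempered distributions\<close>

lemma algebraic_growthE:
  assumes "algebraic_growth f"
  obtains B k where "B \<ge> 0" "\<And>x. \<bar>f x\<bar> \<le> B * (1 + norm x) ^ k"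
proof -
  from assms obtain B k where b: "\<And>x. \<bar>f x\<bar> \<le> B * (1 + norm x) ^ k"
    unfolding algebraic_growth_def by blast
  have "\<bar>f 0\<bar> \<le> B" using b[of 0] by simp
  then have "B \<ge> 0" by linarith
  with b that show thesis by blast
qed

lemma growth_schwartz_integrable:
  fixes f :: "real ^ 'n::finite \<Rightarrow> real"
  assumes "algebraic_growth f" "continuous_on UNIV f" "\<gamma> \<in> schwartz"
  shows "integrable lborel (\<lambda>x. complex_of_real (f x) * \<gamma> x)"
proof -
  obtain B k where B: "B \<ge> 0" "\<And>x. \<bar>f x\<bar> \<le> B * (1 + norm x) ^ k"
    using algebraic_growthE[OF assms(1)] by blast
  have "f \<in> borel_measurable borel" using assms(2) by (rule borel_measurable_continuous_onI)
  then show ?thesis using B assms(3) by (intro integral_schwartz_bound(1)[of _ B k]) auto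
qed

lemma tempered_distr_of:
  fixes f :: "real ^ 'n::finite \<Rightarrow> real"
  assumes f: "algebraic_growth f" "continuous_on UNIV f"
  shows "tempered_distribution (distr_of f)"
proof -
  obtain B k where B: "B \<ge> 0" "\<And>x. \<bar>f x\<bar> \<le> B * (1 + norm x) ^ k"
    using algebraic_growthE[OF assms(1)] by blast
  have m: "f \<in> borel_measurable borel" using assms(2) by (rule borel_measurable_continuous_onI)
  have "cmod (distr_of f \<gamma>) \<le> (B * (LINT x|lborel. decay_weight (x :: real ^ 'n))) * schwartz_norm (CARD('n) + 1 + k) \<gamma>" if "\<gamma> \<in> schwartz" for \<gamma>
    unfolding distr_of_def using B m that by (intro integral_schwartz_bound(2)) auto
  moreover have "distr_of f (\<lambda>x. c * \<gamma> x + \<eta> x) = c * distr_of f \<gamma> + distr_of f \<eta>" if "\<gamma> \<in> schwartz" "\<eta> \<in> schwartz" for c \<gamma> \<eta>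
    unfolding distr_of_def
    using growth_schwartz_integrable[OF f that(1)] growth_schwartz_integrable[OF f that(2)]
    by (simp add: distrib_left mult.left_commute[of _ c])
  ultimately show ?thesis unfolding tempered_distribution_def by blast
qed

lemma algebraic_growth_add:
  assumes "algebraic_growth f" "algebraic_growth g"
  shows "algebraic_growth (\<lambda>x. f x + g x)"
proof -
  obtain A k where A: "A \<ge> 0" "\<And>x. \<bar>f x\<bar> \<le> A * (1 + norm x) ^ k"
    using algebraic_growthE[OF assms(1)] by blast
  obtain B l where B: "B \<ge> 0" "\<And>x. \<bar>g x\<bar> \<le> B * (1 + norm x) ^ l"
    using algebraic_growthE[OF assms(2)] by blast
  have "\<bar>f x + g x\<bar> \<le> (A + B) * (1 + norm x) ^ max k l" for x
  proof -
    have "\<bar>f x + g x\<bar> \<le> A * (1 + norm x) ^ k + B * (1 + norm x) ^ l"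
      using A(2)[of x] B(2)[of x] by linarith
    also have "\<dots> \<le> A * (1 + norm x) ^ max k l + B * (1 + norm x) ^ max k l"
      using A(1) B(1) by (intro add_mono mult_left_mono power_increasing) auto
    finally show ?thesis by (simp add: algebra_simps)
  qed
  then show ?thesis unfolding algebraic_growth_def by blast
qed

lemma algebraic_growth_cmult:
  assumes "algebraic_growth f"
  shows "algebraic_growth (\<lambda>x. c * f x)"
proof -
  obtain A k where A: "A \<ge> 0" "\<And>x. \<bar>f x\<bar> \<le> A * (1 + norm x) ^ k"
    using algebraic_growthE[OF assms(1)] by blast
  have "\<bar>c * f x\<bar> \<le> (\<bar>c\<bar> * A) * (1 + norm x) ^ k" for x
    using mult_left_mono[OF A(2)[of x], of "\<bar>c\<bar>"] by (simp add: abs_mult mult.assoc)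
  then show ?thesis unfolding algebraic_growth_def by blast
qed

lemma algebraic_growth_sum:
  "finite A \<Longrightarrow> (\<And>a. a \<in> A \<Longrightarrow> algebraic_growth (f a)) \<Longrightarrow> algebraic_growth (\<lambda>x. \<Sum>a\<in>A. f a x)"
proof (induction A rule: finite_induct)
  case empty
  show ?case unfolding algebraic_growth_def by (intro exI[of _ 0]) simp
qed (simp add: algebraic_growth_add)

lemma algebraic_growth_translate:
  assumes "algebraic_growth f"
  shows "algebraic_growth (\<lambda>x. f (x - y))"
proof -
  obtain A k where A: "A \<ge> 0" "\<And>x. \<bar>f x\<bar> \<le> A * (1 + norm x) ^ k"
    using algebraic_growthE[OF assms(1)] by blast
  have "\<bar>f (x - y)\<bar> \<le> (A * (1 + norm y) ^ k) * (1 + norm x) ^ k" for x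
  proof -
    have "1 + norm (x - y) \<le> 1 + norm x + norm y" using norm_triangle_ineq4[of x y] by simp
    also have "\<dots> \<le> (1 + norm y) * (1 + norm x)" by (simp add: algebra_simps)
    finally have "(1 + norm (x - y)) ^ k \<le> ((1 + norm y) * (1 + norm x)) ^ k"
      by (intro power_mono) auto
    from mult_left_mono[OF this A(1)] A(2)[of "x - y"] show ?thesis
      by (simp add: power_mult_distrib mult.assoc)
  qed
  then show ?thesis unfolding algebraic_growth_def by blast
qed

lemma polynomial_growth_continuous:
  fixes p :: "real ^ 'n::finite \<Rightarrow> real"
  assumes "p \<in> polynomials k"
  shows "algebraic_growth p" "continuous_on UNIV p"
proof -
  note t = temper_mult_polynomial[OF assms]
  show "algebraic_growth p"
    using temper_mult_growth[OF t] unfolding algebraic_growth_def by auto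
  have "isCont (\<lambda>x. complex_of_real (p x)) x" for x
    using temper_mult_differentiable[OF t] by (rule differentiable_imp_continuous_within)
  then have "isCont (\<lambda>x. Re (complex_of_real (p x))) x" for x
    by (intro continuous_Re)
  then show "continuous_on UNIV p" by (simp add: continuous_at_imp_continuous_on)
qed

text \<open>Orders of vanishing add: \<open>m\<close> from the moment conditions and
  \<open>m\<close> from \<gamma>. This is how a transform of order m for \<phi> becomes one of order
  m/2 for an expansion, whose test functions vanish only to order m.\<close>

lemma expsum_mult_vanishing:
  assumes \<Xi>: "finite \<Xi>"
    and mom: "\<And>r. r \<in> polynomials (m - 1) \<Longrightarrow> (\<Sum>\<xi>\<in>\<Xi>. a \<xi> * r \<xi>) = 0"
    and \<gamma>: "\<gamma> \<in> schwartz_vanishing (of_int m)"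
  shows "(\<lambda>\<omega>. expsum \<Xi> a \<omega> * \<gamma> \<omega>) \<in> schwartz_vanishing (2 * of_int m)"
proof -
  have s: "(\<lambda>\<omega>. expsum \<Xi> a \<omega> * \<gamma> \<omega>) \<in> schwartz"
    by (intro schwartz_mult temper_mult_expsum \<Xi> schwartz_vanishing_schwartz[OF \<gamma>])
  show ?thesis
  proof (cases "m \<le> 0")
    case True
    then show ?thesis by (intro schwartz_vanishing_nonpos s) simp
  next
    case False
    then have m: "real (nat m) = of_int m" by simp
    obtain B where B: "B \<ge> 0" "\<And>\<omega>. cmod (\<gamma> \<omega>) \<le> B * norm \<omega> ^ nat m"
      using schwartz_vanishing_bound[of \<gamma> "nat m"] \<gamma> m by auto
    obtain C where C: "C \<ge> 0" "\<And>\<omega>. cmod (expsum \<Xi> a \<omega>) \<le> C * norm \<omega> ^ nat m"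
      using expsum_vanishing[OF \<Xi> mom] by blast
    have "norm \<omega> powr (- (2 * of_int m)) * cmod (expsum \<Xi> a \<omega> * \<gamma> \<omega>) \<le> C * B" if "\<omega> \<noteq> 0" for \<omega>
    proof -
      have "norm \<omega> powr (- (2 * of_int m)) * cmod (expsum \<Xi> a \<omega> * \<gamma> \<omega>) \<le>
          norm \<omega> powr (- (2 * of_int m)) * ((C * norm \<omega> ^ nat m) * (B * norm \<omega> ^ nat m))"
        unfolding norm_mult using B C by (intro mult_left_mono mult_mono) auto
      also have "\<dots> = C * B * (norm \<omega> powr (- (2 * of_int m)) * (norm \<omega> powr of_int m * norm \<omega> powr of_int m))"
        using that powr_realpow[of "norm \<omega>" "nat m"] by (simp add: m)
      also have "\<dots> = C * B" using that unfolding powr_add[symmetric] by simp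
      finally show ?thesis .
    qed
    then show ?thesis using s unfolding schwartz_vanishing_def by blast
  qed
qed

lemma measurable_punctured:
  "g \<in> borel_measurable borel \<Longrightarrow> g \<in> borel_measurable (restrict_space borel (- {0}))"
  by (rule measurable_restrict_space1)

lemma fourier_expsum_mult:
  fixes \<gamma> :: "real ^ 'n::finite \<Rightarrow> complex"
  assumes "finite \<Xi>" "\<gamma> \<in> schwartz"
  shows "osc (-1) (\<lambda>\<omega>. expsum \<Xi> a \<omega> * \<gamma> \<omega>) x = (\<Sum>\<xi>\<in>\<Xi>. complex_of_real (a \<xi>) * osc (-1) \<gamma> (x + \<xi>))"
proof -
  have e: "(\<lambda>\<omega>. expsum \<Xi> a \<omega> * \<gamma> \<omega>) = (\<lambda>\<omega>. \<Sum>\<xi>\<in>\<Xi>. complex_of_real (a \<xi>) * (iexp (\<omega> \<bullet> ((-1) *\<^sub>R \<xi>)) * \<gamma> \<omega>))"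
    by (simp add: expsum_def sum_distrib_right mult.assoc)
  have s: "(\<lambda>\<omega>. complex_of_real (a \<xi>) * (iexp (\<omega> \<bullet> ((-1) *\<^sub>R \<xi>)) * \<gamma> \<omega>)) \<in> schwartz" for \<xi>
    by (intro schwartz_cmult schwartz_mult temper_mult.char assms)
  show ?thesis
    unfolding e osc_sum[OF assms(1) s] osc_cmult osc_modulate ..
qed

text \<open>The transform of \<phi> is tested with the exponential sum times \<gamma>. On the other
  side this yields translates of the transformed \<gamma>, and translation invariance moves the
  shifts onto \<phi>; the polynomial contributes 0.\<close>

lemma has_gen_fourier_rbf:
  fixes \<phi> \<phi>hat :: "real ^ 'n::finite \<Rightarrow> real"
  assumes \<phi>: "algebraic_growth \<phi>" "continuous_on UNIV \<phi>"
    and gft: "has_gen_fourier (of_int m) (distr_of \<phi>) (\<lambda>\<omega>. complex_of_real (\<phi>hat \<omega>))"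
    and \<Xi>: "finite \<Xi>"
    and mom: "\<And>r. r \<in> polynomials (m - 1) \<Longrightarrow> (\<Sum>\<xi>\<in>\<Xi>. a \<xi> * r \<xi>) = 0"
    and p: "p \<in> polynomials (m - 1)"
  shows "has_gen_fourier (of_int m / 2) (distr_of (\<lambda>x. (\<Sum>\<xi>\<in>\<Xi>. a \<xi> * \<phi> (x - \<xi>)) + p x))
    (\<lambda>\<omega>. complex_of_real (\<phi>hat \<omega>) * expsum \<Xi> a \<omega>)"
  unfolding has_gen_fourier_def
proof (intro conjI ballI)
  let ?u = "\<lambda>x. (\<Sum>\<xi>\<in>\<Xi>. a \<xi> * \<phi> (x - \<xi>)) + p x"
  have gr: "algebraic_growth (\<lambda>x. \<phi> (x - \<xi>))" for \<xi> by (rule algebraic_growth_translate[OF \<phi>(1)])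
  have co: "continuous_on UNIV (\<lambda>x. \<phi> (x - \<xi>))" for \<xi>
    by (rule continuous_on_compose2[OF \<phi>(2)]) (auto intro!: continuous_intros)
  show "tempered_distribution (distr_of ?u)"
    by (intro tempered_distr_of algebraic_growth_add algebraic_growth_sum algebraic_growth_cmult gr \<Xi>
        polynomial_growth_continuous[OF p] continuous_intros co)
  show "(\<lambda>\<omega>. complex_of_real (\<phi>hat \<omega>) * expsum \<Xi> a \<omega>) \<in> borel_measurable (restrict_space borel (- {0}))"
    using gft measurable_punctured[OF expsum_measurable[OF \<Xi>]] unfolding has_gen_fourier_def by (intro borel_measurable_times) auto
  fix \<gamma> :: "real ^ 'n \<Rightarrow> complex" assume "\<gamma> \<in> schwartz_vanishing (2 * (of_int m / 2))"
  then have \<gamma>: "\<gamma> \<in> schwartz_vanishing (of_int m)" by simp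
  note \<gamma>s = schwartz_vanishing_schwartz[OF \<gamma>]
  let ?\<eta> = "\<lambda>\<omega>. expsum \<Xi> a \<omega> * \<gamma> \<omega>"
  have \<eta>: "?\<eta> \<in> schwartz_vanishing (2 * of_int m)" by (rule expsum_mult_vanishing[OF \<Xi> mom \<gamma>])
  note t = gft[unfolded has_gen_fourier_def, THEN conjunct2, THEN conjunct2, rule_format, OF \<eta>]
  show "integrable lborel (\<lambda>\<omega>. complex_of_real (\<phi>hat \<omega>) * expsum \<Xi> a \<omega> * \<gamma> \<omega>)"
    using t by (simp add: mult.assoc)
  define \<psi> where "\<psi> = osc (-1) \<gamma>"
  have \<psi>: "\<psi> \<in> schwartz" unfolding \<psi>_def by (rule schwartz_osc[OF _ \<gamma>s]) simp
  have [measurable]: "\<psi> \<in> borel_measurable borel" by (rule schwartz_measurable[OF \<psi>])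
  have [measurable]: "\<phi> \<in> borel_measurable borel" using \<phi>(2) by (rule borel_measurable_continuous_onI)
  have int: "integrable lborel (\<lambda>x. complex_of_real (\<phi> (x - \<xi>)) * \<psi> x)" for \<xi>
    by (rule growth_schwartz_integrable[OF gr co \<psi>])
  have int': "integrable lborel (\<lambda>x. complex_of_real (\<phi> x) * \<psi> (x + \<xi>))" for \<xi>
    using integrable_lborel_translate[OF int[of \<xi>], of \<xi>] by simp
  have tr: "(LINT x|lborel. complex_of_real (\<phi> (x - \<xi>)) * \<psi> x) = (LINT x|lborel. complex_of_real (\<phi> x) * \<psi> (x + \<xi>))" for \<xi>
    using integral_lborel_translate[of "\<lambda>x. complex_of_real (\<phi> (x - \<xi>)) * \<psi> x" \<xi>] by simp
  have "(LINT \<omega>|lborel. complex_of_real (\<phi>hat \<omega>) * expsum \<Xi> a \<omega> * \<gamma> \<omega>) = distr_of \<phi> (fourier ?\<eta>)"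
    using t by (simp add: mult.assoc)
  also have "\<dots> = (LINT x|lborel. (\<Sum>\<xi>\<in>\<Xi>. complex_of_real (a \<xi>) * (complex_of_real (\<phi> x) * \<psi> (x + \<xi>))))"
    unfolding distr_of_def fourier_eq_osc fourier_expsum_mult[OF \<Xi> \<gamma>s] \<psi>_def[symmetric]
    by (simp add: sum_distrib_left mult_ac)
  also have "\<dots> = (\<Sum>\<xi>\<in>\<Xi>. complex_of_real (a \<xi>) * (LINT x|lborel. complex_of_real (\<phi> (x - \<xi>)) * \<psi> x))"
    unfolding tr by (subst Bochner_Integration.integral_sum) (auto intro!: integrable_mult_right int')
  also have "\<dots> = (LINT x|lborel. (\<Sum>\<xi>\<in>\<Xi>. complex_of_real (a \<xi>) * (complex_of_real (\<phi> (x - \<xi>)) * \<psi> x)) + complex_of_real (p x) * \<psi> x)"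
    using integral_polynomial_osc[OF \<gamma> p]
      growth_schwartz_integrable[OF polynomial_growth_continuous[OF p] \<psi>]
    by (subst Bochner_Integration.integral_add, goal_cases)
       (auto intro!: Bochner_Integration.integrable_sum integrable_mult_right int simp: \<psi>_def[symmetric] Bochner_Integration.integral_sum int)
  also have "\<dots> = distr_of ?u (fourier \<gamma>)"
    unfolding distr_of_def fourier_eq_osc \<psi>_def[symmetric]
    by (simp add: sum_distrib_right distrib_right mult.assoc)
  finally show "(LINT \<omega>|lborel. complex_of_real (\<phi>hat \<omega>) * expsum \<Xi> a \<omega> * \<gamma> \<omega>) = distr_of ?u (fourier \<gamma>)" .
qed

text \<open>By duality the potential of \<open>T\<close> is \<open>T\<close> composed with
  \<open>?K\<close>. On a transformed test function the inner inverse transform cancels by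
  \<open>osc_inversion\<close>, so the weight lands on the test function itself, where
  \<open>schwartz_vanishing_mult\<close> keeps it admissible.\<close>

lemma has_gen_fourier_bessel_potential:
  fixes T :: "(real ^ 'n::finite \<Rightarrow> complex) \<Rightarrow> complex"
  assumes g: "has_gen_fourier m T g"
  shows "has_gen_fourier m (bessel_potential s T) (\<lambda>\<omega>. complex_of_real ((1 + (norm \<omega>)\<^sup>2) powr (s / 2)) * g \<omega>)"
proof -
  let ?w = "\<lambda>\<omega> :: real ^ 'n. complex_of_real ((1 + (norm \<omega>)\<^sup>2) powr (s / 2))"
  let ?K = "\<lambda>\<gamma>. osc (-1) (\<lambda>\<omega>. ?w \<omega> * osc 1 \<gamma> \<omega>)"
  have J: "bessel_potential s T \<gamma> = T (?K \<gamma>)" for \<gamma>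
    by (simp add: bessel_potential_def inv_fourier_distr_def mult_distr_def fourier_distr_def fourier_eq_osc inv_fourier_eq_osc)
  have w: "?w \<in> temper_mult" by (rule temper_mult.bracket)
  have K: "schwartz_cont ?K"
    by (rule schwartz_cont_comp[OF schwartz_cont_osc schwartz_cont_comp[OF schwartz_cont_mult[OF w] schwartz_cont_osc]]) simp_all
  have Klin: "?K (\<lambda>x. c * \<gamma> x + \<eta> x) = (\<lambda>x. c * ?K \<gamma> x + ?K \<eta> x)" if \<gamma>: "\<gamma> \<in> schwartz" and \<eta>: "\<eta> \<in> schwartz" for c \<gamma> \<eta>
  proof -
    have o1: "osc 1 (\<lambda>x. c * \<gamma> x + \<eta> x) \<omega> = c * osc 1 \<gamma> \<omega> + osc 1 \<eta> \<omega>" for \<omega>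
      by (subst osc_add) (simp_all add: schwartz_cmult \<gamma> \<eta> osc_cmult)
    have s: "(\<lambda>\<omega>. ?w \<omega> * osc 1 \<gamma> \<omega>) \<in> schwartz" "(\<lambda>\<omega>. ?w \<omega> * osc 1 \<eta> \<omega>) \<in> schwartz"
      by (intro schwartz_mult w schwartz_osc \<gamma> \<eta>, simp)+
    have "(\<lambda>\<omega>. ?w \<omega> * osc 1 (\<lambda>x. c * \<gamma> x + \<eta> x) \<omega>) = (\<lambda>\<omega>. c * (?w \<omega> * osc 1 \<gamma> \<omega>) + ?w \<omega> * osc 1 \<eta> \<omega>)"
      unfolding o1 by (simp add: algebra_simps)
    then show ?thesis
      by (simp add: osc_add[OF schwartz_cmult[OF s(1)] s(2)] osc_cmult fun_eq_iff)
  qed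
  have T: "tempered_distribution T" and gm: "g \<in> borel_measurable (restrict_space borel (- {0}))"
    using g by (auto simp: has_gen_fourier_def)
  have "tempered_distribution (bessel_potential s T)"
  proof -
    obtain C N where C: "\<And>\<gamma>. \<gamma> \<in> schwartz \<Longrightarrow> cmod (T \<gamma>) \<le> C * schwartz_norm N \<gamma>"
      using T unfolding tempered_distribution_def by blast
    obtain D M where D: "D \<ge> 0" "\<And>\<gamma>. \<gamma> \<in> schwartz \<Longrightarrow> schwartz_norm N (?K \<gamma>) \<le> D * schwartz_norm M \<gamma>"
      using schwartz_cont_norm[OF K, of N] by blast
    have "cmod (bessel_potential s T \<gamma>) \<le> (\<bar>C\<bar> * D) * schwartz_norm M \<gamma>" if \<gamma>: "\<gamma> \<in> schwartz" for \<gamma>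
    proof -
      note KS = schwartz_cont_schwartz[OF K \<gamma>]
      have "cmod (T (?K \<gamma>)) \<le> \<bar>C\<bar> * schwartz_norm N (?K \<gamma>)"
        by (rule order_trans[OF C[OF KS]]) (intro mult_right_mono abs_ge_self schwartz_norm_nonneg KS)
      also have "\<dots> \<le> \<bar>C\<bar> * (D * schwartz_norm M \<gamma>)" by (intro mult_left_mono D \<gamma>) simp
      finally show ?thesis unfolding J by (simp add: mult.assoc)
    qed
    moreover have "bessel_potential s T (\<lambda>x. c * \<gamma> x + \<eta> x) = c * bessel_potential s T \<gamma> + bessel_potential s T \<eta>"
      if \<gamma>: "\<gamma> \<in> schwartz" and \<eta>: "\<eta> \<in> schwartz" for c \<gamma> \<eta>
      unfolding J Klin[OF \<gamma> \<eta>]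
      using T schwartz_cont_schwartz[OF K \<gamma>] schwartz_cont_schwartz[OF K \<eta>] unfolding tempered_distribution_def by blast
    ultimately show ?thesis unfolding tempered_distribution_def by blast
  qed
  moreover have "(\<lambda>\<omega>. ?w \<omega> * g \<omega>) \<in> borel_measurable (restrict_space borel (- {0}))"
    by (intro borel_measurable_times gm measurable_punctured) measurable
  moreover have "integrable lborel (\<lambda>\<omega>. ?w \<omega> * g \<omega> * \<gamma> \<omega>) \<and>
     (LINT \<omega>|lborel. ?w \<omega> * g \<omega> * \<gamma> \<omega>) = bessel_potential s T (fourier \<gamma>)"
    if \<gamma>: "\<gamma> \<in> schwartz_vanishing (2 * m)" for \<gamma>
  proof -
    note 1 = g[unfolded has_gen_fourier_def, THEN conjunct2, THEN conjunct2, rule_format, OF schwartz_vanishing_mult[OF w \<gamma>]]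
    have "osc 1 (osc (-1) \<gamma>) = \<gamma>"
      by (rule ext) (rule osc_inversion[OF schwartz_vanishing_schwartz[OF \<gamma>]])
    then have "bessel_potential s T (fourier \<gamma>) = T (fourier (\<lambda>\<omega>. ?w \<omega> * \<gamma> \<omega>))"
      unfolding J fourier_eq_osc by simp
    moreover have e: "?w \<omega> * g \<omega> * \<gamma> \<omega> = g \<omega> * (?w \<omega> * \<gamma> \<omega>)" for \<omega> by (simp only: mult_ac)
    ultimately show ?thesis unfolding e using 1 by (simp only: simp_thms)
  qed
  ultimately show ?thesis unfolding has_gen_fourier_def by blast
qed

section \<open>Energy of exponential sums with separated frequencies\<close>

lemma expsum_norm_sq:
  "complex_of_real ((cmod (expsum \<Xi> a \<omega>))\<^sup>2) =
     (\<Sum>\<xi>\<in>\<Xi>. \<Sum>\<zeta>\<in>\<Xi>. complex_of_real (a \<xi> * a \<zeta>) * iexp (\<omega> \<bullet> (\<zeta> - \<xi>)))"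
proof -
  have "complex_of_real ((cmod (expsum \<Xi> a \<omega>))\<^sup>2) = expsum \<Xi> a \<omega> * cnj (expsum \<Xi> a \<omega>)"
    by (simp only: complex_norm_square)
  also have "cnj (expsum \<Xi> a \<omega>) = (\<Sum>\<zeta>\<in>\<Xi>. complex_of_real (a \<zeta>) * iexp (\<omega> \<bullet> \<zeta>))"
    by (simp add: expsum_def exp_cnj)
  also have "expsum \<Xi> a \<omega> * \<dots> =
      (\<Sum>\<xi>\<in>\<Xi>. \<Sum>\<zeta>\<in>\<Xi>. complex_of_real (a \<xi> * a \<zeta>) * iexp (\<omega> \<bullet> (\<zeta> - \<xi>)))"
    unfolding expsum_def sum_product
  proof (intro sum.cong refl)
    fix \<xi> \<zeta>
    have "iexp (\<omega> \<bullet> (\<zeta> - \<xi>)) = iexp (\<omega> \<bullet> (- \<xi>)) * iexp (\<omega> \<bullet> \<zeta>)"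
      unfolding exp_add[symmetric] distrib_left[symmetric] of_real_add[symmetric] inner_add_right[symmetric] by simp
    then show "complex_of_real (a \<xi>) * iexp (\<omega> \<bullet> (- \<xi>)) * (complex_of_real (a \<zeta>) * iexp (\<omega> \<bullet> \<zeta>)) =
        complex_of_real (a \<xi> * a \<zeta>) * iexp (\<omega> \<bullet> (\<zeta> - \<xi>))"
      by (simp only: of_real_mult mult_ac)
  qed
  finally show ?thesis .
qed

text \<open>Diagonal dominance: integrating the expanded square term by term gives
  \<open>P * S\<close> from the diagonal, and the rest is bounded by Schur's test with row sums at
  most \<theta>. The centre \<open>z\<close> enters only through factors of modulus 1, so the bound
  does not depend on it.\<close>

lemma gaussian_expsum_energy:
  fixes \<Xi> :: "(real ^ 'n::finite) set" and z :: "real ^ 'n" and a :: "real ^ 'n \<Rightarrow> real"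
  assumes c: "c > 0" and \<Xi>: "finite \<Xi>"
    and \<theta>: "\<And>\<xi>. \<xi> \<in> \<Xi> \<Longrightarrow> (\<Sum>\<zeta>\<in>\<Xi> - {\<xi>}. exp (- (norm (\<zeta> - \<xi>) / c)\<^sup>2 / 2)) \<le> \<theta>"
  defines "P \<equiv> (2 * pi) powr (real CARD('n) / 2) / c ^ CARD('n)"
    and "S \<equiv> \<Sum>\<xi>\<in>\<Xi>. (a \<xi>)\<^sup>2"
  shows "integrable lborel (\<lambda>\<omega>. exp (- (c * norm (\<omega> - z))\<^sup>2 / 2) * (cmod (expsum \<Xi> a \<omega>))\<^sup>2)"
    and "\<bar>(LINT \<omega>|lborel. exp (- (c * norm (\<omega> - z))\<^sup>2 / 2) * (cmod (expsum \<Xi> a \<omega>))\<^sup>2) - P * S\<bar> \<le> P * \<theta> * S"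
proof -
  have P: "P > 0" using c by (simp add: P_def)
  let ?f = "\<lambda>\<omega>. exp (- (c * norm (\<omega> - z))\<^sup>2 / 2) * (cmod (expsum \<Xi> a \<omega>))\<^sup>2"
  let ?e = "\<lambda>\<xi> \<zeta>. exp (- (norm (\<zeta> - \<xi>) / c)\<^sup>2 / 2)"
  let ?w = "\<lambda>\<xi> \<zeta>. complex_of_real (a \<xi> * a \<zeta>) * (complex_of_real (P * ?e \<xi> \<zeta>) * iexp (z \<bullet> (\<zeta> - \<xi>)))"
  have "has_bochner_integral lborel
      (\<lambda>\<omega>. \<Sum>\<xi>\<in>\<Xi>. \<Sum>\<zeta>\<in>\<Xi>. complex_of_real (a \<xi> * a \<zeta>) * (complex_of_real (exp (- (c * norm (\<omega> - z))\<^sup>2 / 2)) * iexp (\<omega> \<bullet> (\<zeta> - \<xi>))))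
      (\<Sum>\<xi>\<in>\<Xi>. \<Sum>\<zeta>\<in>\<Xi>. ?w \<xi> \<zeta>)"
    using gaussian_fourier[OF c, of z] unfolding P_def
    by (intro has_bochner_integral_sum has_bochner_integral_mult_right) simp
  also have "(\<lambda>\<omega>. \<Sum>\<xi>\<in>\<Xi>. \<Sum>\<zeta>\<in>\<Xi>. complex_of_real (a \<xi> * a \<zeta>) * (complex_of_real (exp (- (c * norm (\<omega> - z))\<^sup>2 / 2)) * iexp (\<omega> \<bullet> (\<zeta> - \<xi>)))) =
      (\<lambda>\<omega>. complex_of_real (?f \<omega>))"
    unfolding of_real_mult[of "exp _"] expsum_norm_sq sum_distrib_left by (simp only: mult.left_commute)
  finally have B: "has_bochner_integral lborel (\<lambda>\<omega>. complex_of_real (?f \<omega>)) (\<Sum>\<xi>\<in>\<Xi>. \<Sum>\<zeta>\<in>\<Xi>. ?w \<xi> \<zeta>)" .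
  then have Bi: "integrable lborel (\<lambda>\<omega>. complex_of_real (?f \<omega>))"
    and Bv: "(LINT \<omega>|lborel. complex_of_real (?f \<omega>)) = (\<Sum>\<xi>\<in>\<Xi>. \<Sum>\<zeta>\<in>\<Xi>. ?w \<xi> \<zeta>)"
    by (simp_all only: has_bochner_integral_iff)
  show int: "integrable lborel ?f" using integrable_Re[OF Bi] by simp
  have "complex_of_real (LINT \<omega>|lborel. ?f \<omega>) = (\<Sum>\<xi>\<in>\<Xi>. \<Sum>\<zeta>\<in>\<Xi>. ?w \<xi> \<zeta>)"
    using Bv by (simp only: integral_complex_of_real)
  also have "\<dots> = (\<Sum>\<xi>\<in>\<Xi>. complex_of_real (P * (a \<xi>)\<^sup>2) + (\<Sum>\<zeta>\<in>\<Xi> - {\<xi>}. ?w \<xi> \<zeta>))"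
  proof (intro sum.cong refl)
    fix \<xi> assume "\<xi> \<in> \<Xi>"
    then have "(\<Sum>\<zeta>\<in>\<Xi>. ?w \<xi> \<zeta>) = ?w \<xi> \<xi> + (\<Sum>\<zeta>\<in>\<Xi> - {\<xi>}. ?w \<xi> \<zeta>)"
      by (rule sum.remove[OF \<Xi>])
    also have "?w \<xi> \<xi> = complex_of_real (P * (a \<xi>)\<^sup>2)"
      by (simp add: power2_eq_square)
    finally show "(\<Sum>\<zeta>\<in>\<Xi>. ?w \<xi> \<zeta>) = complex_of_real (P * (a \<xi>)\<^sup>2) + (\<Sum>\<zeta>\<in>\<Xi> - {\<xi>}. ?w \<xi> \<zeta>)" .
  qed
  also have "\<dots> = complex_of_real (P * S) + (\<Sum>\<xi>\<in>\<Xi>. \<Sum>\<zeta>\<in>\<Xi> - {\<xi>}. ?w \<xi> \<zeta>)"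
    unfolding sum.distrib S_def sum_distrib_left of_real_sum ..
  finally have f: "complex_of_real (LINT \<omega>|lborel. ?f \<omega>) = complex_of_real (P * S) + (\<Sum>\<xi>\<in>\<Xi>. \<Sum>\<zeta>\<in>\<Xi> - {\<xi>}. ?w \<xi> \<zeta>)" .
  have "complex_of_real ((LINT \<omega>|lborel. ?f \<omega>) - P * S) = (\<Sum>\<xi>\<in>\<Xi>. \<Sum>\<zeta>\<in>\<Xi> - {\<xi>}. ?w \<xi> \<zeta>)"
    unfolding of_real_diff f by (rule add_diff_cancel_left')
  from arg_cong[OF this, of cmod] have "\<bar>(LINT \<omega>|lborel. ?f \<omega>) - P * S\<bar> = cmod (\<Sum>\<xi>\<in>\<Xi>. \<Sum>\<zeta>\<in>\<Xi> - {\<xi>}. ?w \<xi> \<zeta>)"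
    unfolding norm_of_real .
  also have "\<dots> \<le> (\<Sum>\<xi>\<in>\<Xi>. \<Sum>\<zeta>\<in>\<Xi> - {\<xi>}. P * ((a \<xi>)\<^sup>2 / 2 * ?e \<xi> \<zeta> + (a \<zeta>)\<^sup>2 / 2 * ?e \<xi> \<zeta>))"
  proof (intro order_trans[OF norm_sum] sum_mono)
    fix \<xi> \<zeta>
    \<comment> \<open>The arithmetic-geometric mean inequality splits each mixed product into two
      squares; by symmetry of the kernel both halves then have the same sum.\<close>
    have "0 \<le> (\<bar>a \<xi>\<bar> - \<bar>a \<zeta>\<bar>)\<^sup>2" by simp
    then have "\<bar>a \<xi>\<bar> * \<bar>a \<zeta>\<bar> \<le> (a \<xi>)\<^sup>2 / 2 + (a \<zeta>)\<^sup>2 / 2" by (simp add: power2_diff)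
    then have "(\<bar>a \<xi>\<bar> * \<bar>a \<zeta>\<bar>) * (P * ?e \<xi> \<zeta>) \<le> ((a \<xi>)\<^sup>2 / 2 + (a \<zeta>)\<^sup>2 / 2) * (P * ?e \<xi> \<zeta>)"
      using P by (intro mult_right_mono) auto
    moreover have "cmod (?w \<xi> \<zeta>) = (\<bar>a \<xi>\<bar> * \<bar>a \<zeta>\<bar>) * (P * ?e \<xi> \<zeta>)"
      using P by (simp add: norm_mult abs_mult)
    ultimately show "cmod (?w \<xi> \<zeta>) \<le> P * ((a \<xi>)\<^sup>2 / 2 * ?e \<xi> \<zeta> + (a \<zeta>)\<^sup>2 / 2 * ?e \<xi> \<zeta>)"
      by (simp only: algebra_simps)
  qed
  also have "\<dots> = P * ((\<Sum>\<xi>\<in>\<Xi>. \<Sum>\<zeta>\<in>\<Xi> - {\<xi>}. (a \<xi>)\<^sup>2 / 2 * ?e \<xi> \<zeta>) + (\<Sum>\<xi>\<in>\<Xi>. \<Sum>\<zeta>\<in>\<Xi> - {\<xi>}. (a \<zeta>)\<^sup>2 / 2 * ?e \<xi> \<zeta>))"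
    by (simp only: sum_distrib_left sum.distrib distrib_left)
  also have "(\<Sum>\<xi>\<in>\<Xi>. \<Sum>\<zeta>\<in>\<Xi> - {\<xi>}. (a \<zeta>)\<^sup>2 / 2 * ?e \<xi> \<zeta>) = (\<Sum>\<xi>\<in>\<Xi>. \<Sum>\<zeta>\<in>\<Xi> - {\<xi>}. (a \<xi>)\<^sup>2 / 2 * ?e \<xi> \<zeta>)"
  proof -
    have "(\<Sum>\<xi>\<in>\<Xi>. \<Sum>\<zeta>\<in>\<Xi> - {\<xi>}. (a \<zeta>)\<^sup>2 / 2 * ?e \<xi> \<zeta>) = (\<Sum>\<xi>\<in>\<Xi>. \<Sum>\<zeta>\<in>{\<zeta>\<in>\<Xi>. \<xi> \<noteq> \<zeta>}. (a \<zeta>)\<^sup>2 / 2 * ?e \<xi> \<zeta>)"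
      by (intro sum.cong) auto
    also have "\<dots> = (\<Sum>\<zeta>\<in>\<Xi>. \<Sum>\<xi>\<in>{\<xi>\<in>\<Xi>. \<xi> \<noteq> \<zeta>}. (a \<zeta>)\<^sup>2 / 2 * ?e \<xi> \<zeta>)"
      by (rule sum.swap_restrict[OF \<Xi> \<Xi>])
    also have "\<dots> = (\<Sum>\<xi>\<in>\<Xi>. \<Sum>\<zeta>\<in>\<Xi> - {\<xi>}. (a \<xi>)\<^sup>2 / 2 * ?e \<xi> \<zeta>)"
      by (intro sum.cong) (auto simp: norm_minus_commute)
    finally show ?thesis .
  qed
  also have "P * ((\<Sum>\<xi>\<in>\<Xi>. \<Sum>\<zeta>\<in>\<Xi> - {\<xi>}. (a \<xi>)\<^sup>2 / 2 * ?e \<xi> \<zeta>) + (\<Sum>\<xi>\<in>\<Xi>. \<Sum>\<zeta>\<in>\<Xi> - {\<xi>}. (a \<xi>)\<^sup>2 / 2 * ?e \<xi> \<zeta>)) =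
      P * (\<Sum>\<xi>\<in>\<Xi>. (a \<xi>)\<^sup>2 * (\<Sum>\<zeta>\<in>\<Xi> - {\<xi>}. ?e \<xi> \<zeta>))"
    unfolding sum.distrib[symmetric] sum_distrib_left distrib_right[symmetric] by simp
  also have "\<dots> \<le> P * (\<Sum>\<xi>\<in>\<Xi>. (a \<xi>)\<^sup>2 * \<theta>)"
    using P by (intro mult_left_mono sum_mono \<theta>) auto
  also have "\<dots> = P * \<theta> * S" unfolding S_def sum_distrib_right[symmetric] by simp
  finally show "\<bar>(LINT \<omega>|lborel. ?f \<omega>) - P * S\<bar> \<le> P * \<theta> * S" .
qed

text \<open>The balls of radius 1 around the points are disjoint, which compares the sum with a Gaussian integral.\<close>

lemma separated_gaussian_sum:
  "\<exists>c0>0. \<forall>c. 0 < c \<longrightarrow> c \<le> c0 \<longrightarrow> (\<forall>(\<Xi> :: (real ^ 'n::finite) set). finite \<Xi> \<longrightarrow>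
     (\<forall>\<xi>\<in>\<Xi>. \<forall>\<zeta>\<in>\<Xi>. \<xi> \<noteq> \<zeta> \<longrightarrow> 2 \<le> dist \<xi> \<zeta>) \<longrightarrow>
     (\<forall>\<xi>\<in>\<Xi>. (\<Sum>\<zeta>\<in>\<Xi> - {\<xi>}. exp (- (norm (\<zeta> - \<xi>) / c)\<^sup>2 / 2)) \<le> 1 / 2))"
proof -
  \<comment> \<open>With r = |\<zeta> - \<xi>| >= 2, the unit ball around \<zeta> lies within 3r/2
    of \<xi>, and this \<open>b\<close> makes (b |y - \<xi>|)^2 / 2 at most r^2/4. The exponent
    r^2/(2c^2) is halved: one half pays for this Gaussian, the other for 1/c^2.\<close>
  define b where "b = sqrt 2 / 3"
  define M where "M = (2 * pi) powr (real CARD('n) / 2) / b ^ CARD('n)"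
  define V where "V = unit_ball_vol (real CARD('n))"
  have b: "b > 0" by (simp add: b_def)
  have M: "M > 0" using b by (simp add: M_def)
  have V: "V > 0" by (simp add: V_def)
  have Vx: "measure lborel (ball x 1) = V" for x :: "real ^ 'n"
    using content_ball[of 1 x] by (simp add: V_def)
  \<comment> \<open>The bound by 1 is for the halving of the exponent; the square root gives
    \<open>c\<^sup>2 * M \<le> V / 2\<close>, which suffices because exp (-1/c^2) <= c^2.\<close>
  define c0 where "c0 = min 1 (sqrt (V / (2 * M)))"
  have c0: "c0 > 0" using M V by (simp add: c0_def)
  have main: "(\<Sum>\<zeta>\<in>\<Xi> - {\<xi>}. exp (- (norm (\<zeta> - \<xi>) / c)\<^sup>2 / 2)) \<le> 1 / 2"
    if c: "0 < c" "c \<le> c0" and \<Xi>: "finite \<Xi>"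
      and sep: "\<And>\<xi> \<zeta>. \<xi> \<in> \<Xi> \<Longrightarrow> \<zeta> \<in> \<Xi> \<Longrightarrow> \<xi> \<noteq> \<zeta> \<Longrightarrow> 2 \<le> dist \<xi> \<zeta>" and \<xi>: "\<xi> \<in> \<Xi>"
    for c and \<Xi> :: "(real ^ 'n) set" and \<xi>
  proof -
    have c1: "c \<le> 1" and c2: "c\<^sup>2 \<le> V / (2 * M)"
    proof -
      show "c \<le> 1" using c by (simp add: c0_def)
      have "c \<le> sqrt (V / (2 * M))" using c by (simp add: c0_def)
      then have "c\<^sup>2 \<le> (sqrt (V / (2 * M)))\<^sup>2" using c(1) by (intro power_mono) auto
      then show "c\<^sup>2 \<le> V / (2 * M)" using M V by simp
    qed
    define g where "g y = exp (- (b * norm (y - \<xi>))\<^sup>2 / 2)" for y :: "real ^ 'n"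
    have "has_bochner_integral lborel (\<lambda>y. complex_of_real (g y)) (complex_of_real M)"
      using gaussian_fourier[OF b, of \<xi> 0] by (simp add: g_def M_def)
    then have gi: "integrable lborel g" and gv: "integral\<^sup>L lborel g = M"
      by (auto simp: has_bochner_integral_iff dest: integrable_Re)
    have g0: "g y \<ge> 0" for y by (simp add: g_def)
    have [measurable]: "g \<in> borel_measurable borel" using gi by auto
    have indi: "integrable lborel (\<lambda>y. indicat_real (ball \<zeta> 1) y * g y)" for \<zeta>
      using gi by (intro Bochner_Integration.integrable_bound[OF gi]) (auto simp: indicator_def)
    have termwise: "exp (- (norm (\<zeta> - \<xi>) / c)\<^sup>2 / 2) * V \<le> exp (- 1 / c\<^sup>2) * (LINT y|lborel. indicat_real (ball \<zeta> 1) y * g y)"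
      if \<zeta>: "\<zeta> \<in> \<Xi> - {\<xi>}" for \<zeta>
    proof -
      let ?r = "norm (\<zeta> - \<xi>)"
      have r: "2 \<le> ?r" using sep[of \<zeta> \<xi>] \<zeta> \<xi> by (auto simp: dist_norm)
      have pt: "exp (- (?r / c)\<^sup>2 / 2) * indicat_real (ball \<zeta> 1) y \<le> exp (- 1 / c\<^sup>2) * (indicat_real (ball \<zeta> 1) y * g y)" for y
      proof (cases "y \<in> ball \<zeta> 1")
        case True
        have "norm (y - \<xi>) \<le> norm (y - \<zeta>) + ?r" using norm_triangle_ineq[of "y - \<zeta>" "\<zeta> - \<xi>"] by simp
        also have "norm (y - \<zeta>) \<le> 1" using True by (simp add: dist_norm norm_minus_commute)
        finally have "norm (y - \<xi>) \<le> 3 / 2 * ?r" using r by simp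
        then have "(norm (y - \<xi>))\<^sup>2 \<le> (3 / 2 * ?r)\<^sup>2" by (intro power_mono) auto
        then have n: "(norm (y - \<xi>))\<^sup>2 \<le> 9 / 4 * ?r\<^sup>2" by (simp add: power_mult_distrib power2_eq_square)
        have r4: "4 \<le> ?r\<^sup>2" using power_mono[OF r, of 2] by simp
        have cc: "c\<^sup>2 \<le> 1" using power_mono[OF c1, of 2] c(1) by simp
        have "1 / c\<^sup>2 + (b * norm (y - \<xi>))\<^sup>2 / 2 \<le> 1 / c\<^sup>2 + ?r\<^sup>2 / 4"
          using n by (simp add: b_def power_mult_distrib power_divide)
        also have "\<dots> \<le> ?r\<^sup>2 / 4 / c\<^sup>2 + ?r\<^sup>2 / 4 / c\<^sup>2"
        proof (rule add_mono)
          show "1 / c\<^sup>2 \<le> ?r\<^sup>2 / 4 / c\<^sup>2" using r4 c(1) by (intro divide_right_mono) auto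
          show "?r\<^sup>2 / 4 \<le> ?r\<^sup>2 / 4 / c\<^sup>2"
            using cc c(1) by (simp add: pos_le_divide_eq mult_left_le)
        qed
        also have "\<dots> = (?r / c)\<^sup>2 / 2" by (simp add: power_divide)
        finally have "exp (- (?r / c)\<^sup>2 / 2) \<le> exp (- 1 / c\<^sup>2 + - (b * norm (y - \<xi>))\<^sup>2 / 2)" by simp
        then show ?thesis using True unfolding exp_add g_def by simp
      qed simp
      have "exp (- (?r / c)\<^sup>2 / 2) * V = (LINT y|lborel. exp (- (?r / c)\<^sup>2 / 2) * indicat_real (ball \<zeta> 1) y)"
        using Vx[of \<zeta>] by simp
      also have "\<dots> \<le> (LINT y|lborel. exp (- 1 / c\<^sup>2) * (indicat_real (ball \<zeta> 1) y * g y))"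
        by (intro integral_mono pt integrable_mult_right indi integrable_real_indicator)
           (auto simp: emeasure_ball)
      finally show ?thesis by simp
    qed
    have disj: "(\<Sum>\<zeta>\<in>\<Xi> - {\<xi>}. indicat_real (ball \<zeta> 1) y) \<le> 1" for y
    proof (cases "\<exists>\<zeta>\<in>\<Xi> - {\<xi>}. y \<in> ball \<zeta> 1")
      case True
      then obtain \<zeta> where \<zeta>: "\<zeta> \<in> \<Xi> - {\<xi>}" "y \<in> ball \<zeta> 1" by blast
      have "indicat_real (ball \<zeta>' 1) y = 0" if "\<zeta>' \<in> \<Xi> - {\<xi>} - {\<zeta>}" for \<zeta>'
      proof -
        have "2 \<le> dist \<zeta> \<zeta>'" using that \<zeta> by (intro sep) auto
        then have "y \<notin> ball \<zeta>' 1" using \<zeta>(2) dist_triangle2[of \<zeta> \<zeta>' y] by auto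
        then show ?thesis by simp
      qed
      then have "(\<Sum>\<zeta>\<in>\<Xi> - {\<xi>}. indicat_real (ball \<zeta> 1) y) = indicat_real (ball \<zeta> 1) y"
        using \<Xi> \<zeta>(1) by (subst sum.remove[of _ \<zeta>]) auto
      then show ?thesis by (simp add: indicator_def)
    next
      case False
      then have "(\<Sum>\<zeta>\<in>\<Xi> - {\<xi>}. indicat_real (ball \<zeta> 1) y) = 0" by (intro sum.neutral) auto
      then show ?thesis by simp
    qed
    have "(\<Sum>\<zeta>\<in>\<Xi> - {\<xi>}. exp (- (norm (\<zeta> - \<xi>) / c)\<^sup>2 / 2)) * V \<le>
        (\<Sum>\<zeta>\<in>\<Xi> - {\<xi>}. exp (- 1 / c\<^sup>2) * (LINT y|lborel. indicat_real (ball \<zeta> 1) y * g y))"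
      unfolding sum_distrib_right by (intro sum_mono termwise)
    also have "\<dots> = exp (- 1 / c\<^sup>2) * (LINT y|lborel. (\<Sum>\<zeta>\<in>\<Xi> - {\<xi>}. indicat_real (ball \<zeta> 1) y) * g y)"
      unfolding sum_distrib_left[symmetric] sum_distrib_right
      by (subst Bochner_Integration.integral_sum) (auto intro: indi)
    also have "(LINT y|lborel. (\<Sum>\<zeta>\<in>\<Xi> - {\<xi>}. indicat_real (ball \<zeta> 1) y) * g y) \<le> (LINT y|lborel. g y)"
      using disj g0 by (intro integral_mono gi)
        (auto simp: sum_distrib_right intro!: Bochner_Integration.integrable_sum indi mult_left_le_one_le sum_nonneg, auto simp flip: sum_distrib_right intro!: mult_left_le_one_le sum_nonneg)
    also have "(LINT y|lborel. g y) = M" by (rule gv)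
    finally have "(\<Sum>\<zeta>\<in>\<Xi> - {\<xi>}. exp (- (norm (\<zeta> - \<xi>) / c)\<^sup>2 / 2)) * V \<le> exp (- 1 / c\<^sup>2) * M"
      by simp
    also have "exp (- 1 / c\<^sup>2) * M \<le> c\<^sup>2 * M"
    proof (rule mult_right_mono)
      have "1 / c\<^sup>2 \<le> exp (1 / c\<^sup>2)" using exp_ge_add_one_self[of "1 / c\<^sup>2"] by linarith
      then show "exp (- 1 / c\<^sup>2) \<le> c\<^sup>2"
        using c(1) by (simp add: exp_minus field_simps)
    qed (use M in simp)
    also have "c\<^sup>2 * M \<le> (1 / 2) * V" using c2 M by (simp add: field_simps)
    finally show ?thesis using V by (rule mult_right_le_imp_le)
  qed
  show ?thesis
    by (rule exI[of _ c0], intro conjI c0 allI impI ballI, rule main) (assumption | drule (1) bspec | blast)+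
qed

text \<open>Row sums of 1/2 keep the energy within half of its diagonal value on either side. As
  nonnegative integrals the energies can be split and interchanged without integrability
  conditions.\<close>

lemma nn_integral_gauss_expsum:
  fixes \<Xi> :: "(real ^ 'n::finite) set" and z :: "real ^ 'n" and a :: "real ^ 'n \<Rightarrow> real"
  assumes c: "c > 0" and \<Xi>: "finite \<Xi>"
    and \<theta>: "\<And>\<xi>. \<xi> \<in> \<Xi> \<Longrightarrow> (\<Sum>\<zeta>\<in>\<Xi> - {\<xi>}. exp (- (norm (\<zeta> - \<xi>) / c)\<^sup>2 / 2)) \<le> 1 / 2"
  defines "P \<equiv> (2 * pi) powr (real CARD('n) / 2) / c ^ CARD('n)"
    and "S \<equiv> \<Sum>\<xi>\<in>\<Xi>. (a \<xi>)\<^sup>2"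
  defines "K \<equiv> \<integral>\<^sup>+\<omega>. ennreal (exp (- (c * norm (\<omega> - z))\<^sup>2 / 2) * (cmod (expsum \<Xi> a \<omega>))\<^sup>2) \<partial>lborel"
  shows "ennreal (P * S / 2) \<le> K" "K \<le> ennreal (3 / 2 * P * S)"
proof -
  note g = gaussian_expsum_energy[OF c \<Xi> \<theta>, where a = a and z = z]
  have K: "K = ennreal (LINT \<omega>|lborel. exp (- (c * norm (\<omega> - z))\<^sup>2 / 2) * (cmod (expsum \<Xi> a \<omega>))\<^sup>2)"
    unfolding K_def by (rule nn_integral_eq_integral[OF g(1)]) auto
  define k where "k = (LINT \<omega>|lborel. exp (- (c * norm (\<omega> - z))\<^sup>2 / 2) * (cmod (expsum \<Xi> a \<omega>))\<^sup>2)"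
  have "\<bar>k - P * S\<bar> \<le> P * (1 / 2) * S"
    unfolding k_def P_def S_def by (rule g(2))
  then have "\<bar>k - P * S\<bar> \<le> P * S / 2" by simp
  then have "P * S / 2 \<le> k" "k \<le> 3 / 2 * (P * S)" by linarith+
  then show "ennreal (P * S / 2) \<le> K" "K \<le> ennreal (3 / 2 * P * S)"
    unfolding K k_def[symmetric] mult.assoc by (intro ennreal_leI; simp only:)+
qed

text \<open>High frequencies are dominated by low ones: both sides are comparable to the sum of the
  squared coefficients, which every sufficiently wide Gaussian average of the energy detects.\<close>

lemma expsum_tail_energy:
  fixes p R0 :: real
  assumes p: "p > real CARD('n::finite)"
  shows "\<exists>R\<ge>R0. \<exists>C\<ge>0. \<forall>\<Xi> (a :: real ^ 'n \<Rightarrow> real). finite \<Xi> \<longrightarrow>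
     (\<forall>\<xi>\<in>\<Xi>. \<forall>\<zeta>\<in>\<Xi>. \<xi> \<noteq> \<zeta> \<longrightarrow> 2 \<le> dist \<xi> \<zeta>) \<longrightarrow>
     (\<integral>\<^sup>+\<eta>. ennreal (norm \<eta> powr (- p) * (cmod (expsum \<Xi> a \<eta>))\<^sup>2) * indicator {\<eta>. norm \<eta> > R} \<eta> \<partial>lborel) \<le>
     ennreal C * (\<integral>\<^sup>+\<eta>. ennreal ((cmod (expsum \<Xi> a \<eta>))\<^sup>2) * indicator {\<eta>. norm \<eta> \<le> R} \<eta> \<partial>lborel)"
proof -
  obtain c where c: "c > 0" and sepc: "\<And>c' (\<Xi> :: (real ^ 'n) set) \<xi>. 0 < c' \<Longrightarrow> c' \<le> c \<Longrightarrow> finite \<Xi> \<Longrightarrow>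
      (\<forall>\<xi>\<in>\<Xi>. \<forall>\<zeta>\<in>\<Xi>. \<xi> \<noteq> \<zeta> \<longrightarrow> 2 \<le> dist \<xi> \<zeta>) \<Longrightarrow> \<xi> \<in> \<Xi> \<Longrightarrow>
      (\<Sum>\<zeta>\<in>\<Xi> - {\<xi>}. exp (- (norm (\<zeta> - \<xi>) / c')\<^sup>2 / 2)) \<le> 1 / 2"
    using separated_gaussian_sum[where 'n = 'n] by metis
  \<comment> \<open>The Gaussian of parameter \<open>c\<close> is the square of that of parameter
    \<open>c'\<close>. Beyond \<open>R\<close> one factor is at most exp (-(c R)^2 / 4), and the
    other is again an admissible Gaussian because \<open>c' \<le> c\<close>.\<close>
  define c' where "c' = c / sqrt 2"
  have c': "0 < c'" "c' \<le> c" using c by (auto simp: c'_def divide_le_eq)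
  define P where "P = (2 * pi) powr (real CARD('n) / 2) / c ^ CARD('n)"
  define P' where "P' = (2 * pi) powr (real CARD('n) / 2) / c' ^ CARD('n)"
  have P: "P > 0" "P' > 0" using c c' by (auto simp: P_def P'_def)
  define V where "V = unit_ball_vol (real CARD('n))"
  have V: "V > 0" by (simp add: V_def)
  define J where "J = (LINT z|lborel. (1 + norm (z :: real ^ 'n)) powr (- p))"
  have Ji: "integrable lborel (\<lambda>z :: real ^ 'n. (1 + norm z) powr (- p))"
    by (rule integrable_japanese_bracket) (use p in simp)
  have J: "J \<ge> 0" unfolding J_def by (rule integral_nonneg_AE) simp
  \<comment> \<open>The Gaussian energy beyond \<open>R\<close> is at most exp (-(c R)^2 / 4) times
    3/2 P' S. It has to stay below P S / 4, half of the lower bound P S / 2; since exp t >= t, it is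
    enough that (c R)^2 / 4 >= 6 P'/P, which determines \<open>R\<close>.\<close>
  define x where "x = 6 * P' / P"
  have x: "x > 0" using P by (simp add: x_def)
  define R where "R = max (max R0 1) (2 / c * sqrt x)"
  have R: "R \<ge> R0" "R \<ge> 1" by (auto simp: R_def)
  have tailfac: "exp (- (c * R)\<^sup>2 / 4) * (3 / 2 * P') \<le> P / 4"
  proof -
    have "2 * sqrt x \<le> c * R"
    proof -
      have "2 / c * sqrt x \<le> R" by (simp add: R_def)
      then show ?thesis using c by (simp add: field_simps)
    qed
    then have "(2 * sqrt x)\<^sup>2 \<le> (c * R)\<^sup>2" using x by (intro power_mono) auto
    then have "x \<le> (c * R)\<^sup>2 / 4" using x by (simp add: power_mult_distrib)
    also have "\<dots> \<le> exp ((c * R)\<^sup>2 / 4)" using exp_ge_add_one_self[of "(c * R)\<^sup>2 / 4"] by linarith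
    finally have "exp (- (c * R)\<^sup>2 / 4) * x \<le> exp (- (c * R)\<^sup>2 / 4) * exp ((c * R)\<^sup>2 / 4)"
      by (rule mult_left_mono) simp
    also have "\<dots> = 1" by (simp add: exp_add[symmetric])
    finally have "exp (- (c * R)\<^sup>2 / 4) * x \<le> 1" .
    from mult_right_mono[OF this, of "P / 4"] show ?thesis using P by (simp add: x_def field_simps)
  qed
  define D where "D = 4 powr p * exp (c\<^sup>2 / 2) / V"
  have D: "D \<ge> 0" using V by (simp add: D_def)
  \<comment> \<open>Trades the power weight for a superposition of Gaussians with centres
    \<open>z\<close> and integrable density. The unit ball around \<eta> alone contributes a
    multiple of the weight: \<open>D\<close> collects its volume, the smallest value of the Gaussian
    on it and the factor 4 in 1 + |z| <= 4 |\<eta>|.\<close>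
  have weight: "ennreal (norm \<eta> powr (- p)) \<le>
      ennreal D * (\<integral>\<^sup>+z. ennreal ((1 + norm z) powr (- p) * exp (- (c * norm (\<eta> - z))\<^sup>2 / 2)) \<partial>lborel)"
    if \<eta>: "norm \<eta> > R" for \<eta> :: "real ^ 'n"
  proof -
    let ?m = "4 powr (- p) * norm \<eta> powr (- p) * exp (- c\<^sup>2 / 2)"
    have pp: "p > 0" using p by (rule order_le_less_trans[rotated]) simp
    have n1: "norm \<eta> > 1" using \<eta> R by linarith
    have "ennreal (?m * V) = (\<integral>\<^sup>+z. ennreal ?m * indicator (ball \<eta> 1) z \<partial>lborel)"
      using emeasure_ball[of 1 \<eta>] V by (subst nn_integral_cmult_indicator) (simp_all add: V_def ennreal_mult' )
    also have "\<dots> \<le> (\<integral>\<^sup>+z. ennreal ((1 + norm z) powr (- p) * exp (- (c * norm (\<eta> - z))\<^sup>2 / 2)) \<partial>lborel)"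
    proof (rule nn_integral_mono)
      fix z :: "real ^ 'n"
      show "ennreal ?m * indicator (ball \<eta> 1) z \<le> ennreal ((1 + norm z) powr (- p) * exp (- (c * norm (\<eta> - z))\<^sup>2 / 2))"
      proof (cases "z \<in> ball \<eta> 1")
        case True
        then have nz: "norm (\<eta> - z) \<le> 1" by (simp add: dist_norm)
        have "norm z \<le> norm \<eta> + norm (\<eta> - z)" using norm_triangle_ineq2[of z \<eta>] by (simp add: norm_minus_commute)
        then have "1 + norm z \<le> 4 * norm \<eta>" using nz n1 by linarith
        then have "(4 * norm \<eta>) powr (- p) \<le> (1 + norm z) powr (- p)"
          using pp by (intro powr_mono2') (auto simp: add_pos_nonneg)
        then have 1: "4 powr (- p) * norm \<eta> powr (- p) \<le> (1 + norm z) powr (- p)" by (simp add: powr_mult)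
        have "(c * norm (\<eta> - z))\<^sup>2 \<le> (c * 1)\<^sup>2" using nz c by (intro power_mono mult_left_mono) auto
        then have 2: "exp (- c\<^sup>2 / 2) \<le> exp (- (c * norm (\<eta> - z))\<^sup>2 / 2)" by simp
        show ?thesis using mult_mono[OF 1 2] True by (simp add: ennreal_leI)
      qed simp
    qed
    finally have m: "ennreal (?m * V) \<le> (\<integral>\<^sup>+z. ennreal ((1 + norm z) powr (- p) * exp (- (c * norm (\<eta> - z))\<^sup>2 / 2)) \<partial>lborel)" .
    have "norm \<eta> powr (- p) = D * (?m * V)"
      using V by (simp add: D_def powr_minus exp_minus field_simps)
    then have "ennreal (norm \<eta> powr (- p)) = ennreal D * ennreal (?m * V)"
      using D V by (simp add: ennreal_mult'[symmetric])
    also have "\<dots> \<le> ennreal D * (\<integral>\<^sup>+z. ennreal ((1 + norm z) powr (- p) * exp (- (c * norm (\<eta> - z))\<^sup>2 / 2)) \<partial>lborel)"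
      by (intro mult_left_mono m) simp
    finally show ?thesis .
  qed
  \<comment> \<open>Each centre contributes at most 3/2 P S, and low frequencies carry at least P S
    / 4; the quotient of the two is 6.\<close>
  define C where "C = 6 * D * J"
  have "(\<integral>\<^sup>+\<eta>. ennreal (norm \<eta> powr (- p) * (cmod (expsum \<Xi> a \<eta>))\<^sup>2) * indicator {\<eta>. norm \<eta> > R} \<eta> \<partial>lborel) \<le>
     ennreal C * (\<integral>\<^sup>+\<eta>. ennreal ((cmod (expsum \<Xi> a \<eta>))\<^sup>2) * indicator {\<eta>. norm \<eta> \<le> R} \<eta> \<partial>lborel)"
    if \<Xi>: "finite \<Xi>" and sep: "\<forall>\<xi>\<in>\<Xi>. \<forall>\<zeta>\<in>\<Xi>. \<xi> \<noteq> \<zeta> \<longrightarrow> 2 \<le> dist \<xi> \<zeta>" for \<Xi> and a :: "real ^ 'n \<Rightarrow> real"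
  proof -
    define E where "E \<eta> = (cmod (expsum \<Xi> a \<eta>))\<^sup>2" for \<eta>
    have E0: "E \<eta> \<ge> 0" for \<eta> by (simp add: E_def)
    note expsum_measurable[OF \<Xi>, measurable]
    have Em [measurable]: "E \<in> borel_measurable borel" unfolding E_def by measurable
    define S where "S = (\<Sum>\<xi>\<in>\<Xi>. (a \<xi>)\<^sup>2)"
    have S: "S \<ge> 0" unfolding S_def by (intro sum_nonneg) simp
    note th = sepc[OF c order_refl \<Xi> sep] and th' = sepc[OF c' \<Xi> sep]
    define X where "X = (\<integral>\<^sup>+\<eta>. ennreal (E \<eta>) * indicator {\<eta>. norm \<eta> \<le> R} \<eta> \<partial>lborel)"
    have low: "ennreal (P * S / 4) \<le> X"
    proof -
      have "ennreal (P * S / 2) \<le> (\<integral>\<^sup>+\<omega>. ennreal (exp (- (c * norm (\<omega> - 0))\<^sup>2 / 2) * E \<omega>) \<partial>lborel)"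
        unfolding P_def S_def E_def by (rule nn_integral_gauss_expsum(1)[OF c \<Xi> th])
      also have "\<dots> \<le> (\<integral>\<^sup>+\<omega>. ennreal (E \<omega>) * indicator {\<eta>. norm \<eta> \<le> R} \<omega> +
          ennreal (exp (- (c * R)\<^sup>2 / 4)) * ennreal (exp (- (c' * norm (\<omega> - 0))\<^sup>2 / 2) * E \<omega>) \<partial>lborel)"
      proof (rule nn_integral_mono)
        fix \<omega> :: "real ^ 'n"
        show "ennreal (exp (- (c * norm (\<omega> - 0))\<^sup>2 / 2) * E \<omega>) \<le> ennreal (E \<omega>) * indicator {\<eta>. norm \<eta> \<le> R} \<omega> +
          ennreal (exp (- (c * R)\<^sup>2 / 4)) * ennreal (exp (- (c' * norm (\<omega> - 0))\<^sup>2 / 2) * E \<omega>)"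
        proof (cases "norm \<omega> \<le> R")
          case True
          have "ennreal (exp (- (c * norm (\<omega> - 0))\<^sup>2 / 2) * E \<omega>) \<le> ennreal (E \<omega>)"
            using E0 by (intro ennreal_leI mult_left_le_one_le) auto
          also have "\<dots> \<le> ennreal (E \<omega>) + ennreal (exp (- (c * R)\<^sup>2 / 4)) * ennreal (exp (- (c' * norm (\<omega> - 0))\<^sup>2 / 2) * E \<omega>)"
            by simp
          finally show ?thesis using True by simp
        next
          case False
          have "(c * R)\<^sup>2 \<le> (c * norm \<omega>)\<^sup>2"
            using False c R by (intro power_mono mult_left_mono mult_nonneg_nonneg) auto
          moreover have "(c' * norm \<omega>)\<^sup>2 = (c * norm \<omega>)\<^sup>2 / 2"
            by (simp add: c'_def power_mult_distrib power_divide)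
          ultimately have "exp (- (c * norm \<omega>)\<^sup>2 / 2) \<le> exp (- (c * R)\<^sup>2 / 4 + - (c' * norm \<omega>)\<^sup>2 / 2)" by simp
          then have "exp (- (c * norm \<omega>)\<^sup>2 / 2) * E \<omega> \<le> exp (- (c * R)\<^sup>2 / 4) * (exp (- (c' * norm \<omega>)\<^sup>2 / 2) * E \<omega>)"
            unfolding exp_add mult.assoc[symmetric] by (rule mult_right_mono) (rule E0)
          then show ?thesis using False by (simp add: ennreal_mult'[symmetric] E0 ennreal_leI)
        qed
      qed
      also have "\<dots> = X + ennreal (exp (- (c * R)\<^sup>2 / 4)) * (\<integral>\<^sup>+\<omega>. ennreal (exp (- (c' * norm (\<omega> - 0))\<^sup>2 / 2) * E \<omega>) \<partial>lborel)"
        unfolding X_def by (subst nn_integral_add) (simp_all add: nn_integral_cmult)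
      also have "\<dots> \<le> X + ennreal (exp (- (c * R)\<^sup>2 / 4)) * ennreal (3 / 2 * P' * S)"
        unfolding P'_def S_def E_def by (intro add_left_mono mult_left_mono nn_integral_gauss_expsum(2)[OF c'(1) \<Xi> th']) simp_all
      also have "\<dots> \<le> X + ennreal (P * S / 4)"
      proof (intro add_left_mono)
        have "exp (- (c * R)\<^sup>2 / 4) * (3 / 2 * P' * S) \<le> P * S / 4"
          using mult_right_mono[OF tailfac S] by simp
        then show "ennreal (exp (- (c * R)\<^sup>2 / 4)) * ennreal (3 / 2 * P' * S) \<le> ennreal (P * S / 4)"
          using P S by (simp add: ennreal_mult'[symmetric] ennreal_leI)
      qed
      finally have le: "ennreal (P * S / 2) \<le> X + ennreal (P * S / 4)" .
      have "ennreal (P * S / 4) + ennreal (P * S / 4) = ennreal (P * S / 2)"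
        using P S by (simp add: ennreal_plus[symmetric] del: ennreal_plus)
      with le have "ennreal (P * S / 4) + ennreal (P * S / 4) \<le> X + ennreal (P * S / 4)" by simp
      then show ?thesis by (subst (asm) (1 2) add.commute) (simp add: ennreal_add_left_cancel_le)
    qed
    have "(\<integral>\<^sup>+\<eta>. ennreal (norm \<eta> powr (- p) * E \<eta>) * indicator {\<eta>. norm \<eta> > R} \<eta> \<partial>lborel) \<le>
        (\<integral>\<^sup>+\<eta>. ennreal D * (\<integral>\<^sup>+z. ennreal ((1 + norm z) powr (- p)) * ennreal (exp (- (c * norm (\<eta> - z))\<^sup>2 / 2) * E \<eta>) \<partial>lborel) \<partial>lborel)"
    proof (rule nn_integral_mono)
      fix \<eta> :: "real ^ 'n"
      have e: "(\<integral>\<^sup>+z. ennreal ((1 + norm z) powr (- p)) * ennreal (exp (- (c * norm (\<eta> - z))\<^sup>2 / 2) * E \<eta>) \<partial>lborel) =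
          (\<integral>\<^sup>+z. ennreal ((1 + norm z) powr (- p) * exp (- (c * norm (\<eta> - z))\<^sup>2 / 2)) \<partial>lborel) * ennreal (E \<eta>)"
        using E0 by (subst nn_integral_multc[symmetric]) (auto simp: ennreal_mult' mult.assoc)
      show "ennreal (norm \<eta> powr (- p) * E \<eta>) * indicator {\<eta>. norm \<eta> > R} \<eta> \<le>
          ennreal D * (\<integral>\<^sup>+z. ennreal ((1 + norm z) powr (- p)) * ennreal (exp (- (c * norm (\<eta> - z))\<^sup>2 / 2) * E \<eta>) \<partial>lborel)"
        using mult_right_mono[OF weight[of \<eta>], of "ennreal (E \<eta>)"] E0
        unfolding e by (cases "norm \<eta> > R") (simp_all add: ennreal_mult' mult.assoc)
    qed
    also have "\<dots> = ennreal D * (\<integral>\<^sup>+\<eta>. \<integral>\<^sup>+z. ennreal ((1 + norm z) powr (- p)) * ennreal (exp (- (c * norm (\<eta> - z))\<^sup>2 / 2) * E \<eta>) \<partial>lborel \<partial>lborel)"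
      by (rule nn_integral_cmult) measurable
    also have "(\<integral>\<^sup>+\<eta>. \<integral>\<^sup>+z. ennreal ((1 + norm z) powr (- p)) * ennreal (exp (- (c * norm (\<eta> - z))\<^sup>2 / 2) * E \<eta>) \<partial>lborel \<partial>lborel) =
        (\<integral>\<^sup>+z. \<integral>\<^sup>+\<eta>. ennreal ((1 + norm z) powr (- p)) * ennreal (exp (- (c * norm (\<eta> - z))\<^sup>2 / 2) * E \<eta>) \<partial>lborel \<partial>lborel)"
      by (rule lborel_pair.Fubini') measurable
    also have "\<dots> = (\<integral>\<^sup>+z. ennreal ((1 + norm z) powr (- p)) * (\<integral>\<^sup>+\<eta>. ennreal (exp (- (c * norm (\<eta> - z))\<^sup>2 / 2) * E \<eta>) \<partial>lborel) \<partial>lborel)"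
      by (intro nn_integral_cong nn_integral_cmult) measurable
    also have "\<dots> \<le> (\<integral>\<^sup>+z. ennreal ((1 + norm (z :: real ^ 'n)) powr (- p)) * ennreal (3 / 2 * P * S) \<partial>lborel)"
      unfolding P_def S_def E_def by (intro nn_integral_mono mult_left_mono nn_integral_gauss_expsum(2)[OF c \<Xi> th]) simp_all
    also have "\<dots> = ennreal J * ennreal (3 / 2 * P * S)"
      unfolding J_def using Ji by (subst nn_integral_multc) (simp_all add: nn_integral_eq_integral)
    also have "ennreal D * (ennreal J * ennreal (3 / 2 * P * S)) = ennreal C * ennreal (P * S / 4)"
      using D J P S by (simp add: C_def ennreal_mult'[symmetric] mult_nonneg_nonneg mult_ac)
    also have "\<dots> \<le> ennreal C * X" by (intro mult_left_mono low) simp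
    finally show ?thesis by (simp add: X_def E_def mult_left_mono)
  qed
  moreover have "C \<ge> 0" using D J by (simp add: C_def)
  ultimately show ?thesis using R(1) by blast
qed

section \<open>The Bernstein inequality\<close>

text \<open>Dividing the points by \<open>q\<close> makes their separation 2 and dilates the
  frequencies. The Jacobian occurs on both sides and cancels, while the weight leaves the factor
  \<open>q powr p\<close>.\<close>

lemma expsum_tail_energy_scaled:
  fixes p R0 :: real
  assumes p: "p > real CARD('n::finite)"
  shows "\<exists>R\<ge>R0. \<exists>C\<ge>0. \<forall>\<Xi> (a :: real ^ 'n \<Rightarrow> real) q. finite \<Xi> \<longrightarrow> 0 < q \<longrightarrow>
     (\<forall>\<xi>\<in>\<Xi>. \<forall>\<zeta>\<in>\<Xi>. \<xi> \<noteq> \<zeta> \<longrightarrow> 2 * q \<le> dist \<xi> \<zeta>) \<longrightarrow>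
     (\<integral>\<^sup>+\<omega>. ennreal (norm \<omega> powr (- p) * (cmod (expsum \<Xi> a \<omega>))\<^sup>2) * indicator {\<omega>. norm \<omega> > R / q} \<omega> \<partial>lborel) \<le>
     ennreal (C * q powr p) * (\<integral>\<^sup>+\<omega>. ennreal ((cmod (expsum \<Xi> a \<omega>))\<^sup>2) * indicator {\<omega>. norm \<omega> \<le> R / q} \<omega> \<partial>lborel)"
proof -
  obtain R C where R: "R \<ge> R0" and C: "C \<ge> 0"
    and tail: "\<forall>\<Xi> (a :: real ^ 'n \<Rightarrow> real). finite \<Xi> \<longrightarrow>
     (\<forall>\<xi>\<in>\<Xi>. \<forall>\<zeta>\<in>\<Xi>. \<xi> \<noteq> \<zeta> \<longrightarrow> 2 \<le> dist \<xi> \<zeta>) \<longrightarrow>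
     (\<integral>\<^sup>+\<eta>. ennreal (norm \<eta> powr (- p) * (cmod (expsum \<Xi> a \<eta>))\<^sup>2) * indicator {\<eta>. norm \<eta> > R} \<eta> \<partial>lborel) \<le>
     ennreal C * (\<integral>\<^sup>+\<eta>. ennreal ((cmod (expsum \<Xi> a \<eta>))\<^sup>2) * indicator {\<eta>. norm \<eta> \<le> R} \<eta> \<partial>lborel)"
    using expsum_tail_energy[OF p, of R0] by (elim exE conjE)
  note main = tail[THEN spec, THEN spec, THEN mp, THEN mp]
  have "(\<integral>\<^sup>+\<omega>. ennreal (norm \<omega> powr (- p) * (cmod (expsum \<Xi> a \<omega>))\<^sup>2) * indicator {\<omega>. norm \<omega> > R / q} \<omega> \<partial>lborel) \<le>
     ennreal (C * q powr p) * (\<integral>\<^sup>+\<omega>. ennreal ((cmod (expsum \<Xi> a \<omega>))\<^sup>2) * indicator {\<omega>. norm \<omega> \<le> R / q} \<omega> \<partial>lborel)"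
    if \<Xi>: "finite \<Xi>" and q: "q > 0" and sep: "\<forall>\<xi>\<in>\<Xi>. \<forall>\<zeta>\<in>\<Xi>. \<xi> \<noteq> \<zeta> \<longrightarrow> 2 * q \<le> dist \<xi> \<zeta>"
    for \<Xi> and a :: "real ^ 'n \<Rightarrow> real" and q
  proof -
    define \<Xi>' where "\<Xi>' = (\<lambda>\<xi>. (1 / q) *\<^sub>R \<xi>) ` \<Xi>"
    define a' where "a' \<xi> = a (q *\<^sub>R \<xi>)" for \<xi>
    note expsum_measurable[OF \<Xi>, measurable]
    have inj: "inj_on (\<lambda>\<xi>. (1 / q) *\<^sub>R \<xi>) \<Xi>" using q by (auto simp: inj_on_def)
    have ex: "expsum \<Xi> a (0 + (1 / q) *\<^sub>R \<eta>) = expsum \<Xi>' a' \<eta>" for \<eta>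
      unfolding expsum_def \<Xi>'_def a'_def using q by (simp add: sum.reindex[OF inj])
    have sep': "\<forall>\<xi>\<in>\<Xi>'. \<forall>\<zeta>\<in>\<Xi>'. \<xi> \<noteq> \<zeta> \<longrightarrow> 2 \<le> dist \<xi> \<zeta>"
    proof (intro ballI impI)
      fix x y assume "x \<in> \<Xi>'" "y \<in> \<Xi>'" "x \<noteq> y"
      then obtain \<xi> \<zeta> where e: "\<xi> \<in> \<Xi>" "\<zeta> \<in> \<Xi>" "\<xi> \<noteq> \<zeta>" "x = (1 / q) *\<^sub>R \<xi>" "y = (1 / q) *\<^sub>R \<zeta>"
        unfolding \<Xi>'_def by blast
      have "dist x y = dist \<xi> \<zeta> / q"
        using q unfolding e by (simp add: dist_norm scaleR_diff_right[symmetric] del: scaleR_diff_right)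
      moreover have "2 * q \<le> dist \<xi> \<zeta>" using sep e by blast
      ultimately show "2 \<le> dist x y" using q by (simp add: pos_le_divide_eq)
    qed
    let ?c = "ennreal (\<bar>1 / q\<bar> ^ DIM(real ^ 'n))"
    have n: "norm (0 + (1 / q) *\<^sub>R \<eta>) = norm \<eta> / q" for \<eta> :: "real ^ 'n" using q by simp
    have "(\<integral>\<^sup>+\<omega>. ennreal (norm \<omega> powr (- p) * (cmod (expsum \<Xi> a \<omega>))\<^sup>2) * indicator {\<omega>. norm \<omega> > R / q} \<omega> \<partial>lborel) =
        ?c * (\<integral>\<^sup>+\<eta>. ennreal (norm (0 + (1 / q) *\<^sub>R \<eta>) powr (- p) * (cmod (expsum \<Xi> a (0 + (1 / q) *\<^sub>R \<eta>)))\<^sup>2) *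
          indicator {\<omega>. norm \<omega> > R / q} (0 + (1 / q) *\<^sub>R \<eta>) \<partial>lborel)"
      using q by (intro nn_integral_lborel_affine) auto
    also have "(\<lambda>\<eta> :: real ^ 'n. ennreal (norm (0 + (1 / q) *\<^sub>R \<eta>) powr (- p) * (cmod (expsum \<Xi> a (0 + (1 / q) *\<^sub>R \<eta>)))\<^sup>2) *
          indicator {\<omega>. norm \<omega> > R / q} (0 + (1 / q) *\<^sub>R \<eta>)) =
        (\<lambda>\<eta>. ennreal (q powr p) * (ennreal (norm \<eta> powr (- p) * (cmod (expsum \<Xi>' a' \<eta>))\<^sup>2) * indicator {\<eta>. norm \<eta> > R} \<eta>))"
    proof
      fix \<eta> :: "real ^ 'n"
      have i: "indicator {\<omega>. norm \<omega> > R / q} (0 + (1 / q) *\<^sub>R \<eta>) = (indicator {\<eta>. norm \<eta> > R} \<eta> :: ennreal)"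
        using q by (auto simp: indicator_def divide_less_cancel)
      have "(norm \<eta> / q) powr (- p) = q powr p * norm \<eta> powr (- p)"
        using q by (simp add: powr_divide powr_minus field_simps)
      then have "ennreal ((norm \<eta> / q) powr (- p) * (cmod (expsum \<Xi>' a' \<eta>))\<^sup>2) =
          ennreal (q powr p) * ennreal (norm \<eta> powr (- p) * (cmod (expsum \<Xi>' a' \<eta>))\<^sup>2)"
        by (simp add: ennreal_mult'[symmetric] mult.assoc)
      then show "ennreal (norm (0 + (1 / q) *\<^sub>R \<eta>) powr (- p) * (cmod (expsum \<Xi> a (0 + (1 / q) *\<^sub>R \<eta>)))\<^sup>2) *
          indicator {\<omega>. norm \<omega> > R / q} (0 + (1 / q) *\<^sub>R \<eta>) =
          ennreal (q powr p) * (ennreal (norm \<eta> powr (- p) * (cmod (expsum \<Xi>' a' \<eta>))\<^sup>2) * indicator {\<eta>. norm \<eta> > R} \<eta>)"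
        unfolding n ex i by (simp only: mult.assoc)
    qed
    also have "(\<integral>\<^sup>+\<eta>. ennreal (q powr p) * (ennreal (norm \<eta> powr (- p) * (cmod (expsum \<Xi>' a' \<eta>))\<^sup>2) * indicator {\<eta>. norm \<eta> > R} \<eta>) \<partial>lborel) =
        ennreal (q powr p) * (\<integral>\<^sup>+\<eta>. ennreal (norm \<eta> powr (- p) * (cmod (expsum \<Xi>' a' \<eta>))\<^sup>2) * indicator {\<eta>. norm \<eta> > R} \<eta> \<partial>lborel)"
      using expsum_measurable[of \<Xi>' a'] \<Xi> by (intro nn_integral_cmult) (auto simp: \<Xi>'_def)
    also have "?c * (ennreal (q powr p) * (\<integral>\<^sup>+\<eta>. ennreal (norm \<eta> powr (- p) * (cmod (expsum \<Xi>' a' \<eta>))\<^sup>2) * indicator {\<eta>. norm \<eta> > R} \<eta> \<partial>lborel)) \<le>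
        ?c * (ennreal (q powr p) * (ennreal C * (\<integral>\<^sup>+\<eta>. ennreal ((cmod (expsum \<Xi>' a' \<eta>))\<^sup>2) * indicator {\<eta>. norm \<eta> \<le> R} \<eta> \<partial>lborel)))"
      by (intro mult_left_mono main sep') (use \<Xi> in \<open>auto simp: \<Xi>'_def\<close>)
    also have "\<dots> = ennreal (C * q powr p) * (?c * (\<integral>\<^sup>+\<eta>. ennreal ((cmod (expsum \<Xi>' a' \<eta>))\<^sup>2) * indicator {\<eta>. norm \<eta> \<le> R} \<eta> \<partial>lborel))"
      using C by (simp add: ennreal_mult' mult_ac)
    also have "(\<lambda>\<eta>. ennreal ((cmod (expsum \<Xi>' a' \<eta>))\<^sup>2) * indicator {\<eta>. norm \<eta> \<le> R} \<eta>) =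
        (\<lambda>\<eta>. ennreal ((cmod (expsum \<Xi> a (0 + (1 / q) *\<^sub>R \<eta>)))\<^sup>2) * indicator {\<omega>. norm \<omega> \<le> R / q} (0 + (1 / q) *\<^sub>R \<eta>))"
      unfolding ex using q by (intro ext) (auto simp: indicator_def divide_le_cancel)
    also have "?c * (\<integral>\<^sup>+\<eta>. ennreal ((cmod (expsum \<Xi> a (0 + (1 / q) *\<^sub>R \<eta>)))\<^sup>2) * indicator {\<omega>. norm \<omega> \<le> R / q} (0 + (1 / q) *\<^sub>R \<eta>) \<partial>lborel) =
        (\<integral>\<^sup>+\<omega>. ennreal ((cmod (expsum \<Xi> a \<omega>))\<^sup>2) * indicator {\<omega>. norm \<omega> \<le> R / q} \<omega> \<partial>lborel)"
      using q by (intro nn_integral_lborel_affine[symmetric]) auto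
    finally show ?thesis .
  qed
  then show ?thesis using R C by blast
qed

section \<open>From energies to native seminorms\<close>

lemma separation_radius_dist:
  assumes \<Xi>: "finite \<Xi>" and q: "separation_radius \<Xi> = ereal q"
  shows "0 < q" "\<forall>\<xi>\<in>\<Xi>. \<forall>\<zeta>\<in>\<Xi>. \<xi> \<noteq> \<zeta> \<longrightarrow> 2 * q \<le> dist \<xi> \<zeta>"
proof -
  let ?I = "INF \<xi>\<in>\<Xi>. INF \<zeta>\<in>\<Xi> - {\<xi>}. ereal (dist \<xi> \<zeta>)"
  \<comment> \<open>The added 1 keeps the set nonempty, so that its minimum is meaningful; any
    positive lower bound of the distances gives \<open>0 < q\<close>.\<close>
  define D where "D = insert 1 ((\<lambda>(\<xi>, \<zeta>). dist \<xi> \<zeta>) ` {(\<xi>, \<zeta>) \<in> \<Xi> \<times> \<Xi>. \<xi> \<noteq> \<zeta>})"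
  have "finite {(\<xi>, \<zeta>) \<in> \<Xi> \<times> \<Xi>. \<xi> \<noteq> \<zeta>}"
    by (rule finite_subset[of _ "\<Xi> \<times> \<Xi>"]) (use \<Xi> in auto)
  then have D: "finite D" "D \<noteq> {}" unfolding D_def by auto
  have "Min D \<in> D" by (rule Min_in[OF D])
  then have pos: "0 < Min D" unfolding D_def by auto
  have "ereal (Min D) \<le> ?I"
  proof (intro INF_greatest)
    fix \<xi> \<zeta> assume "\<xi> \<in> \<Xi>" "\<zeta> \<in> \<Xi> - {\<xi>}"
    then have "dist \<xi> \<zeta> \<in> D" unfolding D_def by force
    then show "ereal (Min D) \<le> ereal (dist \<xi> \<zeta>)" using D by simp
  qed
  then have "ereal (1 / 2) * ereal (Min D) \<le> ereal q"
    unfolding q[symmetric] separation_radius_def by (intro ereal_mult_left_mono) simp_all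
  then show "0 < q" using pos by simp
  show "\<forall>\<xi>\<in>\<Xi>. \<forall>\<zeta>\<in>\<Xi>. \<xi> \<noteq> \<zeta> \<longrightarrow> 2 * q \<le> dist \<xi> \<zeta>"
  proof (intro ballI impI)
    fix \<xi> \<zeta> assume e: "\<xi> \<in> \<Xi>" "\<zeta> \<in> \<Xi>" "\<xi> \<noteq> \<zeta>"
    have "?I \<le> (INF \<zeta>\<in>\<Xi> - {\<xi>}. ereal (dist \<xi> \<zeta>))" by (rule INF_lower[OF e(1)])
    also have "\<dots> \<le> ereal (dist \<xi> \<zeta>)" by (rule INF_lower) (use e in auto)
    finally have "ereal q \<le> ereal (1 / 2) * ereal (dist \<xi> \<zeta>)"
      unfolding q[symmetric] separation_radius_def by (intro ereal_mult_left_mono) simp_all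
    then show "2 * q \<le> dist \<xi> \<zeta>" by simp
  qed
qed

text \<open>The definitions refer to an arbitrarily chosen transform; by almost everywhere
  uniqueness any explicitly known one computes the same integral.\<close>

lemma native_space_seminorm:
  fixes T :: "(real ^ 'n::finite \<Rightarrow> complex) \<Rightarrow> complex"
  assumes g: "has_gen_fourier (of_int m / 2) T g" and w: "w \<in> borel_measurable borel"
  shows "integrable lborel (\<lambda>\<omega>. (cmod (g \<omega>))\<^sup>2 / w \<omega>) \<Longrightarrow> T \<in> native_space m w"
    and "native_seminorm m w T = sqrt (LINT \<omega>|lborel. (cmod (g \<omega>))\<^sup>2 / w \<omega>)"
proof -
  let ?G = "gen_fourier (of_int m / 2) T"
  have G: "has_gen_fourier (of_int m / 2) T ?G"
    unfolding gen_fourier_def using g by (rule someI[where P = "has_gen_fourier (of_int m / 2) T"])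
  have [measurable]: "?G \<in> borel_measurable borel" "g \<in> borel_measurable borel"
    using G g by (auto intro: borel_measurable_punctured simp: has_gen_fourier_def)
  note w [measurable]
  have AE: "AE \<omega> in lborel. (cmod (g \<omega>))\<^sup>2 / w \<omega> = (cmod (?G \<omega>))\<^sup>2 / w \<omega>"
    using gen_fourier_unique[OF g G] by eventually_elim simp
  show "T \<in> native_space m w" if i: "integrable lborel (\<lambda>\<omega>. (cmod (g \<omega>))\<^sup>2 / w \<omega>)"
  proof -
    have "integrable lborel (\<lambda>\<omega>. (cmod (?G \<omega>))\<^sup>2 / w \<omega>)"
      by (rule integrable_cong_AE_imp[OF i]) (use AE in \<open>auto elim: eventually_mono\<close>)
    then show ?thesis using g unfolding native_space_def by blast
  qed
  show "native_seminorm m w T = sqrt (LINT \<omega>|lborel. (cmod (g \<omega>))\<^sup>2 / w \<omega>)"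
    unfolding native_seminorm_def by (subst integral_cong_AE[OF _ _ AE]) auto
qed

text \<open>Close to the origin integrability is extracted from the generalized transform itself:
  the exponential sum, its conjugate and a Gaussian form an admissible test function, as each sum
  vanishes to order \<open>m\<close>. Far out, the upper bound with \<open>2 * \<tau>\<close> above
  the dimension suffices.\<close>

lemma rbf_energy_integrable:
  fixes \<phi> \<phi>hat :: "real ^ 'n::finite \<Rightarrow> real"
  assumes gft: "has_gen_fourier (of_int m) (distr_of \<phi>) (\<lambda>\<omega>. complex_of_real (\<phi>hat \<omega>))"
    and m: "\<phi>hat \<in> borel_measurable borel" and pos: "\<And>\<omega>. \<omega> \<noteq> 0 \<Longrightarrow> 0 \<le> \<phi>hat \<omega>"
    and \<tau>: "2 * \<tau> > real CARD('n)" and C2: "0 \<le> C2"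
    and upper: "\<And>\<omega>. norm \<omega> > r0 \<Longrightarrow> \<phi>hat \<omega> \<le> C2 * norm \<omega> powr (- 2 * \<tau>)"
    and \<Xi>: "finite \<Xi>"
    and mom: "\<And>r. r \<in> polynomials (m - 1) \<Longrightarrow> (\<Sum>\<xi>\<in>\<Xi>. a \<xi> * r \<xi>) = 0"
  shows "integrable lborel (\<lambda>\<omega>. \<phi>hat \<omega> * (cmod (expsum \<Xi> a \<omega>))\<^sup>2)"
proof -
  let ?G = "\<lambda>\<omega> :: real ^ 'n. exp (- (1 * norm (\<omega> - 0))\<^sup>2 / 2)"
  \<comment> \<open>The conjugate of the exponential sum, since \<open>a\<close> is real; written as
    a sum of exponentials it is visibly in \<open>temper_mult\<close>.\<close>
  define B where "B \<omega> = (\<Sum>\<xi>\<in>\<Xi>. complex_of_real (a \<xi>) * iexp (\<omega> \<bullet> \<xi>))" for \<omega>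
  have Bt: "B \<in> temper_mult" unfolding B_def by (intro temper_mult_sum temper_mult.intros \<Xi>)
  have cB: "B \<omega> = cnj (expsum \<Xi> a \<omega>)" for \<omega> by (simp add: B_def expsum_def exp_cnj)
  note m [measurable] expsum_measurable[OF \<Xi>, measurable]
  obtain C where C: "C \<ge> 0" "\<And>\<omega>. cmod (expsum \<Xi> a \<omega>) \<le> C * norm \<omega> ^ nat m"
    using expsum_vanishing[OF \<Xi> mom] by blast
  have test: "(\<lambda>\<omega>. B \<omega> * complex_of_real (?G \<omega>)) \<in> schwartz_vanishing (of_int m)"
  proof (rule schwartz_vanishingI)
    show "(\<lambda>\<omega>. B \<omega> * complex_of_real (?G \<omega>)) \<in> schwartz" by (rule schwartz_gauss[OF _ Bt]) simp
    show "(\<lambda>\<omega>. complex_of_real C * complex_of_real (?G \<omega>)) \<in> schwartz" by (rule schwartz_gauss[OF _ temper_mult.const]) simp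
    show "of_int m \<le> real (nat m)" by linarith
    show "cmod (B \<omega> * complex_of_real (?G \<omega>)) \<le> norm \<omega> powr real (nat m) * cmod (complex_of_real C * complex_of_real (?G \<omega>))" if "\<omega> \<noteq> 0" for \<omega>
      using C(1) mult_right_mono[OF C(2)[of \<omega>], of "?G \<omega>"] that
      by (simp add: cB norm_mult powr_realpow mult_ac)
  qed
  have "(\<lambda>\<omega>. expsum \<Xi> a \<omega> * (B \<omega> * complex_of_real (?G \<omega>))) \<in> schwartz_vanishing (2 * of_int m)"
    by (rule expsum_mult_vanishing[OF \<Xi> mom test])
  note t = gft[unfolded has_gen_fourier_def, THEN conjunct2, THEN conjunct2, rule_format, OF this]
  have "integrable lborel (\<lambda>\<omega>. complex_of_real (\<phi>hat \<omega>) * (expsum \<Xi> a \<omega> * (B \<omega> * complex_of_real (?G \<omega>))))"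
    by (rule t[THEN conjunct1])
  also have "(\<lambda>\<omega>. complex_of_real (\<phi>hat \<omega>) * (expsum \<Xi> a \<omega> * (B \<omega> * complex_of_real (?G \<omega>)))) =
      (\<lambda>\<omega>. complex_of_real (\<phi>hat \<omega> * (cmod (expsum \<Xi> a \<omega>))\<^sup>2 * ?G \<omega>))"
    unfolding cB of_real_mult complex_norm_square by (simp only: mult.assoc)
  finally have near: "integrable lborel (\<lambda>\<omega>. \<phi>hat \<omega> * (cmod (expsum \<Xi> a \<omega>))\<^sup>2 * ?G \<omega>)"
    by (auto dest: integrable_Re)
  define \<rho> where "\<rho> = max r0 1"
  define A where "A = (\<Sum>\<xi>\<in>\<Xi>. \<bar>a \<xi>\<bar>)"
  have far: "integrable lborel (\<lambda>\<omega> :: real ^ 'n. (1 + norm \<omega>) powr (- (2 * \<tau>)))"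
    by (rule integrable_japanese_bracket) (use \<tau> in simp)
  \<comment> \<open>Beyond \<rho> >= 1 one has |\<omega>| >= (1 + |\<omega>|)/2, which costs the
    power of 2; \<open>A\<close> bounds the exponential sum everywhere.\<close>
  define K where "K = C2 * 2 powr (2 * \<tau>) * A\<^sup>2"
  have K: "K \<ge> 0" using C2 by (simp add: K_def)
  have bound: "norm (\<phi>hat \<omega> * (cmod (expsum \<Xi> a \<omega>))\<^sup>2) \<le>
      norm (exp (\<rho>\<^sup>2 / 2) * (\<phi>hat \<omega> * (cmod (expsum \<Xi> a \<omega>))\<^sup>2 * ?G \<omega>) + K * (1 + norm \<omega>) powr (- (2 * \<tau>)))"
    if w: "\<omega> \<noteq> 0" for \<omega>
  proof -
    let ?h = "\<phi>hat \<omega> * (cmod (expsum \<Xi> a \<omega>))\<^sup>2"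
    have h: "0 \<le> ?h" using pos[OF w] by simp
    have "?h \<le> exp (\<rho>\<^sup>2 / 2) * (?h * ?G \<omega>) + K * (1 + norm \<omega>) powr (- (2 * \<tau>))"
    proof (cases "norm \<omega> \<le> \<rho>")
      case True
      then have "(norm \<omega>)\<^sup>2 \<le> \<rho>\<^sup>2" by (intro power_mono) auto
      then have "1 \<le> exp (\<rho>\<^sup>2 / 2) * ?G \<omega>" by (simp add: exp_add[symmetric])
      from mult_left_mono[OF this h] have "?h \<le> exp (\<rho>\<^sup>2 / 2) * (?h * ?G \<omega>)" by (simp add: mult_ac)
      moreover have "0 \<le> K * (1 + norm \<omega>) powr (- (2 * \<tau>))" using K by simp
      ultimately show ?thesis by linarith
    next
      case False
      then have n: "norm \<omega> > r0" "norm \<omega> > 1" by (auto simp: \<rho>_def)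
      have "\<phi>hat \<omega> \<le> C2 * norm \<omega> powr (- (2 * \<tau>))" using upper[OF n(1)] by simp
      also have "norm \<omega> powr (- (2 * \<tau>)) \<le> ((1 + norm \<omega>) / 2) powr (- (2 * \<tau>))"
        using n \<tau> by (intro powr_mono2') auto
      also have "((1 + norm \<omega>) / 2) powr (- (2 * \<tau>)) = 2 powr (2 * \<tau>) * (1 + norm \<omega>) powr (- (2 * \<tau>))"
        by (simp add: powr_divide powr_minus field_simps add_nonneg_nonneg)
      finally have 1: "\<phi>hat \<omega> \<le> C2 * (2 powr (2 * \<tau>) * (1 + norm \<omega>) powr (- (2 * \<tau>)))"
        using C2 by (simp add: mult_left_mono)
      have 2: "(cmod (expsum \<Xi> a \<omega>))\<^sup>2 \<le> A\<^sup>2"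
        unfolding A_def by (intro power_mono expsum_le_sum_abs) auto
      have "?h \<le> C2 * (2 powr (2 * \<tau>) * (1 + norm \<omega>) powr (- (2 * \<tau>))) * A\<^sup>2"
        using C2 by (intro mult_mono 1 2) auto
      also have "\<dots> = K * (1 + norm \<omega>) powr (- (2 * \<tau>))" by (simp add: K_def mult_ac)
      moreover have "0 \<le> exp (\<rho>\<^sup>2 / 2) * (?h * ?G \<omega>)" by (intro mult_nonneg_nonneg h) auto
      ultimately show ?thesis by linarith
    qed
    with h show ?thesis by simp
  qed
  show ?thesis
  proof (rule Bochner_Integration.integrable_bound)
    show "integrable lborel (\<lambda>\<omega>. exp (\<rho>\<^sup>2 / 2) * (\<phi>hat \<omega> * (cmod (expsum \<Xi> a \<omega>))\<^sup>2 * ?G \<omega>) + K * (1 + norm \<omega>) powr (- (2 * \<tau>)))"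
      by (intro Bochner_Integration.integrable_add integrable_mult_right near far)
    show "AE \<omega> in lborel. norm (\<phi>hat \<omega> * (cmod (expsum \<Xi> a \<omega>))\<^sup>2) \<le>
      norm (exp (\<rho>\<^sup>2 / 2) * (\<phi>hat \<omega> * (cmod (expsum \<Xi> a \<omega>))\<^sup>2 * ?G \<omega>) + K * (1 + norm \<omega>) powr (- (2 * \<tau>)))"
      using AE_lborel_singleton[of "0 :: real ^ 'n"] by eventually_elim (rule bound)
  qed measurable
qed

text \<open>The powers of q match as follows. Low frequencies lose q^(-2s) from the weight. High
  frequencies gain q^p from the tail estimate and lose q^(-2 tau) when the lower bound for phihat
  turns the energy of the sum back into weighted energy; p - 2 tau = -2s.\<close>

lemma rbf_energy_bernstein:
  fixes \<phi>hat :: "real ^ 'n::finite \<Rightarrow> real"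
  assumes C: "0 < C1" "C1 \<le> C2"
    and m: "\<phi>hat \<in> borel_measurable borel"
    and lower: "\<And>\<omega>. \<omega> \<noteq> 0 \<Longrightarrow> C1 * (1 + (norm \<omega>)\<^sup>2) powr (- \<tau>) \<le> \<phi>hat \<omega>"
    and upper: "\<And>\<omega>. norm \<omega> > r0 \<Longrightarrow> \<phi>hat \<omega> \<le> C2 * norm \<omega> powr (- 2 * \<tau>)"
    and s: "0 \<le> s" "s < \<tau> - real CARD('n) / 2"
  shows "\<exists>K\<ge>0. \<forall>\<Xi> (a :: real ^ 'n \<Rightarrow> real) q. finite \<Xi> \<longrightarrow> 0 < q \<longrightarrow> q < 1 \<longrightarrow>
     (\<forall>\<xi>\<in>\<Xi>. \<forall>\<zeta>\<in>\<Xi>. \<xi> \<noteq> \<zeta> \<longrightarrow> 2 * q \<le> dist \<xi> \<zeta>) \<longrightarrow>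
     (\<integral>\<^sup>+\<omega>. ennreal ((1 + (norm \<omega>)\<^sup>2) powr s * (\<phi>hat \<omega> * (cmod (expsum \<Xi> a \<omega>))\<^sup>2)) \<partial>lborel) \<le>
     ennreal (K * q powr (- 2 * s)) * (\<integral>\<^sup>+\<omega>. ennreal (\<phi>hat \<omega> * (cmod (expsum \<Xi> a \<omega>))\<^sup>2) \<partial>lborel)"
proof -
  \<comment> \<open>Decay exponent of the weight times \<open>\<phi>hat\<close> at high frequencies;
    the bound on \<open>s\<close> says exactly that \<open>p\<close> exceeds the dimension.\<close>
  define p where "p = 2 * \<tau> - 2 * s"
  have p: "p > real CARD('n)" using s by (simp add: p_def)
  have \<tau>: "\<tau> > 0" using s by (smt (verit) of_nat_0_le_iff divide_nonneg_nonneg)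
  have pos: "0 < \<phi>hat \<omega>" if "\<omega> \<noteq> 0" for \<omega>
  proof -
    have "0 < 1 + (norm \<omega>)\<^sup>2" by (simp add: add_pos_nonneg)
    then have "0 < C1 * (1 + (norm \<omega>)\<^sup>2) powr (- \<tau>)" using C(1) by simp
    with lower[OF that] show ?thesis by linarith
  qed
  obtain R D where R: "R \<ge> max r0 1" and D: "D \<ge> 0"
    and tail': "\<forall>\<Xi> (a :: real ^ 'n \<Rightarrow> real) q. finite \<Xi> \<longrightarrow> 0 < q \<longrightarrow>
     (\<forall>\<xi>\<in>\<Xi>. \<forall>\<zeta>\<in>\<Xi>. \<xi> \<noteq> \<zeta> \<longrightarrow> 2 * q \<le> dist \<xi> \<zeta>) \<longrightarrow>
     (\<integral>\<^sup>+\<omega>. ennreal (norm \<omega> powr (- p) * (cmod (expsum \<Xi> a \<omega>))\<^sup>2) * indicator {\<omega>. norm \<omega> > R / q} \<omega> \<partial>lborel) \<le>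
     ennreal (D * q powr p) * (\<integral>\<^sup>+\<omega>. ennreal ((cmod (expsum \<Xi> a \<omega>))\<^sup>2) * indicator {\<omega>. norm \<omega> \<le> R / q} \<omega> \<partial>lborel)"
    using expsum_tail_energy_scaled[OF p, of "max r0 1"] by (elim exE conjE)
  note tail = tail'[THEN spec, THEN spec, THEN spec, THEN mp, THEN mp, THEN mp]
  \<comment> \<open>\<open>L\<close> belongs to the weight at low frequencies, \<open>M\<close> to
    the weighted \<open>\<phi>hat\<close> at high ones, and \<open>N\<close> to the reciprocal of
    the lower bound for \<open>\<phi>hat\<close> at low ones.\<close>
  define L where "L = (1 + R\<^sup>2) powr s"
  define M where "M = C2 * 2 powr s"
  define N where "N = (1 + R\<^sup>2) powr \<tau> / C1"
  have LMN: "L \<ge> 0" "M \<ge> 0" "N \<ge> 0" using C by (auto simp: L_def M_def N_def)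
  have "(\<integral>\<^sup>+\<omega>. ennreal ((1 + (norm \<omega>)\<^sup>2) powr s * (\<phi>hat \<omega> * (cmod (expsum \<Xi> a \<omega>))\<^sup>2)) \<partial>lborel) \<le>
     ennreal ((L + M * D * N) * q powr (- 2 * s)) * (\<integral>\<^sup>+\<omega>. ennreal (\<phi>hat \<omega> * (cmod (expsum \<Xi> a \<omega>))\<^sup>2) \<partial>lborel)"
    if \<Xi>: "finite \<Xi>" and q: "0 < q" "q < 1" and sep: "\<forall>\<xi>\<in>\<Xi>. \<forall>\<zeta>\<in>\<Xi>. \<xi> \<noteq> \<zeta> \<longrightarrow> 2 * q \<le> dist \<xi> \<zeta>"
    for \<Xi> and a :: "real ^ 'n \<Rightarrow> real" and q
  proof -
    define E where "E \<omega> = (cmod (expsum \<Xi> a \<omega>))\<^sup>2" for \<omega>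
    have E0: "E \<omega> \<ge> 0" for \<omega> by (simp add: E_def)
    note m [measurable] expsum_measurable[OF \<Xi>, measurable]
    have [measurable]: "E \<in> borel_measurable borel" unfolding E_def by measurable
    define I where "I = (\<integral>\<^sup>+\<omega>. ennreal (\<phi>hat \<omega> * E \<omega>) \<partial>lborel)"
    have q2: "q\<^sup>2 \<le> 1" "0 < q\<^sup>2" using q by (auto simp: power_le_one)
    have bracket: "(1 + (norm \<omega>)\<^sup>2) powr r \<le> (1 + R\<^sup>2) powr r * q powr (- 2 * r)"
      if "norm \<omega> \<le> R / q" "r \<ge> 0" for \<omega> :: "real ^ 'n" and r
    proof -
      have "(norm \<omega>)\<^sup>2 \<le> (R / q)\<^sup>2" using that(1) by (intro power_mono) auto
      moreover have "1 \<le> 1 / q\<^sup>2" using q2 by simp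
      ultimately have "1 + (norm \<omega>)\<^sup>2 \<le> (1 + R\<^sup>2) / q\<^sup>2" by (simp add: power_divide add_divide_distrib)
      then have "(1 + (norm \<omega>)\<^sup>2) powr r \<le> ((1 + R\<^sup>2) / q\<^sup>2) powr r"
        using that(2) by (intro powr_mono2) (auto simp: add_nonneg_nonneg)
      also have "\<dots> = (1 + R\<^sup>2) powr r / (q\<^sup>2) powr r"
        by (rule powr_divide)
      also have "(q\<^sup>2) powr r = q powr (2 * r)"
        using q powr_powr[of q 2 r] by simp
      finally show ?thesis by (simp add: powr_minus divide_inverse)
    qed
    have "(\<integral>\<^sup>+\<omega>. ennreal ((1 + (norm \<omega>)\<^sup>2) powr s * (\<phi>hat \<omega> * E \<omega>)) \<partial>lborel) \<le>
      (\<integral>\<^sup>+\<omega>. ennreal (L * q powr (- 2 * s)) * ennreal (\<phi>hat \<omega> * E \<omega>) +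
        ennreal M * (ennreal (norm \<omega> powr (- p) * E \<omega>) * indicator {\<omega>. norm \<omega> > R / q} \<omega>) \<partial>lborel)"
    proof (rule nn_integral_mono_AE, use AE_lborel_singleton[of "0 :: real ^ 'n"] in eventually_elim)
      fix \<omega> :: "real ^ 'n" assume w: "\<omega> \<noteq> 0"
      have h: "0 \<le> \<phi>hat \<omega> * E \<omega>" using pos[OF w] E0 by simp
      show "ennreal ((1 + (norm \<omega>)\<^sup>2) powr s * (\<phi>hat \<omega> * E \<omega>)) \<le>
        ennreal (L * q powr (- 2 * s)) * ennreal (\<phi>hat \<omega> * E \<omega>) +
        ennreal M * (ennreal (norm \<omega> powr (- p) * E \<omega>) * indicator {\<omega>. norm \<omega> > R / q} \<omega>)"
      proof (cases "norm \<omega> \<le> R / q")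
        case True
        have "(1 + (norm \<omega>)\<^sup>2) powr s * (\<phi>hat \<omega> * E \<omega>) \<le> (L * q powr (- 2 * s)) * (\<phi>hat \<omega> * E \<omega>)"
          unfolding L_def by (intro mult_right_mono bracket True s h)
        then show ?thesis using True LMN h by (simp add: ennreal_mult'[symmetric] ennreal_leI)
      next
        case False
        \<comment> \<open>Because q < 1, the high frequencies lie beyond both r0 and 1: the upper
          bound for \<open>\<phi>hat\<close> holds there, and 1 + |\<omega>|^2 <= 2
          |\<omega>|^2.\<close>
        have "R \<le> R / q" using q R by (simp add: pos_le_divide_eq mult_left_le)
        with False R have n: "norm \<omega> > r0" "norm \<omega> \<ge> 1" by auto
        have "1 \<le> (norm \<omega>)\<^sup>2" using n(2) by (simp add: one_le_power)
        then have "(1 + (norm \<omega>)\<^sup>2) powr s \<le> (2 * (norm \<omega>)\<^sup>2) powr s"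
          using s by (intro powr_mono2) auto
        also have "\<dots> = 2 powr s * norm \<omega> powr (2 * s)"
        proof -
          have "((norm \<omega>)\<^sup>2) powr s = norm \<omega> powr (2 * s)"
            using powr_powr[of "norm \<omega>" 2 s] n by simp
          then show ?thesis by (simp add: powr_mult)
        qed
        finally have "(1 + (norm \<omega>)\<^sup>2) powr s * (\<phi>hat \<omega> * E \<omega>) \<le>
            (2 powr s * norm \<omega> powr (2 * s)) * ((C2 * norm \<omega> powr (- 2 * \<tau>)) * E \<omega>)"
          using upper[OF n(1)] E0 pos[OF w] C by (intro mult_mono) auto
        also have "\<dots> = M * ((norm \<omega> powr (2 * s) * norm \<omega> powr (- 2 * \<tau>)) * E \<omega>)"
          by (simp only: M_def mult_ac)
        also have "norm \<omega> powr (2 * s) * norm \<omega> powr (- 2 * \<tau>) = norm \<omega> powr (- p)"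
          unfolding powr_add[symmetric] by (simp add: p_def)
        finally have "ennreal ((1 + (norm \<omega>)\<^sup>2) powr s * (\<phi>hat \<omega> * E \<omega>)) \<le> ennreal M * ennreal (norm \<omega> powr (- p) * E \<omega>)"
          using LMN E0 by (simp add: ennreal_mult'[symmetric] ennreal_leI)
        also have "\<dots> \<le> ennreal (L * q powr (- 2 * s)) * ennreal (\<phi>hat \<omega> * E \<omega>) + ennreal M * ennreal (norm \<omega> powr (- p) * E \<omega>)"
          by simp
        finally show ?thesis using False by simp
      qed
    qed
    also have "\<dots> = ennreal (L * q powr (- 2 * s)) * I +
        ennreal M * (\<integral>\<^sup>+\<omega>. ennreal (norm \<omega> powr (- p) * E \<omega>) * indicator {\<omega>. norm \<omega> > R / q} \<omega> \<partial>lborel)"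
      unfolding I_def by (subst nn_integral_add) (simp_all add: nn_integral_cmult)
    also have "\<dots> \<le> ennreal (L * q powr (- 2 * s)) * I +
        ennreal M * (ennreal (D * q powr p) * (\<integral>\<^sup>+\<omega>. ennreal (E \<omega>) * indicator {\<omega>. norm \<omega> \<le> R / q} \<omega> \<partial>lborel))"
      unfolding E_def by (intro add_left_mono mult_left_mono tail \<Xi> q sep) simp
    also have "\<dots> \<le> ennreal (L * q powr (- 2 * s)) * I +
        ennreal M * (ennreal (D * q powr p) * (\<integral>\<^sup>+\<omega>. ennreal (N * q powr (- 2 * \<tau>)) * ennreal (\<phi>hat \<omega> * E \<omega>) \<partial>lborel))"
    proof (intro add_left_mono mult_left_mono nn_integral_mono_AE,
        use AE_lborel_singleton[of "0 :: real ^ 'n"] in eventually_elim)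
      fix \<omega> :: "real ^ 'n" assume w: "\<omega> \<noteq> 0"
      show "ennreal (E \<omega>) * indicator {\<omega>. norm \<omega> \<le> R / q} \<omega> \<le> ennreal (N * q powr (- 2 * \<tau>)) * ennreal (\<phi>hat \<omega> * E \<omega>)"
      proof (cases "norm \<omega> \<le> R / q")
        case True
        have b0: "0 < (1 + (norm \<omega>)\<^sup>2) powr \<tau>" by (simp add: add_pos_nonneg add_nonneg_eq_0_iff)
        have "1 = (1 + (norm \<omega>)\<^sup>2) powr \<tau> / C1 * (C1 * (1 + (norm \<omega>)\<^sup>2) powr (- \<tau>))"
          using C b0 by (simp add: powr_minus)
        also have "\<dots> \<le> (N * q powr (- 2 * \<tau>)) * \<phi>hat \<omega>"
        proof (rule mult_mono)
          show "(1 + (norm \<omega>)\<^sup>2) powr \<tau> / C1 \<le> N * q powr (- 2 * \<tau>)"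
            using divide_right_mono[OF bracket[OF True, of \<tau>], of C1] \<tau> C by (simp add: N_def)
        qed (use lower[OF w] LMN C in auto)
        finally have "1 * E \<omega> \<le> (N * q powr (- 2 * \<tau>)) * \<phi>hat \<omega> * E \<omega>"
          by (rule mult_right_mono) (rule E0)
        then show ?thesis using True LMN by (simp add: ennreal_mult'[symmetric] mult.assoc ennreal_leI)
      qed simp
    qed simp_all
    also have "\<dots> = ennreal (L * q powr (- 2 * s)) * I +
        ennreal M * (ennreal (D * q powr p) * (ennreal (N * q powr (- 2 * \<tau>)) * I))"
      unfolding I_def by (subst nn_integral_cmult) simp_all
    also have "\<dots> = ennreal (L * q powr (- 2 * s) + M * (D * q powr p * (N * q powr (- 2 * \<tau>)))) * I"
      using LMN D by (subst ennreal_plus) (simp_all add: distrib_right ennreal_mult' mult.assoc)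
    also have "L * q powr (- 2 * s) + M * (D * q powr p * (N * q powr (- 2 * \<tau>))) = (L + M * D * N) * q powr (- 2 * s)"
    proof -
      have "q powr p * q powr (- 2 * \<tau>) = q powr (- 2 * s)"
        unfolding powr_add[symmetric] by (simp add: p_def)
      then have "M * (D * q powr p * (N * q powr (- 2 * \<tau>))) = M * D * N * q powr (- 2 * s)"
        by (metis (no_types, opaque_lifting) mult.assoc mult.left_commute)
      then show ?thesis by (simp only: distrib_right)
    qed
    finally show ?thesis by (simp only: I_def E_def)
  qed
  moreover have "L + M * D * N \<ge> 0" using LMN D by simp
  ultimately show ?thesis by blast
qed

text \<open>\<open>q\<close> is a real number, so sets with at most one point, whose separation
  radius is infinite, fall outside its range. Membership in \<open>native_space\<close> is part of
  the claim because the seminorm has a meaning only there. The constant is the square root of the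
  one in the energy inequality.\<close>

theorem theorem3p1:
  fixes \<phi> \<phi>hat :: "real ^ 'n \<Rightarrow> real" and m0 :: int and \<tau> s C1 C2 r0 :: real
  assumes rbf: "radial_basis_function m0 \<phi>"
    and cont: "continuous_on UNIV \<phi>"
    and growth: "algebraic_growth \<phi>"
    and gft: "has_gen_fourier (of_int m0) (distr_of \<phi>) (\<lambda>\<omega>. complex_of_real (\<phi>hat \<omega>))"
    and gft_cont: "continuous_on (- {0}) \<phi>hat"
    and \<tau>: "\<tau> > real CARD('n) / 2"
    and C12: "0 < C1" "C1 \<le> C2" "r0 > 0"
    and lower: "\<And>\<omega>. \<omega> \<noteq> 0 \<Longrightarrow> C1 * (1 + (norm \<omega>)\<^sup>2) powr (- \<tau>) \<le> \<phi>hat \<omega>"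
    and upper: "\<And>\<omega>. norm \<omega> > r0 \<Longrightarrow> \<phi>hat \<omega> \<le> C2 * norm \<omega> powr (- 2 * \<tau>)"
    and s: "0 \<le> s" "s < \<tau> - real CARD('n) / 2"
  shows "\<exists>C. \<forall>\<Xi> q. finite \<Xi> \<longrightarrow> separation_radius \<Xi> = ereal q \<longrightarrow> q < 1 \<longrightarrow>
           (\<forall>u\<in>rbf_space m0 \<phi> \<Xi>.
              distr_of u \<in> native_space m0 \<phi>hat \<and>
              bessel_potential s (distr_of u) \<in> native_space m0 \<phi>hat \<and>
              native_seminorm m0 \<phi>hat (bessel_potential s (distr_of u))
                \<le> C * q powr (- s) * native_seminorm m0 \<phi>hat (distr_of u))"
proof -
  have "(\<lambda>\<omega>. complex_of_real (\<phi>hat \<omega>)) \<in> borel_measurable borel"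
    using gft by (intro borel_measurable_punctured) (simp add: has_gen_fourier_def)
  then have "(\<lambda>\<omega>. Re (complex_of_real (\<phi>hat \<omega>))) \<in> borel_measurable borel" by measurable
  then have m [measurable]: "\<phi>hat \<in> borel_measurable borel" by simp
  have pos: "0 < \<phi>hat \<omega>" if "\<omega> \<noteq> 0" for \<omega>
  proof -
    have "0 < 1 + (norm \<omega>)\<^sup>2" by (simp add: add_pos_nonneg)
    then have "0 < C1 * (1 + (norm \<omega>)\<^sup>2) powr (- \<tau>)" using C12(1) by simp
    with lower[OF that] show ?thesis by linarith
  qed
  have "\<exists>K\<ge>0. \<forall>\<Xi> (a :: real ^ 'n \<Rightarrow> real) q. finite \<Xi> \<longrightarrow> 0 < q \<longrightarrow> q < 1 \<longrightarrow>
     (\<forall>\<xi>\<in>\<Xi>. \<forall>\<zeta>\<in>\<Xi>. \<xi> \<noteq> \<zeta> \<longrightarrow> 2 * q \<le> dist \<xi> \<zeta>) \<longrightarrow>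
     (\<integral>\<^sup>+\<omega>. ennreal ((1 + (norm \<omega>)\<^sup>2) powr s * (\<phi>hat \<omega> * (cmod (expsum \<Xi> a \<omega>))\<^sup>2)) \<partial>lborel) \<le>
     ennreal (K * q powr (- 2 * s)) * (\<integral>\<^sup>+\<omega>. ennreal (\<phi>hat \<omega> * (cmod (expsum \<Xi> a \<omega>))\<^sup>2) \<partial>lborel)"
    by (rule rbf_energy_bernstein[OF C12(1,2) m lower upper s])
  then obtain K where K: "K \<ge> 0" and bern': "\<forall>\<Xi> (a :: real ^ 'n \<Rightarrow> real) q. finite \<Xi> \<longrightarrow> 0 < q \<longrightarrow> q < 1 \<longrightarrow>
     (\<forall>\<xi>\<in>\<Xi>. \<forall>\<zeta>\<in>\<Xi>. \<xi> \<noteq> \<zeta> \<longrightarrow> 2 * q \<le> dist \<xi> \<zeta>) \<longrightarrow>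
     (\<integral>\<^sup>+\<omega>. ennreal ((1 + (norm \<omega>)\<^sup>2) powr s * (\<phi>hat \<omega> * (cmod (expsum \<Xi> a \<omega>))\<^sup>2)) \<partial>lborel) \<le>
     ennreal (K * q powr (- 2 * s)) * (\<integral>\<^sup>+\<omega>. ennreal (\<phi>hat \<omega> * (cmod (expsum \<Xi> a \<omega>))\<^sup>2) \<partial>lborel)"
    by (elim exE conjE)
  note bern = bern'[THEN spec, THEN spec, THEN spec, THEN mp, THEN mp, THEN mp, THEN mp]
  have "distr_of u \<in> native_space m0 \<phi>hat \<and>
      bessel_potential s (distr_of u) \<in> native_space m0 \<phi>hat \<and>
      native_seminorm m0 \<phi>hat (bessel_potential s (distr_of u))
        \<le> sqrt K * q powr (- s) * native_seminorm m0 \<phi>hat (distr_of u)"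
    if \<Xi>: "finite \<Xi>" and sep: "separation_radius \<Xi> = ereal q" and q1: "q < 1" and u: "u \<in> rbf_space m0 \<phi> \<Xi>" for \<Xi> q u
  proof -
    note q = separation_radius_dist[OF \<Xi> sep]
    from u obtain a p where p: "p \<in> polynomials (m0 - 1)"
      and mom: "\<And>r. r \<in> polynomials (m0 - 1) \<Longrightarrow> (\<Sum>\<xi>\<in>\<Xi>. a \<xi> * r \<xi>) = 0"
      and ue: "u = (\<lambda>x. (\<Sum>\<xi>\<in>\<Xi>. a \<xi> * \<phi> (x - \<xi>)) + p x)"
      unfolding rbf_space_def by blast
    define E where "E \<omega> = (cmod (expsum \<Xi> a \<omega>))\<^sup>2" for \<omega>
    note expsum_measurable[OF \<Xi>, measurable]
    have [measurable]: "E \<in> borel_measurable borel" unfolding E_def by measurable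
    have gu: "has_gen_fourier (of_int m0 / 2) (distr_of u) (\<lambda>\<omega>. complex_of_real (\<phi>hat \<omega>) * expsum \<Xi> a \<omega>)"
      unfolding ue by (rule has_gen_fourier_rbf[OF growth cont gft \<Xi> mom p])
    note gJ = has_gen_fourier_bessel_potential[OF gu, of s]
    have nz: "AE \<omega> in lborel. \<omega> \<noteq> (0 :: real ^ 'n)" by (rule AE_lborel_singleton)
    let ?U = "\<lambda>\<omega>. \<phi>hat \<omega> * E \<omega>" and ?J = "\<lambda>\<omega>. (1 + (norm \<omega>)\<^sup>2) powr s * (\<phi>hat \<omega> * E \<omega>)"
    \<comment> \<open>The integrands of the two squared seminorms; off the origin
      \<open>\<phi>hat\<close> is positive, and one factor cancels to give \<open>?U\<close> and
      \<open>?J\<close>.\<close>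
    let ?gu = "\<lambda>\<omega>. (cmod (complex_of_real (\<phi>hat \<omega>) * expsum \<Xi> a \<omega>))\<^sup>2 / \<phi>hat \<omega>"
    let ?gJ = "\<lambda>\<omega>. (cmod (complex_of_real ((1 + (norm \<omega>)\<^sup>2) powr (s / 2)) * (complex_of_real (\<phi>hat \<omega>) * expsum \<Xi> a \<omega>)))\<^sup>2 / \<phi>hat \<omega>"
    have AEu: "AE \<omega> in lborel. ?U \<omega> = ?gu \<omega>"
      using nz
    proof eventually_elim
      case (elim \<omega>)
      then show ?case using pos[OF elim] by (simp add: E_def norm_mult power_mult_distrib power2_eq_square)
    qed
    have AEJ: "AE \<omega> in lborel. ?J \<omega> = ?gJ \<omega>"
      using AEu
    proof eventually_elim
      case (elim \<omega>)
      have "((1 + (norm \<omega>)\<^sup>2) powr (s / 2))\<^sup>2 = (1 + (norm \<omega>)\<^sup>2) powr s"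
        unfolding power2_eq_square powr_add[symmetric] by simp
      moreover have "?gJ \<omega> = ((1 + (norm \<omega>)\<^sup>2) powr (s / 2))\<^sup>2 * ?gu \<omega>"
        by (simp add: norm_mult power_mult_distrib)
      ultimately show ?case unfolding elim by (simp only:)
    qed
    have Ui: "integrable lborel ?U"
      unfolding E_def using \<tau> C12
      by (intro rbf_energy_integrable[OF gft m _ _ _ upper \<Xi> mom]) (auto intro: less_imp_le pos)
    have U0: "AE \<omega> in lborel. 0 \<le> ?U \<omega>"
      using nz by eventually_elim (simp add: E_def less_imp_le pos)
    have J0: "AE \<omega> in lborel. 0 \<le> ?J \<omega>" using U0 by eventually_elim simp
    have "(\<integral>\<^sup>+\<omega>. ennreal (?J \<omega>) \<partial>lborel) \<le> ennreal (K * q powr (- 2 * s)) * (\<integral>\<^sup>+\<omega>. ennreal (?U \<omega>) \<partial>lborel)"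
      unfolding E_def by (rule bern[OF \<Xi> q(1) q1 q(2)])
    also have "(\<integral>\<^sup>+\<omega>. ennreal (?U \<omega>) \<partial>lborel) = ennreal (LINT \<omega>|lborel. ?U \<omega>)"
      by (rule nn_integral_eq_integral[OF Ui U0])
    also have "ennreal (K * q powr (- 2 * s)) * ennreal (LINT \<omega>|lborel. ?U \<omega>) = ennreal (K * q powr (- 2 * s) * (LINT \<omega>|lborel. ?U \<omega>))"
      using K integral_nonneg_AE[OF U0] by (simp add: ennreal_mult')
    finally have le: "(\<integral>\<^sup>+\<omega>. ennreal (?J \<omega>) \<partial>lborel) \<le> ennreal (K * q powr (- 2 * s) * (LINT \<omega>|lborel. ?U \<omega>))" .
    \<comment> \<open>The inequality between nonnegative integrals already shows that the left side
      is finite. This yields the membership of the potential in the native space before the estimate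
      is restated for real integrals.\<close>
    have Ji: "integrable lborel ?J"
      using le J0 by (intro integrableI_nonneg) (auto intro: order_le_less_trans)
    have "ennreal (LINT \<omega>|lborel. ?J \<omega>) \<le> ennreal (K * q powr (- 2 * s) * (LINT \<omega>|lborel. ?U \<omega>))"
      using le nn_integral_eq_integral[OF Ji J0] by simp
    then have int_le: "(LINT \<omega>|lborel. ?J \<omega>) \<le> K * q powr (- 2 * s) * (LINT \<omega>|lborel. ?U \<omega>)"
      using K integral_nonneg_AE[OF U0] by (subst (asm) ennreal_le_iff) auto
    have iu: "integrable lborel ?gu" and vu: "(LINT \<omega>|lborel. ?gu \<omega>) = (LINT \<omega>|lborel. ?U \<omega>)"
      using integrable_cong_AE_imp[OF Ui _ AEu] integral_cong_AE[OF _ _ AEu] by simp_all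
    have iJ: "integrable lborel ?gJ" and vJ: "(LINT \<omega>|lborel. ?gJ \<omega>) = (LINT \<omega>|lborel. ?J \<omega>)"
      using integrable_cong_AE_imp[OF Ji _ AEJ] integral_cong_AE[OF _ _ AEJ] by simp_all
    have sq: "sqrt (q powr (- 2 * s)) = q powr (- s)"
      using q(1) by (simp add: powr_half_sqrt[symmetric] powr_powr)
    have "native_seminorm m0 \<phi>hat (bessel_potential s (distr_of u)) = sqrt (LINT \<omega>|lborel. ?J \<omega>)"
      using native_space_seminorm(2)[OF gJ m] vJ by simp
    also have "\<dots> \<le> sqrt (K * q powr (- 2 * s) * (LINT \<omega>|lborel. ?U \<omega>))"
      by (rule real_sqrt_le_mono[OF int_le])
    also have "\<dots> = sqrt K * q powr (- s) * sqrt (LINT \<omega>|lborel. ?U \<omega>)"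
      by (simp only: real_sqrt_mult sq)
    also have "sqrt (LINT \<omega>|lborel. ?U \<omega>) = native_seminorm m0 \<phi>hat (distr_of u)"
      using native_space_seminorm(2)[OF gu m] vu by simp
    finally show ?thesis
      using native_space_seminorm(1)[OF gu m iu] native_space_seminorm(1)[OF gJ m iJ] by blast
  qed
  then show ?thesis by blast
qed

end
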